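(* Let $\mathcal{E}$ be a local Dirichlet form on $L_2(X)$ satisfying the standing assumptions of the context, let $H$ be the associated submarkovian operator, and let $\eta\in B_{\rm loc}(\mathcal{E})$ be positive ($\eta\ge 0$). Assume: (I) $\mathcal{E}$ satisfies the $\eta$-Hardy inequality, i.e. $\eta\, D(\mathcal{E})\subseteq L_2(X)$ and $\mathcal{E}(\varphi)\geq(\eta\varphi,\eta\varphi)$ for all $\varphi\in D(\mathcal{E})$; (II) there is a $\gamma\in(0,1)$ such that $\mathcal{E}_{\varphi^2}(\eta)\leq\gamma\,(\eta^2\varphi,\eta^2\varphi)$ for all $\varphi\in B_c(\mathcal{E})$; (III) there exists a net $\{\rho_\alpha\}$ with $\rho_\alpha\in B_c(\mathcal{E})$, $0\leq\rho_\alpha\leq1$, such that $$\lim_\alpha(\varphi,\rho_\alpha\varphi)=(\varphi,\varphi)\quad\text{and}\quad\lim_\alpha\mathcal{E}_{\varphi^2}(\rho_\alpha)=0$$ for all $\varphi\in B(\mathcal{E})$. Then $\mathcal{E}$ satisfies the $\eta$-Rellich inequality with constant $\sigma=(1-\gamma)^2$, i.e. $\eta^2D(H)\subseteq L_2(X)$ and $$(H\varphi,H\varphi)\geq(1-\gamma)^2\,(\eta^2\varphi,\eta^2\varphi)$$ for all $\varphi\in D(H)$.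
   Context: $X$ is a locally compact $\sigma$-compact metric space and $\mu$ a positive Radon measure on $X$ with $\operatorname{supp}\mu=X$. All $L_p(X)=L_p(X;\mu)$ are real and $(\cdot,\cdot)$ is the inner product of $L_2(X)$. $\mathcal{E}$ is a Dirichlet form on $L_2(X)$ with domain $D(\mathcal{E})$, with associated symmetric bilinear form $\mathcal{E}(\varphi,\psi)$, and $\mathcal{E}(\varphi)=\mathcal{E}(\varphi,\varphi)$. $H$ is the positive self-adjoint (submarkovian) operator canonically associated with $\mathcal{E}$: $D(\mathcal{E})=D(H^{1/2})$ and $\mathcal{E}(\varphi)=\|H^{1/2}\varphi\|_2^2$. The graph norm is $\|\varphi\|_{D(\mathcal{E})}=(\mathcal{E}(\varphi)+\|\varphi\|_2^2)^{1/2}$. $B(\mathcal{E})=D(\mathcal{E})\cap L_\infty(X)$ (an algebra and a core of $\mathcal{E}$); $B_c(\mathcal{E})$ is the subalgebra of functions in $B(\mathcal{E})$ with compact support; $C_c(\mathcal{E})=B_c(\mathcal{E})\cap C(X)$; $B_{\rm loc}(\mathcal{E})$ is the space of $\mu$-measurable functions $\psi$ such that for every compact $K\subseteq X$ there is a $\hat\psi\in B(\mathcal{E})$ with $\psi|_K=\hat\psi|_K$. Standing assumptions: $C_c(\mathcal{E})$ is dense in $C_0(X)$ (continuous functions vanishing at infinity) in the supremum norm, and dense in $B_c(\mathcal{E})$ in the $D(\mathcal{E})$-graph norm. $\mathcal{E}$ is local (in the sense of Bouleau and Hirsch): $\mathcal{E}(\varphi,\psi)=0$ for all $\varphi,\psi\in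 D(\mathcal{E})$ for which there is an $a\in\mathbf{R}$ with $(\varphi+a\mathbf{1})\psi=0$. Truncated forms: for positive $\xi\in B(\mathcal{E})$ and $\varphi\in B(\mathcal{E})$, $$\mathcal{E}_\xi(\varphi)=\mathcal{E}(\varphi,\xi\varphi)-2^{-1}\mathcal{E}(\xi,\varphi^2).$$ If $\xi$ has compact support, $\mathcal{E}_\xi$ is defined on functions $\psi\in B_{\rm loc}(\mathcal{E})$ by $\mathcal{E}_\xi(\psi)=\mathcal{E}_\xi(\hat\psi)$, where $\hat\psi\in B(\mathcal{E})$ satisfies $\hat\psi|_{\operatorname{supp}\xi}=\psi|_{\operatorname{supp}\xi}$; this is independent of the choice of $\hat\psi$ by locality. *)

theory Defs
  imports "HOL-Analysis.Analysis"
begin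

definition sigma_compact_space :: "'a topology \<Rightarrow> bool" where
  "sigma_compact_space X \<longleftrightarrow>
     (\<exists>K :: nat \<Rightarrow> 'a set. (\<forall>n. compactin X (K n)) \<and> (\<Union>n. K n) = topspace X)"

definition radon_measure :: "'a::topological_space measure \<Rightarrow> bool" where
  "radon_measure M \<longleftrightarrow>
     sets M = sets borel \<and>
     (\<forall>K. compact K \<longrightarrow> emeasure M K < \<infinity>) \<and>
     (\<forall>A\<in>sets borel. emeasure M A = (INF U\<in>{U. open U \<and> A \<subseteq> U}. emeasure M U)) \<and>
     (\<forall>U. open U \<longrightarrow> emeasure M U = (SUP K\<in>{K. compact K \<and> K \<subseteq> U}. emeasure M K))"

definition full_support :: "'a::topological_space measure \<Rightarrow> bool" where
  "full_support M \<longleftrightarrow> (\<forall>U. open U \<longrightarrow> U \<noteq> {} \<longrightarrow> emeasure M U > 0)"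

text \<open>
  Elements of the spaces $L_p$ are represented by functions rather than by equivalence classes.
  Every set of such functions used below (domains of forms and of operators) is therefore required
  to be saturated under equality almost everywhere, and forms and operators are required to be
  compatible with it.
\<close>

definition L2 :: "'a measure \<Rightarrow> ('a \<Rightarrow> real) set" where
  "L2 M = {f \<in> borel_measurable M. integrable M (\<lambda>x. (f x)\<^sup>2)}"

definition Linf :: "'a measure \<Rightarrow> ('a \<Rightarrow> real) set" where
  "Linf M = {f \<in> borel_measurable M. \<exists>C. AE x in M. \<bar>f x\<bar> \<le> C}"

definition l2_inner :: "'a measure \<Rightarrow> ('a \<Rightarrow> real) \<Rightarrow> ('a \<Rightarrow> real) \<Rightarrow> real" where
  "l2_inner M f g = (\<integral>x. f x * g x \<partial>M)"

definition l2_norm :: "'a measure \<Rightarrow> ('a \<Rightarrow> real) \<Rightarrow> real" where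
  "l2_norm M f = sqrt (l2_inner M f f)"

text \<open>The linear subspaces of $L_2$ that are dense in $L_2$.\<close>

locale dense_L2_subspace =
  fixes M :: "'a measure" and D :: "('a \<Rightarrow> real) set"
  assumes subset_L2: "D \<subseteq> L2 M"
    and ae_closed: "\<And>f g. \<lbrakk>f \<in> D; g \<in> borel_measurable M; AE x in M. f x = g x\<rbrakk> \<Longrightarrow> g \<in> D"
    and zero_mem: "(\<lambda>x. 0) \<in> D"
    and add_mem: "\<And>f g. \<lbrakk>f \<in> D; g \<in> D\<rbrakk> \<Longrightarrow> (\<lambda>x. f x + g x) \<in> D"
    and scale_mem: "\<And>c f. f \<in> D \<Longrightarrow> (\<lambda>x. c * f x) \<in> D"
    and dense: "\<And>f e. \<lbrakk>f \<in> L2 M; e > 0\<rbrakk> \<Longrightarrow> \<exists>g\<in>D. l2_norm M (\<lambda>x. f x - g x) < e"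

definition graph_norm ::
  "'a measure \<Rightarrow> (('a \<Rightarrow> real) \<Rightarrow> ('a \<Rightarrow> real) \<Rightarrow> real) \<Rightarrow> ('a \<Rightarrow> real) \<Rightarrow> real" where
  "graph_norm M E f = sqrt (E f f + (l2_norm M f)\<^sup>2)"

text \<open>Densely defined, symmetric, positive, closed forms on which the unit contraction operates.\<close>

locale dirichlet_form = dense_L2_subspace M D
  for M :: "'a measure" and D :: "('a \<Rightarrow> real) set" +
  fixes E :: "('a \<Rightarrow> real) \<Rightarrow> ('a \<Rightarrow> real) \<Rightarrow> real"
  assumes form_ae: "\<And>f g h. \<lbrakk>f \<in> D; g \<in> D; h \<in> D; AE x in M. f x = g x\<rbrakk> \<Longrightarrow> E f h = E g h"
    and form_sym: "\<And>f g. \<lbrakk>f \<in> D; g \<in> D\<rbrakk> \<Longrightarrow> E f g = E g f"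
    and form_add: "\<And>f g h. \<lbrakk>f \<in> D; g \<in> D; h \<in> D\<rbrakk> \<Longrightarrow> E (\<lambda>x. f x + g x) h = E f h + E g h"
    and form_scale: "\<And>c f h. \<lbrakk>f \<in> D; h \<in> D\<rbrakk> \<Longrightarrow> E (\<lambda>x. c * f x) h = c * E f h"
    and form_nonneg: "\<And>f. f \<in> D \<Longrightarrow> 0 \<le> E f f"
    and form_closed:
      "\<And>u. \<lbrakk>\<And>n::nat. u n \<in> D;
            \<And>e. e > 0 \<Longrightarrow> \<exists>N. \<forall>m\<ge>N. \<forall>n\<ge>N. graph_norm M E (\<lambda>x. u m x - u n x) < e\<rbrakk>
        \<Longrightarrow> \<exists>v\<in>D. (\<lambda>n. graph_norm M E (\<lambda>x. u n x - v x)) \<longlonglongrightarrow> 0"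
    and unit_contraction_mem: "\<And>f. f \<in> D \<Longrightarrow> (\<lambda>x. min (max (f x) 0) 1) \<in> D"
    and unit_contraction_le:
      "\<And>f. f \<in> D \<Longrightarrow> E (\<lambda>x. min (max (f x) 0) 1) (\<lambda>x. min (max (f x) 0) 1) \<le> E f f"

definition local_form ::
  "'a measure \<Rightarrow> ('a \<Rightarrow> real) set \<Rightarrow> (('a \<Rightarrow> real) \<Rightarrow> ('a \<Rightarrow> real) \<Rightarrow> real) \<Rightarrow> bool" where
  "local_form M D E \<longleftrightarrow>
     (\<forall>\<phi>\<in>D. \<forall>\<psi>\<in>D. (\<exists>a. AE x in M. (\<phi> x + a) * \<psi> x = 0) \<longrightarrow> E \<phi> \<psi> = 0)"

text \<open>
  The (possibly unbounded) operator \<open>T\<close> with domain \<open>D\<close> is given by a total function, whose values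
  outside \<open>D\<close> are irrelevant.
\<close>

locale positive_self_adjoint = dense_L2_subspace M D
  for M :: "'a measure" and D :: "('a \<Rightarrow> real) set" +
  fixes T :: "('a \<Rightarrow> real) \<Rightarrow> ('a \<Rightarrow> real)"
  assumes op_L2: "\<And>f. f \<in> D \<Longrightarrow> T f \<in> L2 M"
    and op_ae: "\<And>f g. \<lbrakk>f \<in> D; g \<in> D; AE x in M. f x = g x\<rbrakk> \<Longrightarrow> AE x in M. T f x = T g x"
    and op_add: "\<And>f g. \<lbrakk>f \<in> D; g \<in> D\<rbrakk> \<Longrightarrow> AE x in M. T (\<lambda>x. f x + g x) x = T f x + T g x"
    and op_scale: "\<And>c f. f \<in> D \<Longrightarrow> AE x in M. T (\<lambda>x. c * f x) x = c * T f x"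
    and op_symmetric: "\<And>f g. \<lbrakk>f \<in> D; g \<in> D\<rbrakk> \<Longrightarrow> l2_inner M (T f) g = l2_inner M f (T g)"
    and adjoint_domain:
      "\<And>g h. \<lbrakk>g \<in> L2 M; h \<in> L2 M; \<And>f. f \<in> D \<Longrightarrow> l2_inner M (T f) g = l2_inner M f h\<rbrakk>
        \<Longrightarrow> g \<in> D"
    and op_positive: "\<And>f. f \<in> D \<Longrightarrow> 0 \<le> l2_inner M (T f) f"

text \<open>\<open>S\<close> is the positive self-adjoint square root of \<open>T\<close>, i.e. $T = S^2$ including domains.\<close>

definition is_sqrt_operator ::
  "'a measure \<Rightarrow> ('a \<Rightarrow> real) set \<Rightarrow> (('a \<Rightarrow> real) \<Rightarrow> ('a \<Rightarrow> real)) \<Rightarrow>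
   ('a \<Rightarrow> real) set \<Rightarrow> (('a \<Rightarrow> real) \<Rightarrow> ('a \<Rightarrow> real)) \<Rightarrow> bool" where
  "is_sqrt_operator M DS S DT T \<longleftrightarrow>
     positive_self_adjoint M DS S \<and>
     DT = {f \<in> DS. S f \<in> DS} \<and>
     (\<forall>f\<in>DT. AE x in M. T f x = S (S f) x)"

text \<open>\<open>H\<close> with domain \<open>DH\<close> is the operator associated with the form \<open>E\<close> with domain \<open>D\<close>:
  $D(\mathcal{E}) = D(H^{1/2})$ and $\mathcal{E}(\varphi) = \|H^{1/2}\varphi\|_2^2$.\<close>

definition associated_operator ::
  "'a measure \<Rightarrow> ('a \<Rightarrow> real) set \<Rightarrow> (('a \<Rightarrow> real) \<Rightarrow> ('a \<Rightarrow> real) \<Rightarrow> real) \<Rightarrow>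
   ('a \<Rightarrow> real) set \<Rightarrow> (('a \<Rightarrow> real) \<Rightarrow> ('a \<Rightarrow> real)) \<Rightarrow> bool" where
  "associated_operator M D E DH H \<longleftrightarrow>
     positive_self_adjoint M DH H \<and>
     (\<exists>S. is_sqrt_operator M D S DH H \<and> (\<forall>\<phi>\<in>D. E \<phi> \<phi> = (l2_norm M (S \<phi>))\<^sup>2))"

text \<open>The support of a function that is only determined up to null sets.\<close>

definition ess_supp :: "'a::topological_space measure \<Rightarrow> ('a \<Rightarrow> real) \<Rightarrow> 'a set" where
  "ess_supp M f = - \<Union>{U. open U \<and> (AE x in M. x \<in> U \<longrightarrow> f x = 0)}"

definition B_form :: "'a measure \<Rightarrow> ('a \<Rightarrow> real) set \<Rightarrow> ('a \<Rightarrow> real) set" where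
  "B_form M D = D \<inter> Linf M"

definition Bc_form :: "'a::topological_space measure \<Rightarrow> ('a \<Rightarrow> real) set \<Rightarrow> ('a \<Rightarrow> real) set" where
  "Bc_form M D = {f \<in> B_form M D. compact (ess_supp M f)}"

definition Cc_form :: "'a::topological_space measure \<Rightarrow> ('a \<Rightarrow> real) set \<Rightarrow> ('a \<Rightarrow> real) set" where
  "Cc_form M D = {f \<in> Bc_form M D. continuous_on UNIV f}"

definition Bloc_form :: "'a::topological_space measure \<Rightarrow> ('a \<Rightarrow> real) set \<Rightarrow> ('a \<Rightarrow> real) set" where
  "Bloc_form M D = {\<psi> \<in> borel_measurable M.
     \<forall>K. compact K \<longrightarrow> (\<exists>\<psi>'\<in>B_form M D. AE x in M. x \<in> K \<longrightarrow> \<psi> x = \<psi>' x)}"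

definition C0 :: "('a::topological_space \<Rightarrow> real) set" where
  "C0 = {f. continuous_on UNIV f \<and> (\<forall>e>0. \<exists>K. compact K \<and> (\<forall>x. x \<notin> K \<longrightarrow> \<bar>f x\<bar> < e))}"

definition Cc_dense_in_C0 :: "'a::topological_space measure \<Rightarrow> ('a \<Rightarrow> real) set \<Rightarrow> bool" where
  "Cc_dense_in_C0 M D \<longleftrightarrow> (\<forall>f\<in>C0. \<forall>e>0. \<exists>g\<in>Cc_form M D. \<forall>x. \<bar>f x - g x\<bar> < e)"

definition Cc_dense_in_Bc ::
  "'a::topological_space measure \<Rightarrow> ('a \<Rightarrow> real) set \<Rightarrow> (('a \<Rightarrow> real) \<Rightarrow> ('a \<Rightarrow> real) \<Rightarrow> real) \<Rightarrow> bool"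
  where
  "Cc_dense_in_Bc M D E \<longleftrightarrow>
     (\<forall>f\<in>Bc_form M D. \<forall>e>0. \<exists>g\<in>Cc_form M D. graph_norm M E (\<lambda>x. f x - g x) < e)"

definition truncated_form ::
  "(('a \<Rightarrow> real) \<Rightarrow> ('a \<Rightarrow> real) \<Rightarrow> real) \<Rightarrow> ('a \<Rightarrow> real) \<Rightarrow> ('a \<Rightarrow> real) \<Rightarrow> real" where
  "truncated_form E \<xi> \<phi> = E \<phi> (\<lambda>x. \<xi> x * \<phi> x) - E \<xi> (\<lambda>x. (\<phi> x)\<^sup>2) / 2"

text \<open>
  The extension of the truncated form to \<open>\<psi> \<in> Bloc_form M D\<close>, for \<open>\<xi>\<close> of compact support.
  For local forms the value does not depend on the choice of \<open>\<psi>'\<close>.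
\<close>

definition truncated_form_loc ::
  "'a::topological_space measure \<Rightarrow> ('a \<Rightarrow> real) set \<Rightarrow>
   (('a \<Rightarrow> real) \<Rightarrow> ('a \<Rightarrow> real) \<Rightarrow> real) \<Rightarrow> ('a \<Rightarrow> real) \<Rightarrow> ('a \<Rightarrow> real) \<Rightarrow> real" where
  "truncated_form_loc M D E \<xi> \<psi> =
     truncated_form E \<xi>
       (SOME \<psi>'. \<psi>' \<in> B_form M D \<and> (AE x in M. x \<in> ess_supp M \<xi> \<longrightarrow> \<psi>' x = \<psi> x))"

definition hardy_inequality ::
  "'a measure \<Rightarrow> ('a \<Rightarrow> real) set \<Rightarrow> (('a \<Rightarrow> real) \<Rightarrow> ('a \<Rightarrow> real) \<Rightarrow> real) \<Rightarrow> ('a \<Rightarrow> real) \<Rightarrow> bool" where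
  "hardy_inequality M D E \<eta> \<longleftrightarrow>
     (\<forall>\<phi>\<in>D. (\<lambda>x. \<eta> x * \<phi> x) \<in> L2 M) \<and>
     (\<forall>\<phi>\<in>D. E \<phi> \<phi> \<ge> l2_inner M (\<lambda>x. \<eta> x * \<phi> x) (\<lambda>x. \<eta> x * \<phi> x))"

definition rellich_inequality ::
  "'a measure \<Rightarrow> ('a \<Rightarrow> real) set \<Rightarrow> (('a \<Rightarrow> real) \<Rightarrow> ('a \<Rightarrow> real)) \<Rightarrow> ('a \<Rightarrow> real) \<Rightarrow> real \<Rightarrow> bool" where
  "rellich_inequality M DH H \<eta> \<sigma> \<longleftrightarrow>
     (\<forall>\<phi>\<in>DH. (\<lambda>x. (\<eta> x)\<^sup>2 * \<phi> x) \<in> L2 M) \<and>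
     (\<forall>\<phi>\<in>DH. l2_inner M (H \<phi>) (H \<phi>) \<ge>
        \<sigma> * l2_inner M (\<lambda>x. (\<eta> x)\<^sup>2 * \<phi> x) (\<lambda>x. (\<eta> x)\<^sup>2 * \<phi> x))"

end

theory Submission
  imports Defs
begin

text \<open>
  For bounded \<open>\<phi> \<in> D(H)\<close>, a level \<open>a\<close>, \<open>\<zeta> = min \<eta> a\<close> and \<open>\<beta> = \<rho> \<zeta>\<close>, the Hardy inequality bounds
  \<open>(H \<phi>, \<beta>\<^sup>2 \<phi>) = E(\<beta> \<phi>) - E\<^sub>w(\<beta>)\<close>, \<open>w = \<phi>\<^sup>2\<close>, from below by \<open>\<parallel>\<zeta>\<^sup>2 \<rho> \<phi>\<parallel>\<^sup>2 - E\<^sub>w(\<rho> \<zeta>)\<close>. By the Leibniz rule and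
  the Cauchy-Schwarz inequality for truncated forms, \<open>E\<^sub>w(\<rho> \<zeta>)\<close> is at most \<open>\<gamma> \<parallel>\<zeta>\<^sup>2 \<rho> \<phi>\<parallel>\<^sup>2\<close> up to errors that vanish
  along the net, and bounded elements form a core of \<open>H\<close>. Finally \<open>a\<close> tends to infinity.

  Energy measures are avoided. Instead \<open>f\<close> is folded repeatedly at half its height: by locality this
  preserves all relevant energies, while the supremum norm tends to \<open>0\<close>. This yields the algebra
  property of \<open>B(E)\<close>, the Leibniz rule and the positivity of truncated forms.
\<close>

section \<open>Positive semidefinite symmetric forms on function spaces\<close>

text \<open>The obstacle is that \<open>\<eta>\<close> need not be bounded and that elements of
  \<open>D(H)\<close> need not be bounded either, so products with them are not known to lie in the
  form domain. Truncating \<eta> at height \<open>a\<close> gives the error caused by \<rho> a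
  finite coefficient, of the form a^2 / \<epsilon>, in front of a quantity that tends to 0 along the
  net. This fixes the order of limits: the net first, then \<epsilon> to 0, then \<open>a\<close> to
  infinity. Folding composes \<open>f\<close> with a piecewise linear map of slopes 1 and -1. For a
  gradient energy, where \<open>E f f\<close> is the integral of |grad f|^2, it leaves |grad f|
  unchanged. Once \<open>f\<close> is uniformly small with its energy kept, all terms of a product
  rule in which \<open>f\<close> stays undifferentiated disappear in the limit, which isolates the
  remaining ones. The constant comes from (1 - \<gamma>) R^2 \<le> h R, where R and h are the norms
  of the truncated \<eta>^2 \<phi> and of \<open>H \<phi>\<close>: divide by R and square.\<close>

locale semi_inner =
  fixes V :: "('a \<Rightarrow> real) set" and Q :: "('a \<Rightarrow> real) \<Rightarrow> ('a \<Rightarrow> real) \<Rightarrow> real"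
  assumes add_in: "\<lbrakk>f \<in> V; g \<in> V\<rbrakk> \<Longrightarrow> (\<lambda>x. f x + g x) \<in> V"
    and scale_in: "f \<in> V \<Longrightarrow> (\<lambda>x. c * f x) \<in> V"
    and sym: "\<lbrakk>f \<in> V; g \<in> V\<rbrakk> \<Longrightarrow> Q f g = Q g f"
    and add_left: "\<lbrakk>f \<in> V; g \<in> V; h \<in> V\<rbrakk> \<Longrightarrow> Q (\<lambda>x. f x + g x) h = Q f h + Q g h"
    and scale_left: "\<lbrakk>f \<in> V; h \<in> V\<rbrakk> \<Longrightarrow> Q (\<lambda>x. c * f x) h = c * Q f h"
    and nonneg: "f \<in> V \<Longrightarrow> 0 \<le> Q f f"
begin

lemma uminus_in: "f \<in> V \<Longrightarrow> (\<lambda>x. - f x) \<in> V"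
  using scale_in[of f "-1"] by simp

lemma diff_in: "\<lbrakk>f \<in> V; g \<in> V\<rbrakk> \<Longrightarrow> (\<lambda>x. f x - g x) \<in> V"
  using add_in[OF _ uminus_in, of f g] by simp

lemma uminus_left: "\<lbrakk>f \<in> V; h \<in> V\<rbrakk> \<Longrightarrow> Q (\<lambda>x. - f x) h = - Q f h"
  using scale_left[of f h "-1"] by simp

lemma diff_left: "\<lbrakk>f \<in> V; g \<in> V; h \<in> V\<rbrakk> \<Longrightarrow> Q (\<lambda>x. f x - g x) h = Q f h - Q g h"
  using add_left[OF _ uminus_in, of f g h] uminus_left[of g h] by simp

lemma add_right: "\<lbrakk>f \<in> V; g \<in> V; h \<in> V\<rbrakk> \<Longrightarrow> Q h (\<lambda>x. f x + g x) = Q h f + Q h g"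
  using add_left[of f g h] sym[of h "\<lambda>x. f x + g x"] sym[of h f] sym[of h g] add_in[of f g] by simp

lemma diff_right: "\<lbrakk>f \<in> V; g \<in> V; h \<in> V\<rbrakk> \<Longrightarrow> Q h (\<lambda>x. f x - g x) = Q h f - Q h g"
  using diff_left[of f g h] sym[of h "\<lambda>x. f x - g x"] sym[of h f] sym[of h g] diff_in[of f g] by simp

lemma scale_right: "\<lbrakk>f \<in> V; h \<in> V\<rbrakk> \<Longrightarrow> Q h (\<lambda>x. c * f x) = c * Q h f"
  using scale_left[of f h c] sym[of h "\<lambda>x. c * f x"] sym[of h f] scale_in[of f c] by simp

lemma uminus_right: "\<lbrakk>f \<in> V; h \<in> V\<rbrakk> \<Longrightarrow> Q h (\<lambda>x. - f x) = - Q h f"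
  using scale_right[of f h "-1"] by simp

lemmas bilinear = add_left add_right diff_left diff_right scale_left scale_right
  uminus_left uminus_right
lemmas closed = add_in diff_in scale_in uminus_in

lemma add_self: "\<lbrakk>f \<in> V; g \<in> V\<rbrakk> \<Longrightarrow>
    Q (\<lambda>x. f x + g x) (\<lambda>x. f x + g x) = Q f f + 2 * Q f g + Q g g"
  using sym[of f g] by (simp add: bilinear closed)

lemma diff_self: "\<lbrakk>f \<in> V; g \<in> V\<rbrakk> \<Longrightarrow>
    Q (\<lambda>x. f x - g x) (\<lambda>x. f x - g x) = Q f f - 2 * Q f g + Q g g"
  using sym[of f g] by (simp add: bilinear closed)

lemma scale_self: "f \<in> V \<Longrightarrow> Q (\<lambda>x. c * f x) (\<lambda>x. c * f x) = c\<^sup>2 * Q f f"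
  by (simp add: bilinear closed power2_eq_square)

lemma sqrt_scale_self: "f \<in> V \<Longrightarrow> sqrt (Q (\<lambda>x. c * f x) (\<lambda>x. c * f x)) = \<bar>c\<bar> * sqrt (Q f f)"
  by (simp add: scale_self real_sqrt_mult)

lemma young:
  assumes "f \<in> V" "g \<in> V" "t > 0"
  shows "2 * \<bar>Q f g\<bar> \<le> t * Q f f + Q g g / t"
proof -
  have f: "(\<lambda>x. t * f x) \<in> V" using assms by (simp add: closed)
  have "0 \<le> t\<^sup>2 * Q f f - 2 * (t * Q f g) + Q g g"
    using nonneg[OF diff_in[OF f assms(2)]] unfolding diff_self[OF f assms(2)]
    using assms by (simp add: bilinear closed power2_eq_square)
  moreover have "0 \<le> t\<^sup>2 * Q f f + 2 * (t * Q f g) + Q g g"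
    using nonneg[OF add_in[OF f assms(2)]] unfolding add_self[OF f assms(2)]
    using assms by (simp add: bilinear closed power2_eq_square)
  ultimately have "2 * \<bar>Q f g\<bar> * t \<le> t\<^sup>2 * Q f f + Q g g"
    using assms(3) by (auto simp: abs_if algebra_simps)
  hence "2 * \<bar>Q f g\<bar> \<le> (t\<^sup>2 * Q f f + Q g g) / t"
    using assms(3) by (simp add: pos_le_divide_eq)
  thus ?thesis using assms(3) by (simp add: add_divide_distrib power2_eq_square)
qed

lemma cauchy_schwarz:
  assumes f: "f \<in> V" and g: "g \<in> V"
  shows "\<bar>Q f g\<bar> \<le> sqrt (Q f f) * sqrt (Q g g)"
proof (rule field_le_epsilon)
  fix e :: real assume e: "0 < e"
  define a b where "a = sqrt (Q f f)" and "b = sqrt (Q g g)"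
  have ab: "a \<ge> 0" "b \<ge> 0" "Q f f = a\<^sup>2" "Q g g = b\<^sup>2"
    using nonneg f g by (auto simp: a_def b_def)
  \<comment> \<open>The optimal weight b / a in \<open>young\<close> is undefined or 0 if one factor
    vanishes, so both factors are shifted by \<open>d\<close>; the surplus is then
    \<open>d * (a + b)\<close>, at most \<open>2 * e\<close>.\<close>
  define d where "d = min 1 (2 * e / (a + b + 1))"
  have "d * (a + b + 1) \<le> (2 * e / (a + b + 1)) * (a + b + 1)"
    using ab by (intro mult_right_mono) (auto simp: d_def)
  hence d: "d > 0" "d * (a + b + 1) \<le> 2 * e"
    using e ab by (auto simp: d_def)
  have "2 * \<bar>Q f g\<bar> \<le> (b + d) / (a + d) * a\<^sup>2 + b\<^sup>2 / ((b + d) / (a + d))"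
    using young[OF f g, of "(b + d) / (a + d)"] ab d by (simp add: divide_pos_pos)
  also have "\<dots> \<le> (b + d) * a + b * (a + d)"
  proof (intro add_mono)
    have "(b + d) * (a * (a / (a + d))) \<le> (b + d) * (a * 1)"
      using ab d by (intro mult_left_mono) auto
    thus "(b + d) / (a + d) * a\<^sup>2 \<le> (b + d) * a" by (simp add: power2_eq_square field_simps)
    have "(a + d) * (b * (b / (b + d))) \<le> (a + d) * (b * 1)"
      using ab d by (intro mult_left_mono) auto
    thus "b\<^sup>2 / ((b + d) / (a + d)) \<le> b * (a + d)" by (simp add: power2_eq_square field_simps)
  qed
  also have "\<dots> \<le> 2 * (a * b) + d * (a + b + 1)" using d by (simp add: algebra_simps)
  finally have "\<bar>Q f g\<bar> \<le> a * b + e" using d by linarith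
  thus "\<bar>Q f g\<bar> \<le> sqrt (Q f f) * sqrt (Q g g) + e" by (simp add: a_def b_def)
qed

lemma triangle:
  assumes f: "f \<in> V" and g: "g \<in> V"
  shows "sqrt (Q (\<lambda>x. f x + g x) (\<lambda>x. f x + g x)) \<le> sqrt (Q f f) + sqrt (Q g g)"
proof (rule real_le_lsqrt)
  have "Q f g \<le> sqrt (Q f f) * sqrt (Q g g)" using cauchy_schwarz[OF f g] by simp
  thus "Q (\<lambda>x. f x + g x) (\<lambda>x. f x + g x) \<le> (sqrt (Q f f) + sqrt (Q g g))\<^sup>2"
    unfolding add_self[OF f g] power2_sum using nonneg f g by simp
qed (use nonneg f g in auto)

lemma triangle_diff:
  assumes f: "f \<in> V" and g: "g \<in> V"
  shows "sqrt (Q (\<lambda>x. f x - g x) (\<lambda>x. f x - g x)) \<le> sqrt (Q f f) + sqrt (Q g g)"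
  using triangle[OF f uminus_in[OF g]] by (simp add: bilinear closed f g)

end

section \<open>Square-integrable functions\<close>

lemma L2_measurable: "f \<in> L2 M \<Longrightarrow> f \<in> borel_measurable M"
  by (simp add: L2_def)

lemma L2_mult_integrable:
  assumes "f \<in> L2 M" "g \<in> L2 M"
  shows "integrable M (\<lambda>x. f x * g x)"
proof (rule Bochner_Integration.integrable_bound)
  show "integrable M (\<lambda>x. (f x)\<^sup>2 + (g x)\<^sup>2)"
    using assms by (auto simp: L2_def)
  show "(\<lambda>x. f x * g x) \<in> borel_measurable M"
    using assms by (auto simp: L2_def)
  show "AE x in M. norm (f x * g x) \<le> norm ((f x)\<^sup>2 + (g x)\<^sup>2)"
  proof (intro AE_I2)
    fix x
    have "0 \<le> (\<bar>f x\<bar> - \<bar>g x\<bar>)\<^sup>2" by simp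
    hence "2 * (\<bar>f x\<bar> * \<bar>g x\<bar>) \<le> (f x)\<^sup>2 + (g x)\<^sup>2" by (simp add: power2_diff)
    moreover have "0 \<le> \<bar>f x\<bar> * \<bar>g x\<bar>" by simp
    ultimately show "norm (f x * g x) \<le> norm ((f x)\<^sup>2 + (g x)\<^sup>2)"
      unfolding real_norm_def abs_mult by linarith
  qed
qed

lemma L2_bound:
  assumes "g \<in> L2 M" "f \<in> borel_measurable M" "AE x in M. \<bar>f x\<bar> \<le> c * \<bar>g x\<bar>"
  shows "f \<in> L2 M"
proof -
  have "integrable M (\<lambda>x. (f x)\<^sup>2)"
  proof (rule Bochner_Integration.integrable_bound)
    show "integrable M (\<lambda>x. c\<^sup>2 * (g x)\<^sup>2)" using assms by (auto simp: L2_def)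
    show "(\<lambda>x. (f x)\<^sup>2) \<in> borel_measurable M" using assms by auto
    show "AE x in M. norm ((f x)\<^sup>2) \<le> norm (c\<^sup>2 * (g x)\<^sup>2)"
      using assms(3)
    proof eventually_elim
      case (elim x)
      hence "\<bar>f x\<bar>\<^sup>2 \<le> (c * \<bar>g x\<bar>)\<^sup>2" by (intro power_mono) auto
      thus ?case by (simp add: power_mult_distrib abs_mult)
    qed
  qed
  thus ?thesis using assms by (simp add: L2_def)
qed

lemma L2_ae:
  assumes "f \<in> L2 M" "g \<in> borel_measurable M" "AE x in M. f x = g x"
  shows "g \<in> L2 M"
  by (rule L2_bound[where c = 1]) (use assms in auto)

lemma semi_inner_L2: "semi_inner (L2 M) (l2_inner M)"
proof
  fix f g assume f: "f \<in> L2 M" and g: "g \<in> L2 M"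
  have "integrable M (\<lambda>x. (f x + g x)\<^sup>2)"
    using f g L2_mult_integrable[OF f g] unfolding power2_sum
    by (auto simp: L2_def mult.assoc)
  thus "(\<lambda>x. f x + g x) \<in> L2 M" using f g by (auto simp: L2_def)
next
  fix f g h assume f: "f \<in> L2 M" and g: "g \<in> L2 M" and h: "h \<in> L2 M"
  show "l2_inner M (\<lambda>x. f x + g x) h = l2_inner M f h + l2_inner M g h"
    using L2_mult_integrable[OF f h] L2_mult_integrable[OF g h]
    by (simp add: l2_inner_def distrib_right)
qed (auto simp: L2_def l2_inner_def mult.assoc power_mult_distrib intro!: Bochner_Integration.integral_cong)

interpretation l2: semi_inner "L2 M" "l2_inner M" for M
  by (rule semi_inner_L2)

lemma l2_inner_cong:
  assumes "f \<in> borel_measurable M" "g \<in> borel_measurable M" "f' \<in> borel_measurable M" "g' \<in> borel_measurable M"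
    "AE x in M. f x = f' x" "AE x in M. g x = g' x"
  shows "l2_inner M f g = l2_inner M f' g'"
  unfolding l2_inner_def
  by (rule integral_cong_AE) (use assms in auto)

lemma l2_inner_mono:
  assumes "f \<in> borel_measurable M" "g \<in> L2 M" "AE x in M. \<bar>f x\<bar> \<le> c * \<bar>g x\<bar>"
  shows "l2_inner M f f \<le> c\<^sup>2 * l2_inner M g g"
proof -
  have f: "f \<in> L2 M" using L2_bound assms by blast
  have "(\<integral>x. f x * f x \<partial>M) \<le> (\<integral>x. c\<^sup>2 * (g x * g x) \<partial>M)"
  proof (rule integral_mono_AE)
    show "AE x in M. f x * f x \<le> c\<^sup>2 * (g x * g x)"
      using assms(3)
    proof eventually_elim
      case (elim x)
      hence "\<bar>f x\<bar>\<^sup>2 \<le> (c * \<bar>g x\<bar>)\<^sup>2" by (intro power_mono) auto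
      hence "(f x)\<^sup>2 \<le> c\<^sup>2 * (g x)\<^sup>2" by (simp add: power_mult_distrib)
      thus ?case by (simp only: power2_eq_square)
    qed
  qed (use L2_mult_integrable f assms in auto)
  thus ?thesis by (simp add: l2_inner_def)
qed

lemma l2_norm_sq: "f \<in> L2 M \<Longrightarrow> (l2_norm M f)\<^sup>2 = l2_inner M f f"
  using l2.nonneg by (simp add: l2_norm_def)

lemma l2_inner_self_eq_0:
  assumes "f \<in> L2 M" "l2_inner M f f = 0"
  shows "AE x in M. f x = 0"
  using integral_nonneg_eq_0_iff_AE[of M "\<lambda>x. f x * f x"] L2_mult_integrable[of f M f] assms
  by (simp add: l2_inner_def)

section \<open>Bounded elements of a local Dirichlet form\<close>

locale local_dirichlet_form = dirichlet_form +
  assumes local: "local_form M D E"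

sublocale local_dirichlet_form \<subseteq> form: semi_inner D E
  by unfold_locales (auto intro: add_mem scale_mem form_sym form_add form_scale form_nonneg)

context local_dirichlet_form
begin

abbreviation B :: "('a \<Rightarrow> real) set" where "B \<equiv> B_form M D"

lemma D_measurable: "f \<in> D \<Longrightarrow> f \<in> borel_measurable M"
  using subset_L2 L2_measurable by blast

lemma D_L2: "f \<in> D \<Longrightarrow> f \<in> L2 M"
  using subset_L2 by blast

lemma E_cong:
  assumes "f \<in> D" "g \<in> D" "f' \<in> borel_measurable M" "g' \<in> borel_measurable M"
    "AE x in M. f x = f' x" "AE x in M. g x = g' x"
  shows "E f g = E f' g'"
proof -
  have "f' \<in> D" "g' \<in> D" using ae_closed assms by blast+
  thus ?thesis using assms form_ae[of f f' g] form_ae[of g g' f'] form_sym by metis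
qed

lemma orthogonal:
  assumes "u \<in> D" "v \<in> D" "AE x in M. (u x - a) * v x = 0"
  shows "E u v = 0"
proof -
  have "AE x in M. (u x + (- a)) * v x = 0" using assms(3) by simp
  thus ?thesis using local assms unfolding local_form_def by blast
qed

text \<open>Think of \<open>u\<close> as the part of a function below height \<open>a\<close> and of
  \<open>v\<close> as the excess above it: \<open>v\<close> lives where \<open>u\<close> is
  constant, so locality removes the cross term, and reflecting the excess costs no energy.\<close>

lemma fold_E:
  assumes "u \<in> D" "v \<in> D" "AE x in M. (u x - a) * v x = 0"
  shows "E (\<lambda>x. u x + v x) (\<lambda>x. u x + v x) = E (\<lambda>x. u x - v x) (\<lambda>x. u x - v x)"
  unfolding form.add_self[OF assms(1,2)] form.diff_self[OF assms(1,2)] orthogonal[OF assms] by simp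

lemma B_D: "f \<in> B \<Longrightarrow> f \<in> D"
  by (simp add: B_form_def)

lemma B_measurable: "f \<in> B \<Longrightarrow> f \<in> borel_measurable M"
  using B_D D_measurable by blast

lemma B_I: "\<lbrakk>f \<in> D; AE x in M. \<bar>f x\<bar> \<le> c\<rbrakk> \<Longrightarrow> f \<in> B"
  using D_measurable by (auto simp: B_form_def Linf_def)

lemma B_boundE:
  assumes "f \<in> B"
  obtains c where "c > 0" "AE x in M. \<bar>f x\<bar> \<le> c"
proof -
  obtain c where c: "AE x in M. \<bar>f x\<bar> \<le> c" using assms by (auto simp: B_form_def Linf_def)
  show ?thesis
    by (rule that[of "\<bar>c\<bar> + 1"]) (use c in \<open>auto elim: eventually_mono\<close>)
qed

lemma B_add: assumes "f \<in> B" "g \<in> B" shows "(\<lambda>x. f x + g x) \<in> B"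
proof -
  obtain c d where "AE x in M. \<bar>f x\<bar> \<le> c" "AE x in M. \<bar>g x\<bar> \<le> d"
    using B_boundE assms by metis
  hence "AE x in M. \<bar>f x + g x\<bar> \<le> c + d" by eventually_elim linarith
  thus ?thesis using B_I add_mem B_D assms by blast
qed

lemma B_scale: assumes "f \<in> B" shows "(\<lambda>x. c * f x) \<in> B"
proof -
  obtain d where "AE x in M. \<bar>f x\<bar> \<le> d" using B_boundE assms by metis
  hence "AE x in M. \<bar>c * f x\<bar> \<le> \<bar>c\<bar> * d"
    by eventually_elim (simp add: abs_mult mult_left_mono)
  thus ?thesis using B_I scale_mem B_D assms by blast
qed

lemma B_uminus: "f \<in> B \<Longrightarrow> (\<lambda>x. - f x) \<in> B"
  using B_scale[of f "-1"] by simp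

lemma B_diff: "\<lbrakk>f \<in> B; g \<in> B\<rbrakk> \<Longrightarrow> (\<lambda>x. f x - g x) \<in> B"
  using B_add[OF _ B_uminus, of f g] by simp

lemma B_ae: 
  assumes "f \<in> B" "g \<in> borel_measurable M" "AE x in M. f x = g x"
  shows "g \<in> B"
proof -
  obtain c where "AE x in M. \<bar>f x\<bar> \<le> c" using B_boundE assms by metis
  hence "AE x in M. \<bar>g x\<bar> \<le> c" using assms(3) by eventually_elim simp
  thus ?thesis using B_I ae_closed B_D assms by blast
qed

lemma cut_mem:
  assumes "f \<in> D" "a > 0"
  shows "(\<lambda>x. min (max (f x) 0) a) \<in> D"
    and "E (\<lambda>x. min (max (f x) 0) a) (\<lambda>x. min (max (f x) 0) a) \<le> E f f"
proof -
  let ?g = "\<lambda>x. (1 / a) * f x" and ?h = "\<lambda>x. min (max ((1 / a) * f x) 0) 1"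
  have eq: "(\<lambda>x. min (max (f x) 0) a) = (\<lambda>x. a * ?h x)"
    using assms(2) by (auto simp: min_def max_def field_simps)
  have g: "?g \<in> D" by (rule scale_mem[OF assms(1)])
  have h: "?h \<in> D" "E ?h ?h \<le> E ?g ?g"
    using unit_contraction_mem[OF g] unit_contraction_le[OF g] by simp_all
  show "(\<lambda>x. min (max (f x) 0) a) \<in> D" unfolding eq by (rule scale_mem[OF h(1)])
  have "a\<^sup>2 * E ?h ?h \<le> a\<^sup>2 * E ?g ?g" using h by (intro mult_left_mono) auto
  also have "\<dots> = E f f" unfolding form.scale_self[OF assms(1)] using assms(2) by (simp add: power_divide)
  finally show "E (\<lambda>x. min (max (f x) 0) a) (\<lambda>x. min (max (f x) 0) a) \<le> E f f"
    unfolding eq form.scale_self[OF h(1)] .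
qed

lemma B_cut:
  assumes "f \<in> B" "a \<ge> 0"
  shows "(\<lambda>x. min (max (f x) 0) a) \<in> B"
proof (cases "a = 0")
  case True
  hence "(\<lambda>x. min (max (f x) 0) a) = (\<lambda>x. 0 * f x)" by auto
  thus ?thesis using B_scale[OF assms(1)] by metis
next
  case False
  thus ?thesis using assms cut_mem(1)[OF B_D, of f a] by (intro B_I[of _ a]) auto
qed

lemma B_pos_part:
  assumes "f \<in> B" shows "(\<lambda>x. max (f x) 0) \<in> B"
proof -
  obtain c where c: "c > 0" "AE x in M. \<bar>f x\<bar> \<le> c" using B_boundE assms by metis
  show ?thesis
    by (rule B_ae[OF B_cut[OF assms, of c]])
      (use c B_measurable assms in \<open>auto elim!: eventually_mono\<close>)
qed

text \<open>A fold at height 0. Locality gives equality of the energies, where a general Dirichlet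
  form only gives an inequality.\<close>

lemma B_abs:
  assumes "f \<in> B"
  shows "(\<lambda>x. \<bar>f x\<bar>) \<in> B" and "E (\<lambda>x. \<bar>f x\<bar>) (\<lambda>x. \<bar>f x\<bar>) = E f f"
proof -
  let ?u = "\<lambda>x. max (f x) 0" and ?v = "\<lambda>x. max (- f x) 0"
  have uv: "?u \<in> B" "?v \<in> B" using B_pos_part B_uminus assms by auto
  have eq: "(\<lambda>x. \<bar>f x\<bar>) = (\<lambda>x. ?u x + ?v x)" "f = (\<lambda>x. ?u x - ?v x)" by auto
  show "(\<lambda>x. \<bar>f x\<bar>) \<in> B" unfolding eq(1) by (rule B_add[OF uv])
  have "E (\<lambda>x. ?u x + ?v x) (\<lambda>x. ?u x + ?v x) = E (\<lambda>x. ?u x - ?v x) (\<lambda>x. ?u x - ?v x)"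
    by (rule fold_E[where a = 0]) (use B_D uv in auto)
  thus "E (\<lambda>x. \<bar>f x\<bar>) (\<lambda>x. \<bar>f x\<bar>) = E f f" unfolding eq(1) using eq(2) by simp
qed

section \<open>The form norm and closedness\<close>

abbreviation N :: "('a \<Rightarrow> real) \<Rightarrow> real" where "N f \<equiv> sqrt (E f f)"

lemma graph_norm_sq: "f \<in> D \<Longrightarrow> (graph_norm M E f)\<^sup>2 = E f f + l2_inner M f f"
  using form_nonneg[of f] l2.nonneg[OF D_L2, of f] by (simp add: graph_norm_def l2_norm_sq D_L2)

lemma graph_norm_le: "f \<in> D \<Longrightarrow> graph_norm M E f \<le> N f + l2_norm M f"
  unfolding graph_norm_def
  using sqrt_add_le_add_sqrt[of "E f f" "(l2_norm M f)\<^sup>2"] form_nonneg[of f] l2.nonneg[OF D_L2, of f]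
  by (simp add: l2_norm_def)

lemma N_le_graph_norm: "f \<in> D \<Longrightarrow> N f \<le> graph_norm M E f"
  by (simp add: graph_norm_def)

lemma l2_norm_le_graph_norm: "f \<in> D \<Longrightarrow> l2_norm M f \<le> graph_norm M E f"
  unfolding graph_norm_def using form_nonneg[of f] by (simp add: real_le_rsqrt)

text \<open>Closedness yields only some limit \<open>v\<close>; the L2 limit, known separately,
  identifies it with \<open>w\<close>. In this way a function given by a pointwise formula is shown
  to lie in \<open>D\<close>.\<close>

lemma closed_limit:
  assumes u: "\<And>n::nat. u n \<in> D" and w: "w \<in> L2 M"
    and l2: "(\<lambda>n. l2_norm M (\<lambda>x. u n x - w x)) \<longlonglongrightarrow> 0"
    and E: "\<And>n m. n \<le> m \<Longrightarrow> N (\<lambda>x. u m x - u n x) \<le> c n" and c: "c \<longlonglongrightarrow> 0"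
  shows "w \<in> D" and "(\<lambda>n. N (\<lambda>x. u n x - w x)) \<longlonglongrightarrow> 0"
proof -
  have sym_N: "N (\<lambda>x. u m x - u n x) = N (\<lambda>x. u n x - u m x)" for m n
    unfolding form.diff_self[OF u u] using form_sym[OF u u, of m n] by simp
  have "\<exists>N. \<forall>m\<ge>N. \<forall>n\<ge>N. graph_norm M E (\<lambda>x. u m x - u n x) < e" if e: "e > 0" for e
  proof -
    have "\<forall>\<^sub>F n in sequentially. l2_norm M (\<lambda>x. u n x - w x) < e / 3 \<and> c n < e / 3"
      using l2 c e by (intro eventually_conj order_tendstoD(2)[where y = 0]) auto
    then obtain K where K: "\<And>n. n \<ge> K \<Longrightarrow> l2_norm M (\<lambda>x. u n x - w x) < e / 3"
      "\<And>n. n \<ge> K \<Longrightarrow> c n < e / 3" unfolding eventually_sequentially by blast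
    have "graph_norm M E (\<lambda>x. u m x - u n x) < e" if mn: "m \<ge> K" "n \<ge> K" for m n
    proof -
      have "N (\<lambda>x. u m x - u n x) < e / 3"
        using E[of n m] E[of m n] K(2)[of n] K(2)[of m] mn sym_N[of m n]
        by (cases "n \<le> m") fastforce+
      moreover have "l2_norm M (\<lambda>x. (u m x - w x) - (u n x - w x))
          \<le> l2_norm M (\<lambda>x. u m x - w x) + l2_norm M (\<lambda>x. u n x - w x)"
        unfolding l2_norm_def by (intro l2.triangle_diff l2.diff_in w D_L2 u)
      ultimately show ?thesis
        using graph_norm_le[OF form.diff_in[OF u u], of m n] K(1)[OF mn(1)] K(1)[OF mn(2)] by simp
    qed
    thus ?thesis by blast
  qed
  from form_closed[OF u this] obtain v where v: "v \<in> D"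
    and lim: "(\<lambda>n. graph_norm M E (\<lambda>x. u n x - v x)) \<longlonglongrightarrow> 0" by blast
  have "(\<lambda>n. l2_norm M (\<lambda>x. u n x - w x) + graph_norm M E (\<lambda>x. u n x - v x)) \<longlonglongrightarrow> 0"
    using tendsto_add[OF l2 lim] by simp
  moreover have "l2_norm M (\<lambda>x. v x - w x)
      \<le> l2_norm M (\<lambda>x. u n x - w x) + graph_norm M E (\<lambda>x. u n x - v x)" for n
  proof -
    have "l2_norm M (\<lambda>x. (u n x - w x) - (u n x - v x))
          \<le> l2_norm M (\<lambda>x. u n x - w x) + l2_norm M (\<lambda>x. u n x - v x)"
      unfolding l2_norm_def by (intro l2.triangle_diff l2.diff_in w D_L2 u v)
    thus ?thesis using l2_norm_le_graph_norm[OF form.diff_in[OF u v], of n] by simp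
  qed
  ultimately have "l2_norm M (\<lambda>x. v x - w x) \<le> 0"
    by (intro LIMSEQ_le_const) auto
  hence "l2_inner M (\<lambda>x. v x - w x) (\<lambda>x. v x - w x) = 0"
    using l2.nonneg[OF l2.diff_in[OF D_L2[OF v] w]] by (simp add: l2_norm_def)
  hence ae: "AE x in M. v x = w x"
    using l2_inner_self_eq_0[OF l2.diff_in[OF D_L2[OF v] w]] by simp
  show wD: "w \<in> D" using ae_closed[OF v L2_measurable[OF w] ae] .
  have "E (\<lambda>x. u n x - w x) (\<lambda>x. u n x - w x) = E (\<lambda>x. u n x - v x) (\<lambda>x. u n x - v x)" for n
    by (rule E_cong) (use ae u v wD D_measurable[OF form.diff_in[OF u v]] in
       \<open>auto intro!: form.diff_in elim!: eventually_mono\<close>)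
  moreover have "(\<lambda>n. N (\<lambda>x. u n x - v x)) \<longlonglongrightarrow> 0"
    by (rule tendsto_sandwich[OF _ _ tendsto_const lim])
      (use form_nonneg[OF form.diff_in[OF u v]] N_le_graph_norm[OF form.diff_in[OF u v]] in auto)
  ultimately show "(\<lambda>n. N (\<lambda>x. u n x - w x)) \<longlonglongrightarrow> 0" by simp
qed

text \<open>For \<open>g\<close> with values in the unit interval this is the tent map min(2t, 2 -
  2t) after \<open>g\<close>, i.e. twice the fold of \<open>g\<close> at height 1/2. Writing it
  through a cut-off reduces membership in \<open>D\<close> to truncation and linearity.\<close>

definition tent :: "('a \<Rightarrow> real) \<Rightarrow> 'a \<Rightarrow> real" where
  "tent g = (\<lambda>x. 4 * min (max (g x) 0) (1 / 2) - 2 * g x)"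

text \<open>The last identity is a self-similarity of t - t^2: with T the tent map, t - t^2 = T t /
  4 + (T t - (T t)^2) / 4. Iterating it produces the expansion of the square.\<close>

lemma tent_props:
  assumes g: "g \<in> D" and r: "\<And>x. 0 \<le> g x \<and> g x \<le> 1"
  shows "tent g \<in> D" and "0 \<le> tent g x \<and> tent g x \<le> 1" and "tent g x \<le> 2 * g x"
    and "N (tent g) = 2 * N g"
    and "g x - (g x)\<^sup>2 = tent g x / 2 - (tent g x)\<^sup>2 / 4"
proof -
  let ?u = "\<lambda>x. min (max (g x) 0) (1 / 2)"
  let ?v = "\<lambda>x. g x - ?u x"
  have u: "?u \<in> D" by (rule cut_mem[OF g]) simp
  have v: "?v \<in> D" by (rule form.diff_in[OF g u])
  have eq: "tent g = (\<lambda>x. 2 * (?u x - ?v x))" by (simp add: tent_def)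
  show "tent g \<in> D" unfolding eq by (intro scale_mem form.diff_in u v)
  show "0 \<le> tent g x \<and> tent g x \<le> 1" "tent g x \<le> 2 * g x"
    "g x - (g x)\<^sup>2 = tent g x / 2 - (tent g x)\<^sup>2 / 4"
    using r[of x] by (auto simp: tent_def min_def max_def power2_eq_square field_simps)
  have "E (\<lambda>x. ?u x + ?v x) (\<lambda>x. ?u x + ?v x) = E (\<lambda>x. ?u x - ?v x) (\<lambda>x. ?u x - ?v x)"
    by (rule fold_E[OF u v, of "1/2"], rule AE_I2) (use r in \<open>auto simp: min_def max_def intro: antisym\<close>)
  hence "E g g = E (\<lambda>x. ?u x - ?v x) (\<lambda>x. ?u x - ?v x)" by simp
  hence "E (tent g) (tent g) = 4 * E g g"
    unfolding eq form.scale_self[OF form.diff_in[OF u v]] by simp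
  thus "N (tent g) = 2 * N g" by (simp add: real_sqrt_mult)
qed

lemma tent_funpow:
  assumes f: "f \<in> D" and r: "\<And>x. 0 \<le> f x \<and> f x \<le> 1"
  shows "(tent ^^ n) f \<in> D \<and> (\<forall>x. 0 \<le> (tent ^^ n) f x \<and> (tent ^^ n) f x \<le> 1)
    \<and> (\<forall>x. (tent ^^ n) f x \<le> 2 ^ n * f x) \<and> N ((tent ^^ n) f) = 2 ^ n * N f"
proof (induction n)
  case 0
  thus ?case using f r by simp
next
  case (Suc n)
  let ?g = "(tent ^^ n) f"
  have "tent ?g x \<le> 2 ^ Suc n * f x" for x
    using tent_props(3)[of ?g x] Suc by (auto intro: order_trans)
  thus ?case using tent_props[of ?g] Suc by simp
qed

text \<open>The Takagi-type expansion \<open>t\<^sup>2 = t - (\<Sum>k\<ge>1. T\<^sup>k t / 4\<^sup>k)\<close> on the unit interval, where \<open>T\<close> is the tent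
  map. By locality \<open>T\<close> exactly doubles the form norm, so the series converges absolutely in it.\<close>

lemma square_unit:
  assumes f: "f \<in> D" and r: "\<And>x. 0 \<le> f x \<and> f x \<le> 1"
  shows "(\<lambda>x. (f x)\<^sup>2) \<in> D" and "N (\<lambda>x. (f x)\<^sup>2) \<le> 2 * N f"
proof -
  define t where "t = (\<lambda>n. (tent ^^ n) f)"
  have t: "t n \<in> D" "0 \<le> t n x" "t n x \<le> 1" "t n x \<le> 2 ^ n * f x" "N (t n) = 2 ^ n * N f" for n x
    using tent_funpow[OF f r, of n] by (auto simp: t_def)
  have t_rec: "t n x - (t n x)\<^sup>2 = t (Suc n) x / 2 - (t (Suc n) x)\<^sup>2 / 4" for n x
    using tent_props(5)[of "t n" x] t by (simp add: t_def)
  define s where "s = (\<lambda>n x. f x - (\<Sum>k<n. t (Suc k) x / 4 ^ Suc k))"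
  have s_Suc: "s (Suc n) = (\<lambda>x. s n x - (1 / 4 ^ Suc n) * t (Suc n) x)" for n
    by (simp add: s_def fun_eq_iff)
  have s: "s n \<in> D" for n
  proof (induction n)
    case 0 thus ?case using f by (simp add: s_def)
  next
    case (Suc n) thus ?case unfolding s_Suc by (intro form.diff_in scale_mem t)
  qed
  have err: "s n x - (f x)\<^sup>2 = (t n x - (t n x)\<^sup>2) / 4 ^ n" for n x
  proof (induction n)
    case 0 thus ?case by (simp add: s_def t_def)
  next
    case (Suc n)
    have "s (Suc n) x - (f x)\<^sup>2 = (t (Suc n) x / 2 - (t (Suc n) x)\<^sup>2 / 4) / 4 ^ n - t (Suc n) x / 4 ^ Suc n"
      using Suc t_rec[of n x] by (simp add: s_Suc)
    also have "\<dots> = (t (Suc n) x - (t (Suc n) x)\<^sup>2) / 4 ^ Suc n"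
      by (simp add: diff_divide_distrib)
    finally show ?case .
  qed
  \<comment> \<open>The bound is proportional to \<open>f\<close> because the measure may be
    infinite, so that uniform smallness alone would not give convergence in L2. The iterate
    contributes 2^n, against 4^n in the denominator.\<close>
  have err_le: "\<bar>s n x - (f x)\<^sup>2\<bar> \<le> (1 / 2) ^ n * \<bar>f x\<bar>" for n x
  proof -
    have "0 \<le> t n x * (1 - t n x)" using t by (intro mult_nonneg_nonneg) (auto simp: algebra_simps)
    hence "0 \<le> t n x - (t n x)\<^sup>2" by (simp add: algebra_simps power2_eq_square)
    moreover have "t n x - (t n x)\<^sup>2 \<le> 2 ^ n * f x" using t(4)[of n x] by (smt (verit) zero_le_power2)
    ultimately have "\<bar>s n x - (f x)\<^sup>2\<bar> \<le> 2 ^ n * f x / 4 ^ n"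
      unfolding err by (simp add: divide_right_mono)
    also have "\<dots> = (1 / 2) ^ n * \<bar>f x\<bar>"
      using r[of x] by (simp add: power_divide field_simps flip: power_mult_distrib)
    finally show ?thesis .
  qed
  have f2: "(\<lambda>x. (f x)\<^sup>2) \<in> L2 M"
    by (rule L2_bound[OF D_L2[OF f], where c = 1])
      (use r D_measurable[OF f] in \<open>auto simp: power2_eq_square mult_left_le\<close>)
  have inc: "N (\<lambda>x. s m x - s n x) \<le> ((1 / 2) ^ n - (1 / 2) ^ m) * N f" if "n \<le> m" for n m
    using that
  proof (induction m rule: dec_induct)
    case base
    thus ?case using form.scale_left[OF s s, of 0 n 0] form.diff_self[OF s s, of n n] by simp
  next
    case (step m)
    have "N (\<lambda>x. (s m x - s n x) - (1 / 4 ^ Suc m) * t (Suc m) x)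
       \<le> N (\<lambda>x. s m x - s n x) + N (\<lambda>x. (1 / 4 ^ Suc m) * t (Suc m) x)"
      by (intro form.triangle_diff form.closed s t)
    moreover have "(\<lambda>x. (s m x - s n x) - (1 / 4 ^ Suc m) * t (Suc m) x) = (\<lambda>x. s (Suc m) x - s n x)"
      by (simp add: s_Suc fun_eq_iff)
    moreover have "N (\<lambda>x. (1 / 4 ^ Suc m) * t (Suc m) x) = (1 / 2) ^ Suc m * N f"
    proof -
      have "(2::real) ^ Suc m / 4 ^ Suc m = (1 / 2) ^ Suc m" unfolding power_divide[symmetric] by simp
      thus ?thesis unfolding form.sqrt_scale_self[OF t(1)] t(5)
        by (metis abs_of_nonneg divide_nonneg_nonneg mult.assoc mult.left_neutral times_divide_eq_left
            zero_le_numeral zero_le_one zero_le_power)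
    qed
    ultimately show ?case using step.IH by (simp add: algebra_simps)
  qed
  have pw: "(\<lambda>n. (1 / 2) ^ n * K) \<longlonglongrightarrow> 0" for K :: real
    by (intro tendsto_mult_left_zero LIMSEQ_power_zero) simp
  have l2_lim: "(\<lambda>n. l2_norm M (\<lambda>x. s n x - (f x)\<^sup>2)) \<longlonglongrightarrow> 0"
  proof (rule tendsto_sandwich[OF _ _ tendsto_const pw])
    have "l2_inner M (\<lambda>x. s n x - (f x)\<^sup>2) (\<lambda>x. s n x - (f x)\<^sup>2) \<le> ((1 / 2) ^ n)\<^sup>2 * l2_inner M f f" for n
      by (rule l2_inner_mono) (use err_le D_measurable s D_L2 f in auto)
    hence "sqrt (l2_inner M (\<lambda>x. s n x - (f x)\<^sup>2) (\<lambda>x. s n x - (f x)\<^sup>2))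
       \<le> sqrt (((1 / 2) ^ n)\<^sup>2 * l2_inner M f f)" for n by (rule real_sqrt_le_mono)
    thus "\<forall>\<^sub>F n in sequentially. l2_norm M (\<lambda>x. s n x - (f x)\<^sup>2) \<le> (1 / 2) ^ n * l2_norm M f"
      unfolding l2_norm_def real_sqrt_mult by simp
    show "\<forall>\<^sub>F n in sequentially. 0 \<le> l2_norm M (\<lambda>x. s n x - (f x)\<^sup>2)"
      using l2.nonneg[OF l2.diff_in[OF D_L2[OF s] f2]] by (simp add: l2_norm_def)
  qed
  have inc': "N (\<lambda>x. s m x - s n x) \<le> (1 / 2) ^ n * N f" if "n \<le> m" for n m
    using inc[OF that] form_nonneg[OF f] by (simp add: left_diff_distrib)
      (smt (verit) mult_nonneg_nonneg real_sqrt_ge_zero zero_le_divide_1_iff zero_le_power)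
  show fD: "(\<lambda>x. (f x)\<^sup>2) \<in> D" by (rule closed_limit(1)[OF s f2 l2_lim inc' pw])
  have lim: "(\<lambda>n. N (\<lambda>x. s n x - (f x)\<^sup>2)) \<longlonglongrightarrow> 0"
    by (rule closed_limit(2)[OF s f2 l2_lim inc' pw])
  \<comment> \<open>One \<open>N f\<close> comes from \<open>s 0 = f\<close>, the other bounds the
    sum of the geometric series of increments; hence the factor 2.\<close>
  have "N (\<lambda>x. (f x)\<^sup>2) \<le> 2 * N f + N (\<lambda>x. s n x - (f x)\<^sup>2)" for n
  proof -
    have "N (\<lambda>x. (s n x - s 0 x) + s 0 x) \<le> N (\<lambda>x. s n x - s 0 x) + N (s 0)"
      by (intro form.triangle form.diff_in s)
    moreover have "s 0 = f" by (simp add: s_def)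
    ultimately have "N (s n) \<le> N (\<lambda>x. s n x - s 0 x) + N f" by simp
    moreover have "N (\<lambda>x. s n x - s 0 x) \<le> N f" using inc'[of 0 n] by simp
    ultimately have "N (s n) \<le> 2 * N f" by linarith
    moreover have "N (\<lambda>x. s n x - (s n x - (f x)\<^sup>2)) \<le> N (s n) + N (\<lambda>x. s n x - (f x)\<^sup>2)"
      by (intro form.triangle_diff form.diff_in s fD)
    ultimately show ?thesis by simp
  qed
  moreover have "(\<lambda>n. 2 * N f + N (\<lambda>x. s n x - (f x)\<^sup>2)) \<longlonglongrightarrow> 2 * N f"
    using tendsto_add[OF tendsto_const lim, of "2 * N f"] by simp
  ultimately show "N (\<lambda>x. (f x)\<^sup>2) \<le> 2 * N f"
    by (intro LIMSEQ_le_const) auto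
qed

text \<open>Dividing the absolute value by \<open>c\<close> reduces this to the unit interval. It
  matters later that the constant is proportional to \<open>c\<close>, as in |grad f^2| \<le> 2 c
  |grad f|.\<close>

lemma square_B:
  assumes f: "f \<in> B" and c: "c > 0" "AE x in M. \<bar>f x\<bar> \<le> c"
  shows "(\<lambda>x. (f x)\<^sup>2) \<in> B" and "N (\<lambda>x. (f x)\<^sup>2) \<le> 2 * c * N f"
proof -
  let ?a = "\<lambda>x. (1 / c) * \<bar>f x\<bar>" and ?g = "\<lambda>x. min (max ((1 / c) * \<bar>f x\<bar>) 0) 1"
  have a: "?a \<in> D" by (intro scale_mem B_D B_abs f)
  have g: "?g \<in> D" by (rule unit_contraction_mem[OF a])
  have m: "f \<in> borel_measurable M" using B_measurable f by blast
  have ae: "AE x in M. ?g x = ?a x" using c(2)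
    by eventually_elim (use c(1) in \<open>auto simp: field_simps min_def max_def\<close>)
  have ae2: "AE x in M. c\<^sup>2 * (?g x)\<^sup>2 = (f x)\<^sup>2" using ae
    by eventually_elim (use c(1) in \<open>simp add: power_divide\<close>)
  have g2: "(\<lambda>x. (?g x)\<^sup>2) \<in> D" "N (\<lambda>x. (?g x)\<^sup>2) \<le> 2 * N ?g"
    by (rule square_unit[OF g]; simp)+
  have fD: "(\<lambda>x. (f x)\<^sup>2) \<in> D"
    by (rule ae_closed[OF scale_mem[OF g2(1)] _ ae2]) (use m in auto)
  show "(\<lambda>x. (f x)\<^sup>2) \<in> B"
    by (rule B_I[OF fD, of "c\<^sup>2"]) (use c(2) in eventually_elim, auto simp: abs_le_square_iff[symmetric] c(1) less_imp_le)
  have eq: "E (\<lambda>x. (f x)\<^sup>2) (\<lambda>x. (f x)\<^sup>2) = E (\<lambda>x. c\<^sup>2 * (?g x)\<^sup>2) (\<lambda>x. c\<^sup>2 * (?g x)\<^sup>2)"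
    by (rule E_cong[symmetric]) (use scale_mem[OF g2(1)] ae2 m in auto)
  have "N (\<lambda>x. (f x)\<^sup>2) = c\<^sup>2 * N (\<lambda>x. (?g x)\<^sup>2)"
    unfolding eq form.sqrt_scale_self[OF g2(1)] by simp
  also have "\<dots> \<le> c\<^sup>2 * (2 * N ?g)" using g2(2) by (intro mult_left_mono) auto
  also have "E ?g ?g = E ?a ?a"
    by (rule E_cong) (use g m ae in auto)
  also have "\<dots> = (1 / c)\<^sup>2 * E f f"
    using form.scale_self[OF B_D[OF B_abs(1)[OF f]], of "1 / c"] B_abs(2)[OF f] by simp
  also have "c\<^sup>2 * (2 * sqrt ((1 / c)\<^sup>2 * E f f)) = 2 * c * N f"
    using c(1) by (simp add: real_sqrt_mult power2_eq_square real_sqrt_divide)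
  finally show "N (\<lambda>x. (f x)\<^sup>2) \<le> 2 * c * N f" .
qed

section \<open>Products of bounded elements\<close>

lemma mult_B:
  assumes f: "f \<in> B" and g: "g \<in> B"
  shows "(\<lambda>x. f x * g x) \<in> B"
proof -
  have "(\<lambda>x. (h x)\<^sup>2) \<in> B" if "h \<in> B" for h
    using that B_boundE square_B(1) by metis
  from this[OF B_add[OF f g]] this[OF B_diff[OF f g]]
  have "(\<lambda>x. (1 / 4) * ((f x + g x)\<^sup>2 - (f x - g x)\<^sup>2)) \<in> B" by (intro B_scale B_diff)
  thus ?thesis by (simp add: power2_sum power2_diff)
qed

lemmas B_closed = B_add B_diff B_scale B_uminus mult_B

lemma power2_B: "f \<in> B \<Longrightarrow> (\<lambda>x. (f x)\<^sup>2) \<in> B"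
  unfolding power2_eq_square by (rule mult_B)

text \<open>Polarisation of \<open>square_B\<close>. Since the constant is linear in the sup bounds,
  products of uniformly small functions of bounded energy have small energy.\<close>

lemma product_bound:
  assumes f: "f \<in> B" "AE x in M. \<bar>f x\<bar> \<le> a" and g: "g \<in> B" "AE x in M. \<bar>g x\<bar> \<le> b" and ab: "a + b > 0"
  shows "N (\<lambda>x. f x * g x) \<le> (a + b) * (N f + N g)"
proof -
  let ?p = "\<lambda>x. (f x + g x)\<^sup>2" and ?q = "\<lambda>x. (f x - g x)\<^sup>2"
  have p: "?p \<in> B" and q: "?q \<in> B" using f g by (auto intro!: power2_B B_closed)
  have "N ?p \<le> 2 * (a + b) * N (\<lambda>x. f x + g x)"
    by (rule square_B(2)[OF B_add[OF f(1) g(1)] ab]) (use f(2) g(2) in \<open>eventually_elim, linarith\<close>)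
  also have "\<dots> \<le> 2 * (a + b) * (N f + N g)"
    using form.triangle[of f g] B_D f g ab by (intro mult_left_mono) auto
  finally have 1: "N ?p \<le> 2 * (a + b) * (N f + N g)" .
  have "N ?q \<le> 2 * (a + b) * N (\<lambda>x. f x - g x)"
    by (rule square_B(2)[OF B_diff[OF f(1) g(1)] ab]) (use f(2) g(2) in \<open>eventually_elim, linarith\<close>)
  also have "\<dots> \<le> 2 * (a + b) * (N f + N g)"
    using form.triangle_diff[of f g] B_D f g ab by (intro mult_left_mono) auto
  finally have 2: "N ?q \<le> 2 * (a + b) * (N f + N g)" .
  have eq: "(\<lambda>x. f x * g x) = (\<lambda>x. (1 / 4) * (?p x - ?q x))"
    by (simp add: power2_sum power2_diff)
  have "N (\<lambda>x. f x * g x) = N (\<lambda>x. ?p x - ?q x) / 4"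
    unfolding eq form.scale_self[OF form.diff_in[OF B_D[OF p] B_D[OF q]]] real_sqrt_mult by simp
  also have "\<dots> \<le> (N ?p + N ?q) / 4"
    using form.triangle_diff[OF B_D[OF p] B_D[OF q]] by simp
  finally show ?thesis using 1 2 by (simp add: algebra_simps)
qed

text \<open>Scaling \<open>m\<close> by sqrt t and \<open>y\<close> by its inverse makes
  \<open>product_bound\<close> asymmetric. When first \<open>b\<close> and then \<open>t\<close>
  tends to 0, the coefficients tend to 0 and 1: asymptotically, multiplying a uniformly small
  \<open>y\<close> by \<open>m\<close> does not increase its energy.\<close>

lemma product_bound_unit:
  assumes m: "m \<in> B" "AE x in M. \<bar>m x\<bar> \<le> 1" and y: "y \<in> B" "AE x in M. \<bar>y x\<bar> \<le> b"
    and "b \<ge> 0" "t > 0"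
  shows "N (\<lambda>x. m x * y x) \<le> (t + b) * N m + (1 + b / t) * N y"
proof -
  define s where "s = sqrt t"
  have s: "s > 0" "t = s * s" using assms by (auto simp: s_def)
  have "N (\<lambda>x. (s * m x) * ((1 / s) * y x)) \<le> (s + b / s) * (N (\<lambda>x. s * m x) + N (\<lambda>x. (1 / s) * y x))"
  proof (rule product_bound)
    show "(\<lambda>x. s * m x) \<in> B" "(\<lambda>x. (1 / s) * y x) \<in> B" using B_scale m y by blast+
    show "AE x in M. \<bar>s * m x\<bar> \<le> s" using m(2)
      by eventually_elim (use s in \<open>simp add: abs_mult\<close>)
    show "AE x in M. \<bar>(1 / s) * y x\<bar> \<le> b / s" using y(2)
      by eventually_elim (use s in \<open>simp add: abs_mult divide_right_mono\<close>)
    show "0 < s + b / s" using s assms by (simp add: add_pos_nonneg)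
  qed
  also have "N (\<lambda>x. s * m x) = s * N m"
    unfolding form.sqrt_scale_self[OF B_D[OF m(1)]] using s by simp
  also have "N (\<lambda>x. (1 / s) * y x) = N y / s"
    unfolding form.sqrt_scale_self[OF B_D[OF y(1)]] using s by simp
  also have "(s + b / s) * (s * N m + N y / s) = (t + b) * N m + (1 + b / t) * N y"
    using s by (simp add: field_simps)
  finally show ?thesis using s by simp
qed

end

section \<open>Folding and the Leibniz rule\<close>

context local_dirichlet_form
begin

text \<open>The polarisation of the truncated form. For a gradient energy it is the integral of
  \<xi> grad f . grad g, and the identities below can be read in this way.\<close>

definition G :: "('a \<Rightarrow> real) \<Rightarrow> ('a \<Rightarrow> real) \<Rightarrow> ('a \<Rightarrow> real) \<Rightarrow> real" where
  "G \<xi> f g = (E f (\<lambda>x. \<xi> x * g x) + E g (\<lambda>x. \<xi> x * f x) - E \<xi> (\<lambda>x. f x * g x)) / 2"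

lemma truncated_form_G: "truncated_form E \<xi> f = G \<xi> f f"
  by (simp add: truncated_form_def G_def power2_eq_square)

text \<open>Twice the defect of the Leibniz rule for \<open>G\<close>, which turns out to be symmetric in all four
  arguments; it thus vanishes by polarisation once it does on the diagonal.\<close>

definition quart ::
  "('a \<Rightarrow> real) \<Rightarrow> ('a \<Rightarrow> real) \<Rightarrow> ('a \<Rightarrow> real) \<Rightarrow> ('a \<Rightarrow> real) \<Rightarrow> real" where
  "quart a b c d =
     E (\<lambda>x. a x * b x) (\<lambda>x. c x * d x) + E (\<lambda>x. a x * c x) (\<lambda>x. b x * d x)
     + E (\<lambda>x. a x * d x) (\<lambda>x. b x * c x)
     - E a (\<lambda>x. b x * (c x * d x)) - E b (\<lambda>x. a x * (c x * d x))
     - E c (\<lambda>x. a x * (b x * d x)) - E d (\<lambda>x. a x * (b x * c x))"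

lemma G_sym: "G \<xi> f g = G \<xi> g f"
  by (simp add: G_def mult.commute)

lemmas B_simps = B_D B_closed power2_B form.bilinear distrib_left distrib_right
  left_diff_distrib right_diff_distrib

lemma G_add:
  assumes "\<xi> \<in> B" "f \<in> B" "f' \<in> B" "g \<in> B"
  shows "G \<xi> (\<lambda>x. f x + f' x) g = G \<xi> f g + G \<xi> f' g"
  unfolding G_def using assms by (simp add: B_simps add_divide_distrib diff_divide_distrib)

lemma G_scale:
  assumes "\<xi> \<in> B" "f \<in> B" "g \<in> B"
  shows "G \<xi> (\<lambda>x. c * f x) g = c * G \<xi> f g"
proof -
  have "(\<lambda>x. \<xi> x * (c * f x)) = (\<lambda>x. c * (\<xi> x * f x))" by (simp add: mult.left_commute)
  thus ?thesis unfolding G_def using assms by (simp add: B_simps mult.assoc algebra_simps)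
qed

lemma G_weight_add:
  assumes "\<xi> \<in> B" "\<xi>' \<in> B" "f \<in> B" "g \<in> B"
  shows "G (\<lambda>x. \<xi> x + \<xi>' x) f g = G \<xi> f g + G \<xi>' f g"
  unfolding G_def using assms by (simp add: B_simps add_divide_distrib diff_divide_distrib)

lemma G_weight_scale:
  assumes "\<xi> \<in> B" "f \<in> B" "g \<in> B"
  shows "G (\<lambda>x. c * \<xi> x) f g = c * G \<xi> f g"
  unfolding G_def using assms by (simp add: B_simps mult.assoc algebra_simps)

lemma G_weight_diff:
  assumes "\<xi> \<in> B" "\<xi>' \<in> B" "f \<in> B" "g \<in> B"
  shows "G (\<lambda>x. \<xi> x - \<xi>' x) f g = G \<xi> f g - G \<xi>' f g"
  unfolding G_def using assms by (simp add: B_simps add_divide_distrib diff_divide_distrib)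

lemma G_uminus: "\<lbrakk>\<xi> \<in> B; f \<in> B; g \<in> B\<rbrakk> \<Longrightarrow> G \<xi> (\<lambda>x. - f x) g = - G \<xi> f g"
  using G_scale[of \<xi> f g "-1"] by simp

lemma G_add_self:
  assumes "\<xi> \<in> B" "f \<in> B" "g \<in> B"
  shows "G \<xi> (\<lambda>x. f x + g x) (\<lambda>x. f x + g x) = G \<xi> f f + 2 * G \<xi> f g + G \<xi> g g"
  using assms G_sym[of \<xi> f "\<lambda>x. f x + g x"] G_sym[of \<xi> g "\<lambda>x. f x + g x"] G_sym[of \<xi> g f]
  by (simp add: G_add B_closed)

lemma quart_sym12:
  assumes "a \<in> B" "b \<in> B" "c \<in> B" "d \<in> B"
  shows "quart a b c d = quart b a c d"
  unfolding quart_def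
  using assms form_sym[of "\<lambda>x. a x * c x" "\<lambda>x. b x * d x"] form_sym[of "\<lambda>x. a x * d x" "\<lambda>x. b x * c x"]
  by (simp add: B_D B_closed mult_ac)

lemma quart_sym_pairs:
  assumes "a \<in> B" "b \<in> B" "c \<in> B" "d \<in> B"
  shows "quart a b c d = quart c d a b"
  unfolding quart_def
  using assms form_sym[of "\<lambda>x. a x * b x" "\<lambda>x. c x * d x"] form_sym[of "\<lambda>x. a x * d x" "\<lambda>x. b x * c x"]
  by (simp add: B_D B_closed mult_ac)

lemma quart_add:
  assumes "a \<in> B" "a' \<in> B" "b \<in> B" "c \<in> B" "d \<in> B"
  shows "quart (\<lambda>x. a x + a' x) b c d = quart a b c d + quart a' b c d"
  unfolding quart_def using assms by (simp add: B_simps)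

lemma quart_uminus:
  assumes "a \<in> B" "b \<in> B" "c \<in> B" "d \<in> B"
  shows "quart (\<lambda>x. - a x) b c d = - quart a b c d"
  unfolding quart_def using assms by (simp add: B_simps)

lemma quart_add_self:
  assumes "a \<in> B" "b \<in> B" "c \<in> B" "d \<in> B"
  shows "quart (\<lambda>x. a x + b x) (\<lambda>x. a x + b x) c d = quart a a c d + 2 * quart a b c d + quart b b c d"
  using assms quart_sym12[of a "\<lambda>x. a x + b x" c d] quart_sym12[of b "\<lambda>x. a x + b x" c d]
    quart_sym12[of b a c d]
  by (simp add: quart_add B_closed)

lemma product_orthogonal:
  assumes "p \<in> B" "q \<in> B" "AE x in M. p x * q x = 0"
  shows "E p q = 0"
  using orthogonal[of p q 0] assms B_D by simp

text \<open>Next to \<open>v\<close>, the function \<open>u\<close> acts as the constant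
  \<open>a\<close>. One of the three terms of \<open>G\<close> vanishes by locality, and the other
  two become \<open>a * E v \<xi>\<close> with opposite signs.\<close>

lemma G_orthogonal:
  assumes "\<xi> \<in> B" "u \<in> B" "v \<in> B" and null: "AE x in M. (u x - a) * v x = 0"
  shows "G \<xi> u v = 0"
proof -
  note B = assms(1-3)
  have 1: "E u (\<lambda>x. \<xi> x * v x) = 0"
    by (rule orthogonal[where a = a]) (use B null B_D B_closed in \<open>auto elim!: eventually_mono\<close>)
  have "E v (\<lambda>x. \<xi> x * u x - a * \<xi> x) = 0"
  proof (rule product_orthogonal)
    show "AE x in M. v x * (\<xi> x * u x - a * \<xi> x) = 0"
      using null by eventually_elim auto
  qed (use B B_closed in auto)
  hence 2: "E v (\<lambda>x. \<xi> x * u x) = a * E v \<xi>" using B by (simp add: B_simps)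
  have "E \<xi> (\<lambda>x. u x * v x) = E \<xi> (\<lambda>x. a * v x)"
    by (rule E_cong) (use B B_closed B_D B_measurable null in \<open>auto elim!: eventually_mono\<close>)
  hence 3: "E \<xi> (\<lambda>x. u x * v x) = a * E v \<xi>" using B form_sym[of v \<xi>] by (simp add: B_simps)
  show ?thesis unfolding G_def 1 2 3 by simp
qed

text \<open>As in \<open>G_orthogonal\<close>, \<open>u\<close> may be replaced by \<open>a\<close>
  wherever it meets \<open>v\<close>. The three terms that pair two products then cancel against
  three of the others, and the term with \<open>u\<close> alone vanishes by locality.\<close>

lemma quart_orthogonal:
  assumes "u \<in> B" "v \<in> B" "g \<in> B" "h \<in> B" and null: "AE x in M. (u x - a) * v x = 0"
  shows "quart u v g h = 0"
proof -
  note B = assms(1-4)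
  have uv: "E k (\<lambda>x. u x * (v x * w x)) = a * E k (\<lambda>x. v x * w x)" if "k \<in> B" "w \<in> B" for k w
  proof -
    have "E k (\<lambda>x. u x * (v x * w x)) = E k (\<lambda>x. a * (v x * w x))"
      by (rule E_cong) (use that B B_closed B_D B_measurable null in \<open>auto elim!: eventually_mono\<close>)
    thus ?thesis using that B by (simp add: B_simps)
  qed
  have uw: "E (\<lambda>x. u x * k x) (\<lambda>x. v x * w x) = a * E k (\<lambda>x. v x * w x)" if "k \<in> B" "w \<in> B" for k w
  proof -
    have "E (\<lambda>x. u x * k x - a * k x) (\<lambda>x. v x * w x) = 0"
    proof (rule product_orthogonal)
      show "AE x in M. (u x * k x - a * k x) * (v x * w x) = 0"
        using null by eventually_elim auto
    qed (use that B B_closed in auto)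
    thus ?thesis using that B by (simp add: B_simps)
  qed
  have vu: "E v (\<lambda>x. u x * w x) = a * E v w" if "w \<in> B" for w
  proof -
    have "E v (\<lambda>x. u x * w x - a * w x) = 0"
    proof (rule product_orthogonal)
      show "AE x in M. v x * (u x * w x - a * w x) = 0" using null by eventually_elim auto
    qed (use that B B_closed in auto)
    thus ?thesis using that B by (simp add: B_simps)
  qed
  have u: "E u (\<lambda>x. v x * (g x * h x)) = 0"
    by (rule orthogonal[where a = a]) (use B null B_D B_closed in \<open>auto elim!: eventually_mono\<close>)
  have "E (\<lambda>x. u x * v x) (\<lambda>x. g x * h x) = E (\<lambda>x. a * v x) (\<lambda>x. g x * h x)"
    by (rule E_cong) (use B B_closed B_D B_measurable null in \<open>auto elim!: eventually_mono\<close>)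
  hence "E (\<lambda>x. u x * v x) (\<lambda>x. g x * h x) = a * E v (\<lambda>x. g x * h x)" using B by (simp add: B_simps)
  thus ?thesis unfolding quart_def
    using uv[of g h] uv[of h g] uw[of g h] uw[of h g] u vu[of "\<lambda>x. g x * h x"] B
    by (simp add: B_closed)
qed

text \<open>Weighted energies and \<open>quart\<close> are included, with arbitrary remaining
  arguments, so that \<open>z\<close> can stand in for \<open>f\<close> inside all expressions
  needed later. The relation is transitive, hence folds can be iterated.\<close>

definition fold_equiv :: "('a \<Rightarrow> real) \<Rightarrow> ('a \<Rightarrow> real) \<Rightarrow> bool" where
  "fold_equiv f z \<longleftrightarrow> f \<in> B \<and> z \<in> B \<and> E z z = E f f \<and> (\<forall>\<xi>\<in>B. G \<xi> z z = G \<xi> f f)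
     \<and> (\<forall>g\<in>B. \<forall>h\<in>B. quart z z g h = quart f f g h)"

lemma fold_equiv_sym: "fold_equiv f z \<Longrightarrow> fold_equiv z f"
  by (simp add: fold_equiv_def)

lemma fold_equiv_trans: "fold_equiv f z \<Longrightarrow> fold_equiv z w \<Longrightarrow> fold_equiv f w"
  by (simp add: fold_equiv_def)

lemma fold_equiv_reflect:
  assumes u: "u \<in> B" and v: "v \<in> B" and null: "AE x in M. (u x - a) * v x = 0"
  shows "fold_equiv (\<lambda>x. u x + v x) (\<lambda>x. u x - v x)"
proof -
  have n: "(\<lambda>x. - v x) \<in> B" and eq: "(\<lambda>x. u x - v x) = (\<lambda>x. u x + (- v x))"
    using B_uminus[OF v] by auto
  have null': "AE x in M. (u x - a) * (- v x) = 0" using null by eventually_elim auto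
  have nn: "G \<xi> (\<lambda>x. - v x) (\<lambda>x. - v x) = G \<xi> v v" if "\<xi> \<in> B" for \<xi>
    using G_uminus[OF that v n] G_uminus[OF that v v] G_sym[of \<xi> v "\<lambda>x. - v x"] by simp
  have qq: "quart (\<lambda>x. - v x) (\<lambda>x. - v x) g h = quart v v g h" if "g \<in> B" "h \<in> B" for g h
    using quart_uminus[OF v n that] quart_uminus[OF v v that] quart_sym12[OF v n that] by simp
  show ?thesis unfolding fold_equiv_def
  proof (intro conjI ballI)
    show "E (\<lambda>x. u x - v x) (\<lambda>x. u x - v x) = E (\<lambda>x. u x + v x) (\<lambda>x. u x + v x)"
      using fold_E[OF B_D[OF u] B_D[OF v] null] by simp
    show "G \<xi> (\<lambda>x. u x - v x) (\<lambda>x. u x - v x) = G \<xi> (\<lambda>x. u x + v x) (\<lambda>x. u x + v x)"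
      if "\<xi> \<in> B" for \<xi>
      unfolding eq G_add_self[OF that u v] G_add_self[OF that u n] nn[OF that]
      using G_orthogonal[OF that u v null] G_orthogonal[OF that u n null'] by simp
    show "quart (\<lambda>x. u x - v x) (\<lambda>x. u x - v x) g h = quart (\<lambda>x. u x + v x) (\<lambda>x. u x + v x) g h"
      if "g \<in> B" "h \<in> B" for g h
      unfolding eq quart_add_self[OF u v that] quart_add_self[OF u n that] qq[OF that]
      using quart_orthogonal[OF u v that null] quart_orthogonal[OF u n that null'] by simp
  qed (use u v B_closed in auto)
qed

lemma fold_exists:
  assumes f: "f \<in> B" and c: "AE x in M. \<bar>f x\<bar> \<le> c" "c > 0"
  shows "\<exists>z. fold_equiv f z \<and> (AE x in M. 0 \<le> z x \<and> z x \<le> c / 2 ^ n)"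
proof (induction n)
  case 0
  let ?u = "\<lambda>x. max (f x) 0" and ?v = "\<lambda>x. max (- f x) 0"
  have "fold_equiv (\<lambda>x. ?u x + ?v x) (\<lambda>x. ?u x - ?v x)"
    by (rule fold_equiv_reflect[where a = 0]) (use B_pos_part f B_uminus in auto)
  hence "fold_equiv (\<lambda>x. ?u x - ?v x) (\<lambda>x. ?u x + ?v x)" by (rule fold_equiv_sym)
  moreover have "(\<lambda>x. ?u x - ?v x) = f" "(\<lambda>x. ?u x + ?v x) = (\<lambda>x. \<bar>f x\<bar>)" by auto
  ultimately have "fold_equiv f (\<lambda>x. \<bar>f x\<bar>)" by simp
  thus ?case using c(1) by (intro exI[of _ "\<lambda>x. \<bar>f x\<bar>"]) auto
next
  case (Suc n)
  then obtain z where z: "fold_equiv f z" and zb: "AE x in M. 0 \<le> z x \<and> z x \<le> c / 2 ^ n" by blast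
  \<comment> \<open>Half of the current bound: where \<open>z\<close> exceeds \<open>a\<close>, the
    folded function is \<open>2 * a - z\<close>, and this lies between 0 and
    \<open>a\<close>.\<close>
  define a where "a = c / 2 ^ Suc n"
  have a: "a > 0" "c / 2 ^ n = 2 * a" using c(2) by (auto simp: a_def)
  let ?u = "\<lambda>x. min (max (z x) 0) a"
  let ?v = "\<lambda>x. z x - ?u x"
  have zB: "z \<in> B" using z by (simp add: fold_equiv_def)
  have u: "?u \<in> B" using B_cut[OF zB] a by simp
  have "fold_equiv (\<lambda>x. ?u x + ?v x) (\<lambda>x. ?u x - ?v x)"
  proof (rule fold_equiv_reflect[OF u B_diff[OF zB u], of a])
    show "AE x in M. (?u x - a) * ?v x = 0" using zb
      by eventually_elim (auto simp: min_def max_def)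
  qed
  hence "fold_equiv z (\<lambda>x. ?u x - ?v x)" by simp
  hence "fold_equiv f (\<lambda>x. ?u x - ?v x)" by (rule fold_equiv_trans[OF z])
  moreover have "AE x in M. 0 \<le> ?u x - ?v x \<and> ?u x - ?v x \<le> a"
    using zb
  proof eventually_elim
    case (elim x)
    hence "?u x = min (z x) a" "z x \<le> 2 * a" using a(2) by auto
    thus ?case using elim a(1) by (cases "z x \<le> a") auto
  qed
  ultimately show ?case unfolding a_def by blast
qed

text \<open>Uniform convergence to 0 with merely bounded energy. The energies of a sequence of folds
  are constant, so nothing stronger can be asked; \<open>product_bound\<close> turns this into
  vanishing energy of products.\<close>

definition null_seq :: "(nat \<Rightarrow> 'a \<Rightarrow> real) \<Rightarrow> bool" where
  "null_seq z \<longleftrightarrow> (\<forall>n. z n \<in> B) \<and> (\<exists>b. b \<longlonglongrightarrow> 0 \<and> (\<forall>n. b n > 0 \<and> (AE x in M. \<bar>z n x\<bar> \<le> b n)))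
     \<and> (\<exists>K. \<forall>n. N (z n) \<le> K)"

lemma null_seqE:
  assumes "null_seq z"
  obtains b K where "\<And>n. z n \<in> B" "b \<longlonglongrightarrow> 0" "\<And>n. b n > 0" "\<And>n. AE x in M. \<bar>z n x\<bar> \<le> b n"
    "\<And>n. N (z n) \<le> K"
  using assms unfolding null_seq_def by blast

lemma fold_seq:
  assumes f: "f \<in> B"
  obtains z where "\<And>n. fold_equiv f (z n)" "null_seq z"
proof -
  obtain c where c: "c > 0" "AE x in M. \<bar>f x\<bar> \<le> c" using B_boundE f by metis
  obtain z where z: "\<And>n. fold_equiv f (z n)" "\<And>n. AE x in M. 0 \<le> z n x \<and> z n x \<le> c / 2 ^ n"
    using fold_exists[OF f c(2,1)] by metis
  have "null_seq z" unfolding null_seq_def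
  proof (intro conjI exI allI)
    show "(\<lambda>n. c / 2 ^ n) \<longlonglongrightarrow> 0"
      using tendsto_mult_left_zero[OF LIMSEQ_power_zero[of "1 / 2 :: real"], of c]
      by (simp add: power_divide field_simps)
    show "AE x in M. \<bar>z n x\<bar> \<le> c / 2 ^ n" for n using z(2)[of n] by eventually_elim auto
    show "N (z n) \<le> N f" for n using z(1)[of n] by (simp add: fold_equiv_def)
  qed (use z c in \<open>auto simp: fold_equiv_def\<close>)
  thus thesis using that z by blast
qed

text \<open>The second claim allows the first to be applied again, to triple products.\<close>

lemma null_seq_mult:
  assumes "null_seq z" "null_seq w"
  shows "(\<lambda>n. N (\<lambda>x. z n x * w n x)) \<longlonglongrightarrow> 0" and "null_seq (\<lambda>n x. z n x * w n x)"
proof -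
  obtain b K where z: "\<And>n. z n \<in> B" "b \<longlonglongrightarrow> 0" "\<And>n. b n > 0" "\<And>n. AE x in M. \<bar>z n x\<bar> \<le> b n"
    "\<And>n. N (z n) \<le> K" using null_seqE[OF assms(1)] by metis
  obtain c L where w: "\<And>n. w n \<in> B" "c \<longlonglongrightarrow> 0" "\<And>n. c n > 0" "\<And>n. AE x in M. \<bar>w n x\<bar> \<le> c n"
    "\<And>n. N (w n) \<le> L" using null_seqE[OF assms(2)] by metis
  have le: "N (\<lambda>x. z n x * w n x) \<le> (b n + c n) * (K + L)" for n
  proof -
    have "N (\<lambda>x. z n x * w n x) \<le> (b n + c n) * (N (z n) + N (w n))"
      using z(3)[of n] w(3)[of n] by (intro product_bound z w) auto
    also have "\<dots> \<le> (b n + c n) * (K + L)"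
      using z(3,5)[of n] w(3,5)[of n] by (intro mult_left_mono) auto
    finally show ?thesis .
  qed
  have 0: "(\<lambda>n. (b n + c n) * (K + L)) \<longlonglongrightarrow> 0"
    using tendsto_add[OF z(2) w(2)] by (auto intro: tendsto_mult_left_zero)
  show lim: "(\<lambda>n. N (\<lambda>x. z n x * w n x)) \<longlonglongrightarrow> 0"
    by (rule tendsto_sandwich[OF _ _ tendsto_const 0])
      (use le form_nonneg B_D mult_B z w in auto)
  hence "Bseq (\<lambda>n. N (\<lambda>x. z n x * w n x))" using convergentI convergent_imp_Bseq by blast
  then obtain J where J: "\<And>n. norm (N (\<lambda>x. z n x * w n x)) \<le> J" unfolding Bseq_def by blast
  show "null_seq (\<lambda>n x. z n x * w n x)" unfolding null_seq_def
  proof (intro conjI exI allI)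
    show "(\<lambda>n. b n * c n) \<longlonglongrightarrow> 0" using tendsto_mult[OF z(2) w(2)] by simp
    show "0 < b n * c n" for n using z w by simp
    show "AE x in M. \<bar>z n x * w n x\<bar> \<le> b n * c n" for n
      using z(4)[of n] w(4)[of n]
      by eventually_elim (use z(3)[of n] in \<open>auto simp: abs_mult intro!: mult_mono\<close>)
    show "N (\<lambda>x. z n x * w n x) \<le> J" for n using J[of n] by simp
  qed (use z w mult_B in auto)
qed

lemma E_tendsto_0:
  assumes "\<And>n. p n \<in> D" "\<And>n. q n \<in> D" "\<And>n. N (p n) \<le> K" "(\<lambda>n. N (q n)) \<longlonglongrightarrow> 0"
  shows "(\<lambda>n. E (p n) (q n)) \<longlonglongrightarrow> 0"
proof (rule tendsto_rabs_zero_cancel, rule tendsto_sandwich[OF _ _ tendsto_const])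
  have "\<bar>E (p n) (q n)\<bar> \<le> K * N (q n)" for n
    using form.cauchy_schwarz[OF assms(1,2), of n n] assms(3)[of n] form_nonneg[OF assms(2)[of n]]
    by (meson mult_right_mono order_trans real_sqrt_ge_zero)
  thus "\<forall>\<^sub>F n in sequentially. \<bar>E (p n) (q n)\<bar> \<le> K * N (q n)" by simp
  show "(\<lambda>n. K * N (q n)) \<longlonglongrightarrow> 0" using assms(4) by (rule tendsto_mult_right_zero)
qed simp

text \<open>Locality makes \<open>quart f f g h\<close> invariant under folding of \<open>f\<close>, while repeated folding makes
  \<open>f\<close> uniformly small without changing its energy.\<close>

lemma quart_eq_0:
  assumes "a \<in> B" "b \<in> B" "c \<in> B" "d \<in> B"
  shows "quart a b c d = 0"
proof -
  have diag: "quart f f g g = 0" if f: "f \<in> B" and g: "g \<in> B" for f g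
  proof -
    obtain z where z: "\<And>n. fold_equiv f (z n)" "null_seq z" using fold_seq[OF f] by metis
    obtain w where w: "\<And>n. fold_equiv g (w n)" "null_seq w" using fold_seq[OF g] by metis
    have B: "z n \<in> B" "w n \<in> B" for n using z w by (auto simp: fold_equiv_def)
    \<comment> \<open>Both functions have to be folded: if only \<open>f\<close> became small, the
      term \<open>E (\<lambda>x. f x * g x) (\<lambda>x. f x * g x)\<close> would survive.
      Exchanging the pairs gives access to \<open>g\<close>.\<close>
    have eq: "quart f f g g = quart (z n) (z n) (w n) (w n)" for n
    proof -
      have "quart f f g g = quart (z n) (z n) g g" using z(1)[of n] g by (simp add: fold_equiv_def)
      also have "\<dots> = quart g g (z n) (z n)" by (intro quart_sym_pairs B g)
      also have "\<dots> = quart (w n) (w n) (z n) (z n)" using w(1)[of n] B by (simp add: fold_equiv_def)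
      also have "\<dots> = quart (z n) (z n) (w n) (w n)" by (intro quart_sym_pairs B)
      finally show ?thesis .
    qed
    note zz = null_seq_mult[OF z(2) z(2)] and ww = null_seq_mult[OF w(2) w(2)]
      and zw = null_seq_mult[OF z(2) w(2)]
    note zww = null_seq_mult(1)[OF z(2) ww(2)] and zzw = null_seq_mult(1)[OF z(2) zw(2)]
    obtain K L J J' where K: "\<And>n. N (z n) \<le> K" and L: "\<And>n. N (w n) \<le> L"
      and J: "\<And>n. N (\<lambda>x. z n x * z n x) \<le> J" and J': "\<And>n. N (\<lambda>x. z n x * w n x) \<le> J'"
      using z(2) w(2) zz(2) zw(2) unfolding null_seq_def by blast
    have D: "(\<lambda>x. p x * q x) \<in> D" if "p \<in> B" "q \<in> B" for p q
      using that B_D mult_B by blast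
    note in_D = D[OF B(1,1)] D[OF B(2,2)] D[OF B(1,2)] B_D[OF B(1)] B_D[OF B(2)]
      D[OF B(1) mult_B[OF B(1,2)]] D[OF B(1) mult_B[OF B(2,2)]]
    \<comment> \<open>In each term of \<open>quart\<close> one argument has bounded energy and the
      other is a product of two null sequences.\<close>
    have lims: "(\<lambda>n. E (\<lambda>x. z n x * z n x) (\<lambda>x. w n x * w n x)) \<longlonglongrightarrow> 0"
      "(\<lambda>n. E (\<lambda>x. z n x * w n x) (\<lambda>x. z n x * w n x)) \<longlonglongrightarrow> 0"
      "(\<lambda>n. E (z n) (\<lambda>x. z n x * (w n x * w n x))) \<longlonglongrightarrow> 0"
      "(\<lambda>n. E (w n) (\<lambda>x. z n x * (z n x * w n x))) \<longlonglongrightarrow> 0"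
      by (rule E_tendsto_0[OF _ _ J ww(1)] E_tendsto_0[OF _ _ J' zw(1)] E_tendsto_0[OF _ _ K zww]
          E_tendsto_0[OF _ _ L zzw]; intro in_D)+
    have "(\<lambda>n. quart (z n) (z n) (w n) (w n)) \<longlonglongrightarrow> 0 + 0 + 0 - 0 - 0 - 0 - 0"
      unfolding quart_def by (intro tendsto_add tendsto_diff lims)
    hence "(\<lambda>n. quart f f g g) \<longlonglongrightarrow> 0" unfolding eq[symmetric] by simp
    thus ?thesis using LIMSEQ_unique tendsto_const by blast
  qed
  \<comment> \<open>Polarisation in one pair and then, after exchanging the pairs, in the
    other.\<close>
  have half: "quart f f' g g = 0" if "f \<in> B" "f' \<in> B" "g \<in> B" for f f' g
    using quart_add_self[OF that(1,2,3,3)] diag that B_add by simp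
  have "quart c d a b = 0"
    using quart_add_self[of a b c d] half[of c d a] half[of c d b] half[of c d "\<lambda>x. a x + b x"] assms
      quart_sym_pairs[of a b c d] quart_sym_pairs[of a a c d] quart_sym_pairs[of b b c d]
      quart_sym_pairs[of "\<lambda>x. a x + b x" "\<lambda>x. a x + b x" c d] B_add[of a b]
    by simp
  thus ?thesis using quart_sym_pairs assms by simp
qed

lemma leibniz:
  assumes "\<xi> \<in> B" "f \<in> B" "g \<in> B" "h \<in> B"
  shows "G \<xi> (\<lambda>x. f x * g x) h = G (\<lambda>x. \<xi> x * f x) g h + G (\<lambda>x. \<xi> x * g x) f h"
  using quart_eq_0[OF assms] assms form_sym[of "\<lambda>x. f x * g x" "\<lambda>x. \<xi> x * h x"]
  unfolding quart_def G_def by (simp add: B_D B_closed mult_ac field_simps)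

section \<open>Weighted energies\<close>

text \<open>For a gradient energy this reads \<omega>^2 |grad h|^2 = |grad (\<omega> h)|^2 - grad
  \<omega> . grad (\<omega> h^2). It serves twice: folding \<open>h\<close> makes the last term
  vanish and exhibits \<open>G\<close> as a limit of energies, and with \<omega> = \<phi>, h =
  \<beta> it connects the Hardy inequality with \<open>H \<phi>\<close>.\<close>

lemma G_square_weight:
  assumes w: "\<omega> \<in> B" and h: "h \<in> B"
  shows "G (\<lambda>x. (\<omega> x)\<^sup>2) h h = E (\<lambda>x. \<omega> x * h x) (\<lambda>x. \<omega> x * h x) - E \<omega> (\<lambda>x. \<omega> x * (h x * h x))"
  using quart_eq_0[OF w w h h] unfolding quart_def G_def
  by (simp add: power2_eq_square mult_ac)

lemma mult_null_seq:
  assumes w: "\<omega> \<in> B" and z: "null_seq z" and lim: "(\<lambda>n. N (z n)) \<longlonglongrightarrow> 0"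
  shows "(\<lambda>n. N (\<lambda>x. \<omega> x * z n x)) \<longlonglongrightarrow> 0"
proof -
  obtain b K where z: "\<And>n. z n \<in> B" "b \<longlonglongrightarrow> 0" "\<And>n. b n > 0" "\<And>n. AE x in M. \<bar>z n x\<bar> \<le> b n"
    using null_seqE[OF z] by metis
  obtain c where c: "c > 0" "AE x in M. \<bar>\<omega> x\<bar> \<le> c" using B_boundE w by metis
  let ?m = "\<lambda>x. (1 / c) * \<omega> x"
  have m: "?m \<in> B" "AE x in M. \<bar>?m x\<bar> \<le> 1"
    by (rule B_scale[OF w], use c(2) in eventually_elim, use c(1) in \<open>simp add: abs_mult\<close>)
  have le: "N (\<lambda>x. \<omega> x * z n x) \<le> c * ((b n + b n) * N ?m + 2 * N (z n))" for n
  proof -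
    have mz: "(\<lambda>x. ?m x * z n x) \<in> D" by (intro B_D mult_B m z)
    \<comment> \<open>The parameter of \<open>product_bound_unit\<close> is \<open>b n\<close>: the
      coefficient of the fixed energy \<open>N ?m\<close> then tends to 0, while that of
      \<open>N (z n)\<close> is 2.\<close>
    have "N (\<lambda>x. ?m x * z n x) \<le> (b n + b n) * N ?m + (1 + b n / b n) * N (z n)"
      using z(3)[of n] by (intro product_bound_unit m z) auto
    hence "c * N (\<lambda>x. ?m x * z n x) \<le> c * ((b n + b n) * N ?m + 2 * N (z n))"
      using z(3)[of n] c by (intro mult_left_mono) auto
    moreover have "(\<lambda>x. \<omega> x * z n x) = (\<lambda>x. c * (?m x * z n x))" using c by auto
    ultimately show ?thesis using form.sqrt_scale_self[OF mz, of c] c(1) by simp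
  qed
  have "(\<lambda>n. c * ((b n + b n) * N ?m + 2 * N (z n))) \<longlonglongrightarrow> c * ((0 + 0) * N ?m + 2 * 0)"
    by (intro tendsto_intros z lim)
  hence 0: "(\<lambda>n. c * ((b n + b n) * N ?m + 2 * N (z n))) \<longlonglongrightarrow> 0" by simp
  show ?thesis
    by (rule tendsto_sandwich[OF _ _ tendsto_const 0])
      (use le form_nonneg B_D mult_B w z(1) in auto)
qed

text \<open>Folding \<open>h\<close> preserves its weighted energy and removes the correction term
  of \<open>G_square_weight\<close> in the limit. The sequence is independent of \<omega>, so that
  different weights can be compared along it.\<close>

lemma weighted_energy_limit:
  assumes h: "h \<in> B"
  shows "\<exists>z. null_seq z \<and>
    (\<forall>\<omega>\<in>B. (\<lambda>n. E (\<lambda>x. \<omega> x * z n x) (\<lambda>x. \<omega> x * z n x)) \<longlonglongrightarrow> G (\<lambda>x. (\<omega> x)\<^sup>2) h h)"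
proof -
  obtain z where z: "\<And>n. fold_equiv h (z n)" "null_seq z" using fold_seq[OF h] by metis
  have B: "z n \<in> B" for n using z by (auto simp: fold_equiv_def)
  have "(\<lambda>n. E (\<lambda>x. \<omega> x * z n x) (\<lambda>x. \<omega> x * z n x)) \<longlonglongrightarrow> G (\<lambda>x. (\<omega> x)\<^sup>2) h h" if w: "\<omega> \<in> B" for \<omega>
  proof -
    note zz = null_seq_mult[OF z(2) z(2)]
    have "(\<lambda>n. E \<omega> (\<lambda>x. \<omega> x * (z n x * z n x))) \<longlonglongrightarrow> 0"
      by (rule E_tendsto_0[where K = "N \<omega>", OF _ _ _ mult_null_seq[OF w zz(2,1)]])
        (use w B B_D B_closed in auto)
    moreover have "E (\<lambda>x. \<omega> x * z n x) (\<lambda>x. \<omega> x * z n x)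
        = G (\<lambda>x. (\<omega> x)\<^sup>2) h h + E \<omega> (\<lambda>x. \<omega> x * (z n x * z n x))" for n
      using G_square_weight[OF w B, of n] z(1)[of n] power2_B[OF w] by (simp add: fold_equiv_def)
    ultimately show ?thesis using tendsto_add[OF tendsto_const, of _ 0] by fastforce
  qed
  thus ?thesis using z(2) by blast
qed

lemma G_nonneg:
  assumes w: "\<omega> \<in> B" and h: "h \<in> B"
  shows "0 \<le> G (\<lambda>x. (\<omega> x)\<^sup>2) h h"
proof -
  obtain z where z: "null_seq z"
    "\<And>\<omega>. \<omega> \<in> B \<Longrightarrow> (\<lambda>n. E (\<lambda>x. \<omega> x * z n x) (\<lambda>x. \<omega> x * z n x)) \<longlonglongrightarrow> G (\<lambda>x. (\<omega> x)\<^sup>2) h h"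
    using weighted_energy_limit[OF h] by blast
  have "z n \<in> B" for n using z by (simp add: null_seq_def)
  thus ?thesis
    by (intro LIMSEQ_le_const[OF z(2)[OF w]]) (use w form_nonneg B_D mult_B in blast)
qed

text \<open>The difference of the weights, (1 - m^2) \<omega>^2, is not visibly the square of an
  element of \<open>B\<close>, because sqrt (1 - m^2) is not a Lipschitz function of m;
  \<open>G_nonneg\<close> therefore does not settle this. Instead the approximating energies are
  compared by \<open>product_bound_unit\<close>, first with \<open>n\<close> to infinity and then
  with \<open>t\<close> to 0.\<close>

lemma G_mono:
  assumes w: "\<omega> \<in> B" and h: "h \<in> B" and m: "m \<in> B" "AE x in M. \<bar>m x\<bar> \<le> 1"
  shows "G (\<lambda>x. (m x * \<omega> x)\<^sup>2) h h \<le> G (\<lambda>x. (\<omega> x)\<^sup>2) h h"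
proof -
  obtain z where z: "null_seq z"
    "\<And>\<omega>. \<omega> \<in> B \<Longrightarrow> (\<lambda>n. E (\<lambda>x. \<omega> x * z n x) (\<lambda>x. \<omega> x * z n x)) \<longlonglongrightarrow> G (\<lambda>x. (\<omega> x)\<^sup>2) h h"
    using weighted_energy_limit[OF h] by blast
  obtain b where b: "\<And>n. z n \<in> B" "b \<longlonglongrightarrow> 0" "\<And>n. b n > 0" "\<And>n. AE x in M. \<bar>z n x\<bar> \<le> b n"
    using null_seqE[OF z(1)] by metis
  obtain c where c: "c > 0" "AE x in M. \<bar>\<omega> x\<bar> \<le> c" using B_boundE w by metis
  have le: "N (\<lambda>x. (m x * \<omega> x) * z n x)
      \<le> (t + c * b n) * N m + (1 + c * b n / t) * N (\<lambda>x. \<omega> x * z n x)" if "t > 0" for n t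
  proof -
    have "N (\<lambda>x. m x * (\<omega> x * z n x))
        \<le> (t + c * b n) * N m + (1 + c * b n / t) * N (\<lambda>x. \<omega> x * z n x)"
    proof (rule product_bound_unit[OF m])
      show "AE x in M. \<bar>\<omega> x * z n x\<bar> \<le> c * b n" using c(2) b(4)[of n]
        by eventually_elim (use c in \<open>auto simp: abs_mult intro!: mult_mono\<close>)
    qed (use w b(1,3)[of n] c that mult_B in auto)
    thus ?thesis by (simp add: mult.assoc)
  qed
  have "sqrt (G (\<lambda>x. (m x * \<omega> x)\<^sup>2) h h) \<le> t * N m + sqrt (G (\<lambda>x. (\<omega> x)\<^sup>2) h h)" if t: "t > 0" for t
  proof (rule LIMSEQ_le)
    show "(\<lambda>n. N (\<lambda>x. (m x * \<omega> x) * z n x)) \<longlonglongrightarrow> sqrt (G (\<lambda>x. (m x * \<omega> x)\<^sup>2) h h)"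
      by (intro tendsto_real_sqrt z(2) mult_B m w)
    have "(\<lambda>n. (t + c * b n) * N m + (1 + c * b n / t) * N (\<lambda>x. \<omega> x * z n x))
        \<longlonglongrightarrow> (t + c * 0) * N m + (1 + c * 0 / t) * sqrt (G (\<lambda>x. (\<omega> x)\<^sup>2) h h)"
      using t by (intro tendsto_intros tendsto_real_sqrt z(2) b(2) w) auto
    thus "(\<lambda>n. (t + c * b n) * N m + (1 + c * b n / t) * N (\<lambda>x. \<omega> x * z n x))
        \<longlonglongrightarrow> t * N m + sqrt (G (\<lambda>x. (\<omega> x)\<^sup>2) h h)" by simp
  qed (use le[OF t] in auto)
  moreover have "((\<lambda>t. t * N m + sqrt (G (\<lambda>x. (\<omega> x)\<^sup>2) h h)) \<longlongrightarrow> 0 * N m + sqrt (G (\<lambda>x. (\<omega> x)\<^sup>2) h h)) (at_right 0)"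
    by (intro tendsto_intros)
  ultimately have "sqrt (G (\<lambda>x. (m x * \<omega> x)\<^sup>2) h h) \<le> 0 * N m + sqrt (G (\<lambda>x. (\<omega> x)\<^sup>2) h h)"
    by (intro tendsto_lowerbound) (auto simp: eventually_at_right_less eventually_mono[OF eventually_at_right_less])
  thus ?thesis by simp
qed

text \<open>Makes Young's inequality available for every weight that is a square; positivity comes
  from the approximation by energies.\<close>

lemma semi_inner_G: "\<omega> \<in> B \<Longrightarrow> semi_inner B (G (\<lambda>x. (\<omega> x)\<^sup>2))"
proof
  assume w: "\<omega> \<in> B"
  show "(\<lambda>x. f x + g x) \<in> B" if "f \<in> B" "g \<in> B" for f g using B_add[OF that] .
  show "(\<lambda>x. c * f x) \<in> B" if "f \<in> B" for f c using B_scale[OF that] .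
  show "0 \<le> G (\<lambda>x. (\<omega> x)\<^sup>2) f f" if "f \<in> B" for f using G_nonneg[OF w that] .
  show "G (\<lambda>x. (\<omega> x)\<^sup>2) f g = G (\<lambda>x. (\<omega> x)\<^sup>2) g f" for f g by (rule G_sym)
qed (simp_all add: G_add G_scale power2_B)

text \<open>Young's inequality for a signed weight dominated by a square. Four times the weight is
  the difference of the squares of \<omega> + m \<omega> and \<omega> - m \<omega>, and the sum of
  these squares is 2 \<omega>^2 + 2 (m \<omega>)^2, which \<open>G_mono\<close> bounds by 4
  \<omega>^2.\<close>

lemma G_cross_weight:
  assumes w: "\<omega> \<in> B" and m: "m \<in> B" "AE x in M. \<bar>m x\<bar> \<le> 1" and f: "f \<in> B" and g: "g \<in> B" and t: "t > 0"
  shows "2 * G (\<lambda>x. (\<omega> x)\<^sup>2 * m x) f g \<le> t * G (\<lambda>x. (\<omega> x)\<^sup>2) f f + G (\<lambda>x. (\<omega> x)\<^sup>2) g g / t"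
proof -
  let ?p = "\<lambda>x. \<omega> x + m x * \<omega> x" and ?q = "\<lambda>x. \<omega> x - m x * \<omega> x" and ?mw = "\<lambda>x. m x * \<omega> x"
  have B: "?mw \<in> B" "?p \<in> B" "?q \<in> B" using w m B_closed by auto
  have "2 * \<bar>G (\<lambda>x. (?p x)\<^sup>2) f g\<bar> \<le> t * G (\<lambda>x. (?p x)\<^sup>2) f f + G (\<lambda>x. (?p x)\<^sup>2) g g / t"
    by (rule semi_inner.young[OF semi_inner_G[OF B(2)] f g t])
  moreover have "2 * \<bar>G (\<lambda>x. (?q x)\<^sup>2) f g\<bar> \<le> t * G (\<lambda>x. (?q x)\<^sup>2) f f + G (\<lambda>x. (?q x)\<^sup>2) g g / t"
    by (rule semi_inner.young[OF semi_inner_G[OF B(3)] f g t])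
  moreover have "4 * G (\<lambda>x. (\<omega> x)\<^sup>2 * m x) f g = G (\<lambda>x. (?p x)\<^sup>2) f g - G (\<lambda>x. (?q x)\<^sup>2) f g"
  proof -
    have "(\<lambda>x. 4 * ((\<omega> x)\<^sup>2 * m x)) = (\<lambda>x. (?p x)\<^sup>2 - (?q x)\<^sup>2)"
      by (simp add: power2_eq_square algebra_simps)
    thus ?thesis
      using G_weight_scale[OF mult_B[OF power2_B[OF w] m(1)] f g, of 4]
        G_weight_diff[OF power2_B[OF B(2)] power2_B[OF B(3)] f g] by simp
  qed
  moreover have par: "G (\<lambda>x. (?p x)\<^sup>2) k k + G (\<lambda>x. (?q x)\<^sup>2) k k \<le> 4 * G (\<lambda>x. (\<omega> x)\<^sup>2) k k" if k: "k \<in> B" for k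
  proof -
    have "(\<lambda>x. (?p x)\<^sup>2 + (?q x)\<^sup>2) = (\<lambda>x. 2 * ((\<omega> x)\<^sup>2 + (?mw x)\<^sup>2))"
      by (simp add: power2_eq_square algebra_simps)
    hence "G (\<lambda>x. (?p x)\<^sup>2) k k + G (\<lambda>x. (?q x)\<^sup>2) k k = 2 * (G (\<lambda>x. (\<omega> x)\<^sup>2) k k + G (\<lambda>x. (?mw x)\<^sup>2) k k)"
      using G_weight_add[OF power2_B[OF B(2)] power2_B[OF B(3)] k k]
        G_weight_scale[OF B_add[OF power2_B[OF w] power2_B[OF B(1)]] k k, of 2]
        G_weight_add[OF power2_B[OF w] power2_B[OF B(1)] k k] by simp
    thus ?thesis using G_mono[OF w k m] by simp
  qed
  moreover have "t * (G (\<lambda>x. (?p x)\<^sup>2) f f + G (\<lambda>x. (?q x)\<^sup>2) f f) \<le> t * (4 * G (\<lambda>x. (\<omega> x)\<^sup>2) f f)"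
    using par[OF f] t by (intro mult_left_mono) auto
  moreover have "(G (\<lambda>x. (?p x)\<^sup>2) g g + G (\<lambda>x. (?q x)\<^sup>2) g g) / t \<le> (4 * G (\<lambda>x. (\<omega> x)\<^sup>2) g g) / t"
    using par[OF g] t by (intro divide_right_mono) auto
  ultimately show ?thesis by (simp add: distrib_left add_divide_distrib)
qed

text \<open>For c = \<rho> \<zeta> the Leibniz rule gives |grad c|^2 = \<rho>^2 |grad \<zeta>|^2 + 2
  \<zeta> grad \<rho> . grad c - \<zeta>^2 |grad \<rho>|^2, weighted by \<phi>^2. Keeping the cross
  term against c instead of \<zeta> gives both sides of Young's inequality the same weight \<phi>^2,
  and the part in c is absorbed on the left.\<close>

lemma G_product_estimate:
  assumes B: "\<phi> \<in> B" "\<rho> \<in> B" "\<zeta> \<in> B" and a: "AE x in M. \<bar>\<zeta> x\<bar> \<le> a" "a > 0" and e: "e > 0"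
  shows "(1 - e) * G (\<lambda>x. (\<phi> x)\<^sup>2) (\<lambda>x. \<rho> x * \<zeta> x) (\<lambda>x. \<rho> x * \<zeta> x)
      \<le> G (\<lambda>x. (\<phi> x * \<rho> x)\<^sup>2) \<zeta> \<zeta> + a\<^sup>2 * G (\<lambda>x. (\<phi> x)\<^sup>2) \<rho> \<rho> / e"
proof -
  let ?c = "\<lambda>x. \<rho> x * \<zeta> x" and ?w = "\<lambda>x. (\<phi> x)\<^sup>2"
  have C: "?c \<in> B" and W: "?w \<in> B" using B mult_B power2_B by auto
  have Wr: "(\<lambda>x. ?w x * \<rho> x) \<in> B" and Wz: "(\<lambda>x. ?w x * \<zeta> x) \<in> B" using W B mult_B by auto
  have 1: "G ?w ?c ?c = G (\<lambda>x. ?w x * \<rho> x) \<zeta> ?c + G (\<lambda>x. ?w x * \<zeta> x) \<rho> ?c"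
    by (rule leibniz[OF W B(2,3) C])
  have 2: "G (\<lambda>x. ?w x * \<rho> x) ?c \<zeta> = G (\<lambda>x. ?w x * \<rho> x * \<rho> x) \<zeta> \<zeta> + G (\<lambda>x. ?w x * \<rho> x * \<zeta> x) \<rho> \<zeta>"
    by (rule leibniz[OF Wr B(2,3,3)])
  have 3: "G (\<lambda>x. ?w x * \<zeta> x) ?c \<rho> = G (\<lambda>x. ?w x * \<zeta> x * \<rho> x) \<zeta> \<rho> + G (\<lambda>x. ?w x * \<zeta> x * \<zeta> x) \<rho> \<rho>"
    by (rule leibniz[OF Wz B(2,3,2)])
  have "G ?w ?c ?c = G (\<lambda>x. (\<phi> x * \<rho> x)\<^sup>2) \<zeta> \<zeta> + 2 * G (\<lambda>x. ?w x * \<zeta> x) \<rho> ?c - G (\<lambda>x. (\<phi> x * \<zeta> x)\<^sup>2) \<rho> \<rho>"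
    using 1 2 3 G_sym[of "\<lambda>x. ?w x * \<rho> x" \<zeta> ?c] G_sym[of "\<lambda>x. ?w x * \<zeta> x" \<rho> ?c]
      G_sym[of "\<lambda>x. ?w x * \<zeta> x * \<rho> x" \<zeta> \<rho>]
    by (simp add: power2_eq_square mult_ac)
  moreover have "0 \<le> G (\<lambda>x. (\<phi> x * \<zeta> x)\<^sup>2) \<rho> \<rho>" using G_nonneg mult_B B by blast
  moreover have "2 * G (\<lambda>x. ?w x * \<zeta> x) \<rho> ?c \<le> a\<^sup>2 * G ?w \<rho> \<rho> / e + e * G ?w ?c ?c"
  proof -
    let ?m = "\<lambda>x. (1 / a) * \<zeta> x"
    \<comment> \<open>The parameter \<open>a / e\<close> is such that, after the normalisation of
      \<zeta> by \<open>a\<close> is undone, the term in \<open>?c\<close> has coefficient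
      \<open>e\<close>.\<close>
    have "2 * G (\<lambda>x. ?w x * ?m x) \<rho> ?c \<le> a / e * G ?w \<rho> \<rho> + G ?w ?c ?c / (a / e)"
    proof (rule G_cross_weight)
      show "?m \<in> B" by (rule B_scale[OF B(3)])
      show "AE x in M. \<bar>?m x\<bar> \<le> 1" using a(1)
        by eventually_elim (use a(2) in \<open>simp add: abs_mult\<close>)
    qed (use B C a e in auto)
    hence "a * (2 * G (\<lambda>x. ?w x * ?m x) \<rho> ?c) \<le> a * (a / e * G ?w \<rho> \<rho> + G ?w ?c ?c / (a / e))"
      using a by (intro mult_left_mono) auto
    moreover have "a * G (\<lambda>x. ?w x * ?m x) \<rho> ?c = G (\<lambda>x. ?w x * \<zeta> x) \<rho> ?c"
    proof -
      have "(\<lambda>x. ?w x * ?m x) = (\<lambda>x. (1 / a) * (?w x * \<zeta> x))" by (simp add: mult_ac)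
      thus ?thesis using G_weight_scale[OF Wz B(2) C, of "1 / a"] a by simp
    qed
    moreover have "a * (a / e * p + q / (a / e)) = a\<^sup>2 * p / e + e * q" for p q
      using a e by (simp add: field_simps power2_eq_square)
    ultimately show ?thesis by (simp only: mult.left_commute[of a 2])
  qed
  ultimately show ?thesis by (simp add: left_diff_distrib)
qed

end

section \<open>Bounded elements of the operator domain\<close>

lemma (in dense_L2_subspace) ae_eq_dense:
  assumes f: "f \<in> L2 M" and g: "g \<in> L2 M" and eq: "\<And>v. v \<in> D \<Longrightarrow> l2_inner M f v = l2_inner M g v"
  shows "AE x in M. f x = g x"
proof -
  let ?h = "\<lambda>x. f x - g x"
  have h: "?h \<in> L2 M" by (rule l2.diff_in[OF f g])
  define a where "a = l2_norm M ?h"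
  have a: "a \<ge> 0" using l2.nonneg[OF h] by (simp add: a_def l2_norm_def)
  have le: "l2_inner M ?h ?h \<le> 0 + e" if e: "e > 0" for e
  proof -
    obtain v where v: "v \<in> D" "l2_norm M (\<lambda>x. ?h x - v x) < e / (a + 1)"
      using dense[OF h, of "e / (a + 1)"] e a by auto
    have vL: "v \<in> L2 M" using v subset_L2 by blast
    have hv: "l2_inner M ?h v = 0" unfolding l2.diff_left[OF f g vL] using eq[OF v(1)] by simp
    have "l2_inner M ?h ?h = l2_inner M ?h (\<lambda>x. ?h x - v x)"
      unfolding l2.diff_right[OF h vL h] hv by simp
    also have "\<dots> \<le> a * l2_norm M (\<lambda>x. ?h x - v x)"
      using l2.cauchy_schwarz[OF h l2.diff_in[OF h vL]] by (simp add: a_def l2_norm_def)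
    also have "\<dots> \<le> a * (e / (a + 1))" using v a by (intro mult_left_mono) auto
    also have "\<dots> \<le> e" using a e by (simp add: field_simps)
    finally show ?thesis by simp
  qed
  have "l2_inner M ?h ?h \<le> 0" by (rule field_le_epsilon[OF le])
  hence "l2_inner M ?h ?h = 0" using l2.nonneg[OF h] by linarith
  thus ?thesis using l2_inner_self_eq_0[OF h] by simp
qed

locale local_form_with_operator = local_dirichlet_form +
  fixes DH :: "('a \<Rightarrow> real) set" and H :: "('a \<Rightarrow> real) \<Rightarrow> ('a \<Rightarrow> real)"
  assumes assoc: "associated_operator M D E DH H"

sublocale local_form_with_operator \<subseteq> op: positive_self_adjoint M DH H
  using assoc by (simp add: associated_operator_def)

context local_form_with_operator
begin

section \<open>The correspondence between form and operator\<close>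

lemma DH_D: "\<phi> \<in> DH \<Longrightarrow> \<phi> \<in> D"
  using assoc by (auto simp: associated_operator_def is_sqrt_operator_def)

lemma sqrt_operator_bilinear:
  "\<exists>S. positive_self_adjoint M D S \<and> DH = {f \<in> D. S f \<in> D} \<and> (\<forall>f\<in>DH. AE x in M. H f x = S (S f) x)
     \<and> (\<forall>f\<in>D. \<forall>g\<in>D. E f g = l2_inner M (S f) (S g))"
proof -
  obtain S where S: "is_sqrt_operator M D S DH H" "\<And>f. f \<in> D \<Longrightarrow> E f f = (l2_norm M (S f))\<^sup>2"
    using assoc unfolding associated_operator_def by blast
  interpret S: positive_self_adjoint M D S using S(1) by (simp add: is_sqrt_operator_def)
  have self: "E f f = l2_inner M (S f) (S f)" if "f \<in> D" for f
    using S(2)[OF that] l2_norm_sq[OF S.op_L2[OF that]] by simp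
  have "E f g = l2_inner M (S f) (S g)" if f: "f \<in> D" and g: "g \<in> D" for f g
  proof -
    note L = S.op_L2[OF f] S.op_L2[OF g]
    have "l2_inner M (S (\<lambda>x. f x + g x)) (S (\<lambda>x. f x + g x))
        = l2_inner M (\<lambda>x. S f x + S g x) (\<lambda>x. S f x + S g x)"
      by (rule l2_inner_cong)
        (use S.op_add[OF f g] L2_measurable[OF l2.add_in[OF L]]
          L2_measurable[OF S.op_L2[OF form.add_in[OF f g]]] in auto)
    thus ?thesis using self[OF form.add_in[OF f g]] self[OF f] self[OF g]
      unfolding form.add_self[OF f g] l2.add_self[OF L] by simp
  qed
  thus ?thesis using S(1) unfolding is_sqrt_operator_def by blast
qed

lemma form_operator:
  assumes "\<phi> \<in> DH" "\<psi> \<in> D"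
  shows "E \<phi> \<psi> = l2_inner M (H \<phi>) \<psi>"
proof -
  obtain S where S: "positive_self_adjoint M D S" "DH = {f \<in> D. S f \<in> D}"
    "\<And>f. f \<in> DH \<Longrightarrow> AE x in M. H f x = S (S f) x"
    "\<And>f g. f \<in> D \<Longrightarrow> g \<in> D \<Longrightarrow> E f g = l2_inner M (S f) (S g)" using sqrt_operator_bilinear by blast
  interpret S: positive_self_adjoint M D S by (rule S(1))
  have \<phi>: "\<phi> \<in> D" "S \<phi> \<in> D" using assms S(2) by auto
  have "E \<phi> \<psi> = l2_inner M (S (S \<phi>)) \<psi>"
    using S(4)[OF \<phi>(1) assms(2)] S.op_symmetric[OF \<phi>(2) assms(2)] by simp
  also have "\<dots> = l2_inner M (H \<phi>) \<psi>"
    by (rule l2_inner_cong)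
      (use S(3)[OF assms(1)] L2_measurable[OF S.op_L2[OF \<phi>(2)]] L2_measurable[OF op.op_L2[OF assms(1)]]
        D_measurable[OF assms(2)] in auto)
  finally show ?thesis .
qed

text \<open>The weak equation places \<open>S u\<close> in the domain of the adjoint of
  \<open>S\<close>, which is \<open>D\<close> by self-adjointness. The value of \<open>H u\<close>
  is then determined by density of \<open>D\<close>.\<close>

lemma operator_memI:
  assumes u: "u \<in> D" and k: "k \<in> L2 M" and eq: "\<And>v. v \<in> D \<Longrightarrow> E u v = l2_inner M k v"
  shows "u \<in> DH" and "AE x in M. H u x = k x"
proof -
  obtain S where S: "positive_self_adjoint M D S" "DH = {f \<in> D. S f \<in> D}"
    "\<And>f g. f \<in> D \<Longrightarrow> g \<in> D \<Longrightarrow> E f g = l2_inner M (S f) (S g)" using sqrt_operator_bilinear by blast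
  interpret S: positive_self_adjoint M D S by (rule S(1))
  have "l2_inner M (S f) (S u) = l2_inner M f k" if "f \<in> D" for f
    using S(3)[OF that u] form_sym[OF that u] eq[OF that] l2.sym[OF k D_L2[OF that]] by simp
  hence "S u \<in> D" by (intro S.adjoint_domain[OF S.op_L2[OF u] k]) auto
  thus uH: "u \<in> DH" using S(2) u by simp
  show "AE x in M. H u x = k x"
    by (rule ae_eq_dense[OF op.op_L2[OF uH] k]) (use form_operator[OF uH] eq in simp)
qed

text \<open>The direct method for \<open>E u u + \<parallel>u - f\<parallel>\<^sup>2\<close>; the unit contraction does not increase this functional,
  so the minimiser \<open>(1 + H)\<^sup>-\<^sup>1 f\<close> can be chosen with the bounds of \<open>f\<close>.\<close>

lemma resolvent_bounded:
  assumes f: "f \<in> L2 M" and fb: "AE x in M. 0 \<le> f x \<and> f x \<le> c" and c: "c > 0"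
  shows "\<exists>u\<in>DH. (AE x in M. \<bar>u x\<bar> \<le> c) \<and> (AE x in M. u x + H u x = f x)"
proof -
  define J where "J = (\<lambda>u. E u u + l2_inner M (\<lambda>x. u x - f x) (\<lambda>x. u x - f x))"
  define I where "I = Inf (J ` D)"
  have uf: "(\<lambda>x. u x - f x) \<in> L2 M" if "u \<in> D" for u by (rule l2.diff_in[OF D_L2[OF that] f])
  have J0: "0 \<le> J u" if "u \<in> D" for u
    using form_nonneg[OF that] l2.nonneg[OF uf[OF that]] by (simp add: J_def)
  have bdd: "bdd_below (J ` D)" by (rule bdd_belowI[of _ 0]) (use J0 in auto)
  have I_le: "I \<le> J u" if "u \<in> D" for u unfolding I_def by (rule cINF_lower[OF bdd that])
  have ex: "\<exists>u\<in>D. J u < I + e" if "e > 0" for e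
    using cInf_lessD[of "J ` D" "I + e"] that zero_mem by (auto simp: I_def)
  obtain u where u: "\<And>n::nat. u n \<in> D" "\<And>n. J (u n) < I + 1 / real (Suc n)"
    using ex[of "1 / real (Suc _)"] by (metis of_nat_0_less_iff zero_less_Suc zero_less_divide_1_iff)
  \<comment> \<open>Parallelogram identity: the midpoint \<open>?w\<close> has functional value at
    least \<open>I\<close>, so two almost minimising elements are close in the graph norm.\<close>
  have cauchy: "(graph_norm M E (\<lambda>x. u m x - u n x))\<^sup>2 \<le> 2 / real (Suc m) + 2 / real (Suc n)" for m n
  proof -
    let ?w = "\<lambda>x. (1 / 2) * (u m x + u n x)" and ?s = "\<lambda>x. u m x + u n x" and ?d = "\<lambda>x. u m x - u n x"
    let ?p = "\<lambda>x. u m x - f x" and ?q = "\<lambda>x. u n x - f x"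
    have s: "?s \<in> D" and d: "?d \<in> D" using u(1) form.closed by auto
    have w: "?w \<in> D" by (rule scale_mem[OF s])
    have p: "?p \<in> L2 M" and q: "?q \<in> L2 M" using uf u by auto
    have "(\<lambda>x. ?w x - f x) = (\<lambda>x. (1 / 2) * (?p x + ?q x))" by (auto simp: field_simps)
    hence "4 * J ?w = E ?s ?s + l2_inner M (\<lambda>x. ?p x + ?q x) (\<lambda>x. ?p x + ?q x)"
      unfolding J_def using form.scale_self[OF s, of "1 / 2"] l2.scale_self[OF l2.add_in[OF p q], of "1 / 2"]
      by (simp add: power2_eq_square)
    moreover have "l2_inner M ?d ?d = l2_inner M (\<lambda>x. ?p x - ?q x) (\<lambda>x. ?p x - ?q x)" by simp
    ultimately have "E ?d ?d + l2_inner M ?d ?d = 2 * J (u m) + 2 * J (u n) - 4 * J ?w"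
      unfolding l2.diff_self[OF p q] l2.add_self[OF p q] form.add_self[OF u(1,1)]
        form.diff_self[OF u(1,1)] J_def by simp
    thus ?thesis using graph_norm_sq[OF d] I_le[OF w] u(2)[of m] u(2)[of n] by simp
  qed
  have "\<exists>K. \<forall>m\<ge>K. \<forall>n\<ge>K. graph_norm M E (\<lambda>x. u m x - u n x) < e" if e: "e > 0" for e
  proof -
    obtain K :: nat where K: "4 / e\<^sup>2 < real K" using reals_Archimedean2 by blast
    have "graph_norm M E (\<lambda>x. u m x - u n x) < e" if "m \<ge> K" "n \<ge> K" for m n
    proof (rule power_less_imp_less_base[where n = 2])
      have K0: "real K > 0" using K e by (meson divide_pos_pos less_trans zero_less_numeral zero_less_power)
      have "2 / real (Suc m) + 2 / real (Suc n) \<le> 2 / real K + 2 / real K"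
        using that K0 by (intro add_mono divide_left_mono) auto
      also have "\<dots> < e\<^sup>2" using K K0 e by (simp add: field_simps)
      finally show "(graph_norm M E (\<lambda>x. u m x - u n x))\<^sup>2 < e\<^sup>2" using cauchy[of m n] by linarith
    qed (use e in simp)
    thus ?thesis by blast
  qed
  from form_closed[OF u(1) this] obtain v where v: "v \<in> D"
    and lim: "(\<lambda>n. graph_norm M E (\<lambda>x. u n x - v x)) \<longlonglongrightarrow> 0" by blast
  \<comment> \<open>Young's inequality for the cross terms replaces a continuity argument for
    \<open>J\<close>; the factor \<open>1 + t\<close> is removed afterwards by letting
    \<open>t\<close> tend to 0.\<close>
  have Jv: "J v \<le> (1 + t) * I" if t: "t > 0" for t
  proof (rule LIMSEQ_le_const)
    have "(\<lambda>n. (1 + t) * (I + 1 / real (Suc n)) + (1 + 1 / t) * (graph_norm M E (\<lambda>x. u n x - v x))\<^sup>2)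
        \<longlonglongrightarrow> (1 + t) * (I + 0) + (1 + 1 / t) * 0\<^sup>2"
      by (intro tendsto_intros lim LIMSEQ_Suc[OF lim_1_over_n])
    thus "(\<lambda>n. (1 + t) * (I + 1 / real (Suc n)) + (1 + 1 / t) * (graph_norm M E (\<lambda>x. u n x - v x))\<^sup>2)
        \<longlonglongrightarrow> (1 + t) * I" by simp
    have "J v \<le> (1 + t) * (I + 1 / real (Suc n)) + (1 + 1 / t) * (graph_norm M E (\<lambda>x. u n x - v x))\<^sup>2" for n
    proof -
      let ?d = "\<lambda>x. u n x - v x" and ?p = "\<lambda>x. u n x - f x"
      have d: "?d \<in> D" and p: "?p \<in> L2 M" using u v uf form.closed by auto
      have "J v = E (\<lambda>x. u n x - ?d x) (\<lambda>x. u n x - ?d x)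
          + l2_inner M (\<lambda>x. ?p x - ?d x) (\<lambda>x. ?p x - ?d x)" by (simp add: J_def)
      also have "\<dots> = J (u n) - 2 * E (u n) ?d - 2 * l2_inner M ?p ?d + (E ?d ?d + l2_inner M ?d ?d)"
        unfolding form.diff_self[OF u(1) d] l2.diff_self[OF p D_L2[OF d]] by (simp add: J_def)
      also have "\<dots> \<le> J (u n) + (t * E (u n) (u n) + E ?d ?d / t)
          + (t * l2_inner M ?p ?p + l2_inner M ?d ?d / t) + (E ?d ?d + l2_inner M ?d ?d)"
        using form.young[OF u(1)[of n] d t] l2.young[OF p D_L2[OF d] t] by linarith
      also have "\<dots> = (1 + t) * J (u n) + (1 + 1 / t) * (E ?d ?d + l2_inner M ?d ?d)"
        by (simp add: J_def algebra_simps add_divide_distrib)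
      also have "\<dots> = (1 + t) * J (u n) + (1 + 1 / t) * (graph_norm M E ?d)\<^sup>2"
        using graph_norm_sq[OF d] by simp
      also have "\<dots> \<le> (1 + t) * (I + 1 / real (Suc n)) + (1 + 1 / t) * (graph_norm M E ?d)\<^sup>2"
        using u(2)[of n] t by (intro add_mono mult_left_mono) auto
      finally show ?thesis .
    qed
    thus "\<exists>N. \<forall>n\<ge>N. J v \<le> (1 + t) * (I + 1 / real (Suc n)) + (1 + 1 / t) * (graph_norm M E (\<lambda>x. u n x - v x))\<^sup>2"
      by blast
  qed
  have "((\<lambda>t. (1 + t) * I) \<longlongrightarrow> (1 + 0) * I) (at_right 0)" by (intro tendsto_intros)
  hence "J v \<le> (1 + 0) * I"
    by (rule tendsto_lowerbound) (use Jv in \<open>auto simp: eventually_at_right_less intro: eventually_mono[OF eventually_at_right_less]\<close>)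
  \<comment> \<open>Since \<open>f\<close> takes its values between 0 and \<open>c\<close>, this
    truncation moves \<open>v\<close> no further from \<open>f\<close>, and it does not increase the
    energy; so \<open>w\<close> is again a minimiser.\<close>
  define w where "w = (\<lambda>x. min (max (v x) 0) c)"
  have w: "w \<in> D" "E w w \<le> E v v" using cut_mem[OF v c] by (auto simp: w_def)
  have "l2_inner M (\<lambda>x. w x - f x) (\<lambda>x. w x - f x) \<le> 1\<^sup>2 * l2_inner M (\<lambda>x. v x - f x) (\<lambda>x. v x - f x)"
  proof (rule l2_inner_mono)
    show "AE x in M. \<bar>w x - f x\<bar> \<le> 1 * \<bar>v x - f x\<bar>" using fb
      by eventually_elim (auto simp: w_def)
  qed (use L2_measurable uf w v in auto)
  hence Jw: "J w \<le> I" using \<open>J v \<le> (1 + 0) * I\<close> w(2) by (simp add: J_def)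
  have fw: "(\<lambda>x. f x - w x) \<in> L2 M" by (rule l2.diff_in[OF f D_L2[OF w(1)]])
  have "E w h = l2_inner M (\<lambda>x. f x - w x) h" if h: "h \<in> D" for h
  proof -
    let ?p = "\<lambda>x. w x - f x"
    have p: "?p \<in> L2 M" using uf w by auto
    define A C where "A = E w h + l2_inner M ?p h" and "C = E h h + l2_inner M h h"
    have C: "C \<ge> 0" using form_nonneg[OF h] l2.nonneg[OF D_L2[OF h]] by (simp add: C_def)
    \<comment> \<open>Variation of the minimiser in direction \<open>h\<close>: \<open>A\<close> is
      half the derivative at 0 and has to vanish.\<close>
    have "0 \<le> 2 * (s * A) + s\<^sup>2 * C" for s
    proof -
      have sh: "(\<lambda>x. s * h x) \<in> D" by (rule scale_mem[OF h])
      have "(\<lambda>x. (w x + s * h x) - f x) = (\<lambda>x. ?p x + s * h x)" by auto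
      hence "J (\<lambda>x. w x + s * h x) = J w + 2 * (s * A) + s\<^sup>2 * C"
        unfolding J_def A_def C_def form.add_self[OF w(1) sh]
        using l2.add_self[OF p D_L2[OF sh]] form.scale_self[OF h, of s] l2.scale_self[OF D_L2[OF h], of s]
          form.scale_right[OF h w(1), of s] l2.scale_right[OF D_L2[OF h] p, of s]
        by (simp add: algebra_simps)
      thus ?thesis using I_le[OF form.add_in[OF w(1) sh]] Jw by simp
    qed
    note * = this
    \<comment> \<open>The optimal value of \<open>s\<close> is \<open>- A / C\<close>; as
      \<open>C\<close> may be 0, the denominator is \<open>C + 1\<close>.\<close>
    define k where "k = C + 1"
    have k: "k \<ge> 1" "C = k - 1" using C by (auto simp: k_def)
    from *[of "- A / k"] have "0 \<le> 2 * (- A / k * A) + (- A / k)\<^sup>2 * C" .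
    also have "\<dots> = - (A\<^sup>2 * (k + 1)) / k\<^sup>2"
      unfolding k(2) using k(1) by (simp add: field_simps power2_eq_square)
    finally have "A\<^sup>2 * (k + 1) \<le> 0" using k(1) by (auto simp: divide_le_0_iff)
    hence "A\<^sup>2 \<le> 0" using k by (simp add: mult_le_0_iff)
    hence "A = 0" by simp
    thus ?thesis unfolding A_def l2.diff_left[OF f D_L2[OF w(1)] D_L2[OF h]]
      l2.diff_left[OF D_L2[OF w(1)] f D_L2[OF h]] by simp
  qed
  hence "w \<in> DH" and H: "AE x in M. H w x = f x - w x"
    using operator_memI[OF w(1) fw] by blast+
  moreover from H have "AE x in M. w x + H w x = f x" by eventually_elim simp
  ultimately show ?thesis using c by (intro bexI[of _ w]) (auto simp: w_def)
qed

section \<open>A core of bounded elements\<close>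

lemma L2_truncate:
  assumes f: "f \<in> L2 M"
  shows "(\<lambda>n. l2_inner M (\<lambda>x. f x - (min (max (f x) 0) (real n) - min (max (- f x) 0) (real n)))
     (\<lambda>x. f x - (min (max (f x) 0) (real n) - min (max (- f x) 0) (real n)))) \<longlonglongrightarrow> 0"
proof -
  let ?r = "\<lambda>n x. f x - (min (max (f x) 0) (real n) - min (max (- f x) 0) (real n))"
  note [measurable] = L2_measurable[OF f]
  have "(\<lambda>n. \<integral>x. ?r n x * ?r n x \<partial>M) \<longlonglongrightarrow> (\<integral>x. 0 \<partial>M)"
  proof (rule integral_dominated_convergence)
    show "integrable M (\<lambda>x. (f x)\<^sup>2)" using f by (simp add: L2_def)
    show "AE x in M. (\<lambda>n. ?r n x * ?r n x) \<longlonglongrightarrow> 0"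
    proof (rule AE_I2, rule tendsto_eventually)
      fix x
      obtain K :: nat where "\<bar>f x\<bar> < real K" using reals_Archimedean2 by blast
      hence "?r n x = 0" if "n \<ge> K" for n using that by (auto simp: min_def max_def)
      thus "\<forall>\<^sub>F n in sequentially. ?r n x * ?r n x = 0"
        unfolding eventually_sequentially by (metis mult_zero_left)
    qed
    show "AE x in M. norm (?r n x * ?r n x) \<le> (f x)\<^sup>2" for n
    proof (rule AE_I2)
      fix x
      have "\<bar>?r n x\<bar> \<le> \<bar>f x\<bar>" by (auto simp: min_def max_def)
      from power_mono[OF this, of 2] show "norm (?r n x * ?r n x) \<le> (f x)\<^sup>2"
        by (simp add: power2_eq_square abs_mult)
    qed
  qed simp_all
  thus ?thesis by (simp add: l2_inner_def)
qed

text \<open>Truncate \<phi> + H \<phi> and apply the resolvent to the positive and negative parts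
  separately, since \<open>resolvent_bounded\<close> needs nonnegative data. This gives a bounded
  \<psi>, and the error in the data controls the error in the graph of \<open>H\<close>.\<close>

lemma bounded_core:
  assumes \<phi>: "\<phi> \<in> DH" and e: "e > 0"
  shows "\<exists>\<psi>\<in>DH. \<psi> \<in> B \<and> l2_norm M (\<lambda>x. \<phi> x - \<psi> x) < e \<and> l2_norm M (\<lambda>x. H \<phi> x - H \<psi> x) < e"
proof -
  define f where "f = (\<lambda>x. \<phi> x + H \<phi> x)"
  have f: "f \<in> L2 M" unfolding f_def using \<phi> DH_D D_L2 op.op_L2 l2.add_in by blast
  have fm: "f \<in> borel_measurable M" by (rule L2_measurable[OF f])
  let ?g = "\<lambda>(n::nat) x. min (max (f x) 0) (real n)" and ?h = "\<lambda>(n::nat) x. min (max (- f x) 0) (real n)"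
  have "\<forall>\<^sub>F n in sequentially. l2_inner M (\<lambda>x. f x - (?g n x - ?h n x)) (\<lambda>x. f x - (?g n x - ?h n x)) < e\<^sup>2"
    using L2_truncate[OF f] e by (intro order_tendstoD(2)[where y = 0]) auto
  then obtain n where n: "n > 0"
    and small: "l2_inner M (\<lambda>x. f x - (?g n x - ?h n x)) (\<lambda>x. f x - (?g n x - ?h n x)) < e\<^sup>2"
    using eventually_conj[OF _ eventually_gt_at_top[of "0::nat"]] eventually_happens' sequentially_bot
    by (smt (verit, ccfv_SIG))
  have gh: "?g n \<in> L2 M" "?h n \<in> L2 M"
    by (rule L2_bound[OF f, where c = 1]; use fm in \<open>auto simp: min_def max_def\<close>)+
  obtain u where u: "u \<in> DH" "AE x in M. \<bar>u x\<bar> \<le> real n" "AE x in M. u x + H u x = ?g n x"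
    using resolvent_bounded[OF gh(1), of "real n"] n by auto
  obtain v where v: "v \<in> DH" "AE x in M. \<bar>v x\<bar> \<le> real n" "AE x in M. v x + H v x = ?h n x"
    using resolvent_bounded[OF gh(2), of "real n"] n by auto
  have sub: "(\<lambda>x. p x - q x) \<in> DH" "AE x in M. H (\<lambda>x. p x - q x) x = H p x - H q x"
    if "p \<in> DH" "q \<in> DH" for p q
  proof -
    have q: "(\<lambda>x. (-1) * q x) \<in> DH" by (rule op.scale_mem[OF that(2)])
    have eq: "(\<lambda>x. p x - q x) = (\<lambda>x. p x + (-1) * q x)" by simp
    show "(\<lambda>x. p x - q x) \<in> DH" unfolding eq by (rule op.add_mem[OF that(1) q])
    show "AE x in M. H (\<lambda>x. p x - q x) x = H p x - H q x"
      unfolding eq using op.op_add[OF that(1) q] op.op_scale[OF that(2), of "-1"]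
      by eventually_elim simp
  qed
  define \<psi> where "\<psi> = (\<lambda>x. u x - v x)"
  have \<psi>: "\<psi> \<in> DH" unfolding \<psi>_def by (rule sub[OF u(1) v(1)])
  have "AE x in M. \<bar>\<psi> x\<bar> \<le> 2 * real n" using u(2) v(2) by eventually_elim (auto simp: \<psi>_def)
  hence \<psi>B: "\<psi> \<in> B" using B_I DH_D \<psi> by blast
  define w where "w = (\<lambda>x. \<phi> x - \<psi> x)"
  define r where "r = (\<lambda>x. f x - (?g n x - ?h n x))"
  have w: "w \<in> DH" unfolding w_def by (rule sub[OF \<phi> \<psi>])
  have r: "r \<in> L2 M" unfolding r_def by (intro l2.diff_in f gh)
  note L = D_L2[OF DH_D[OF w]] op.op_L2[OF w]
  have Hw: "AE x in M. H w x = H \<phi> x - H \<psi> x" unfolding w_def by (rule sub[OF \<phi> \<psi>])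
  have "AE x in M. w x + H w x = r x"
    using Hw sub(2)[OF u(1) v(1), folded \<psi>_def] u(3) v(3)
    by eventually_elim (simp add: w_def r_def f_def \<psi>_def)
  hence "l2_inner M r r = l2_inner M (\<lambda>x. w x + H w x) (\<lambda>x. w x + H w x)"
    by (intro l2_inner_cong) (use L2_measurable[OF r] L2_measurable[OF L(1)] L2_measurable[OF L(2)]
      in \<open>auto elim: eventually_mono\<close>)
  hence "l2_inner M w w + 2 * l2_inner M w (H w) + l2_inner M (H w) (H w) < e\<^sup>2"
    using small unfolding r_def[symmetric] l2.add_self[OF L] by simp
  \<comment> \<open>The cross term is nonnegative because \<open>H\<close> is positive, so one bound
    on the data controls \<open>w\<close> and \<open>H w\<close> at once.\<close>
  hence *: "l2_inner M w w < e\<^sup>2" "l2_inner M (H w) (H w) < e\<^sup>2"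
    using op.op_positive[OF w] l2.sym[OF L] l2.nonneg[OF L(1)] l2.nonneg[OF L(2)] by linarith+
  have "l2_inner M (H w) (H w) = l2_inner M (\<lambda>x. H \<phi> x - H \<psi> x) (\<lambda>x. H \<phi> x - H \<psi> x)"
    by (rule l2_inner_cong) (use Hw L2_measurable[OF L(2)] L2_measurable[OF op.op_L2[OF \<phi>]]
      L2_measurable[OF op.op_L2[OF \<psi>]] in auto)
  hence "l2_norm M w < e" "l2_norm M (\<lambda>x. H \<phi> x - H \<psi> x) < e"
    using * e real_less_lsqrt unfolding l2_norm_def by auto
  thus ?thesis using \<psi> \<psi>B unfolding w_def by blast
qed

end

section \<open>Supports\<close>

lemma closed_ess_supp: "closed (ess_supp M f)"
  unfolding ess_supp_def by (auto intro!: open_Union)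

lemma ess_supp_mono:
  assumes "AE x in M. f x = 0 \<longrightarrow> g x = 0"
  shows "ess_supp M g \<subseteq> ess_supp M f"
proof -
  have "AE x in M. x \<in> U \<longrightarrow> g x = 0" if "AE x in M. x \<in> U \<longrightarrow> f x = 0" for U
    using that assms by eventually_elim auto
  thus ?thesis unfolding ess_supp_def by blast
qed

text \<open>The complement of \<open>ess_supp\<close> is a possibly uncountable union of open sets.
  Sigma-compactness exhausts it by countably many compact sets, each covered by finitely many of the
  open ones.\<close>

lemma ess_supp_zero:
  fixes f :: "'a::metric_space \<Rightarrow> real"
  assumes "sigma_compact_space (euclidean :: 'a topology)"
  shows "AE x in M. x \<notin> ess_supp M f \<longrightarrow> f x = 0"
proof -
  define \<U> where "\<U> = {U. open U \<and> (AE x in M. x \<in> U \<longrightarrow> f x = 0)}"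
  obtain K :: "nat \<Rightarrow> 'a set" where K: "\<And>n. compact (K n)" "(\<Union>n. K n) = UNIV"
    using assms by (auto simp: sigma_compact_space_def)
  \<comment> \<open>The points at distance at least 1 / (m + 1) from the complement of the union:
    closed sets that exhaust the union.\<close>
  define F where "F = (\<lambda>m. - (\<Union>y \<in> - \<Union>\<U>. ball y (1 / real (Suc m))))"
  have F: "closed (F m)" for m unfolding F_def closed_def by (simp add: open_UN)
  have F_sub: "F m \<subseteq> \<Union>\<U>" for m
  proof
    fix x assume x: "x \<in> F m"
    show "x \<in> \<Union>\<U>"
    proof (rule ccontr)
      assume n: "x \<notin> \<Union>\<U>"
      have "x \<in> ball x (1 / real (Suc m))" by simp
      thus False using n x unfolding F_def by blast
    qed
  qed
  have cover: "\<exists>m. x \<in> F m" if x: "x \<in> \<Union>\<U>" for x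
  proof -
    have "open (\<Union>\<U>)" by (auto simp: \<U>_def)
    then obtain e where e: "e > 0" "ball x e \<subseteq> \<Union>\<U>" using x unfolding open_contains_ball by blast
    obtain m where m: "1 / real (Suc m) < e" using e(1) nat_approx_posE by blast
    have "x \<notin> ball y (1 / real (Suc m))" if "y \<notin> \<Union>\<U>" for y
    proof
      assume "x \<in> ball y (1 / real (Suc m))"
      hence "y \<in> ball x e" using m by (simp add: dist_commute)
      thus False using e(2) that by blast
    qed
    hence "x \<in> F m" unfolding F_def by blast
    thus ?thesis by blast
  qed
  have "AE x in M. x \<in> K n \<inter> F m \<longrightarrow> f x = 0" for n m
  proof -
    have "compact (K n \<inter> F m)" using K F by (simp add: compact_Int_closed)
    then obtain \<V> where V: "\<V> \<subseteq> \<U>" "finite \<V>" "K n \<inter> F m \<subseteq> \<Union>\<V>"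
      by (rule compactE[of _ \<U>]) (use F_sub in \<open>auto simp: \<U>_def\<close>)
    have "AE x in M. \<forall>U\<in>\<V>. x \<in> U \<longrightarrow> f x = 0"
      using V by (intro AE_finite_allI) (auto simp: \<U>_def)
    thus ?thesis by eventually_elim (use V(3) in blast)
  qed
  hence "AE x in M. \<forall>n m. x \<in> K n \<inter> F m \<longrightarrow> f x = 0" unfolding AE_all_countable by blast
  thus ?thesis
  proof eventually_elim
    case (elim x)
    show ?case
    proof
      assume "x \<notin> ess_supp M f"
      then obtain m where "x \<in> F m" using cover by (auto simp: ess_supp_def \<U>_def)
      moreover obtain n where "x \<in> K n" using K(2) by blast
      ultimately show "f x = 0" using elim by blast
    qed
  qed
qed

context local_dirichlet_form
begin

text \<open>By locality every term of \<open>G\<close> that contains the difference vanishes. This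
  gives the independence of representative that \<open>truncated_form_loc\<close> relies on.\<close>

lemma G_cong_on_weight:
  assumes "\<xi> \<in> B" "\<psi> \<in> B" "\<psi>' \<in> B" "AE x in M. \<xi> x * (\<psi> x - \<psi>' x) = 0"
  shows "G \<xi> \<psi> \<psi> = G \<xi> \<psi>' \<psi>'"
proof -
  let ?d = "\<lambda>x. \<psi> x - \<psi>' x"
  have d: "?d \<in> B" using assms B_diff by blast
  have 0: "G \<xi> h ?d = 0" if h: "h \<in> B" for h
  proof -
    have "E h (\<lambda>x. \<xi> x * ?d x) = 0" "E ?d (\<lambda>x. \<xi> x * h x) = 0" "E \<xi> (\<lambda>x. h x * ?d x) = 0"
      by (rule product_orthogonal; use assms d h mult_B in \<open>auto elim!: eventually_mono\<close>)+
    thus ?thesis by (simp only: G_def) simp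
  qed
  have "G \<xi> (\<lambda>x. \<psi>' x + ?d x) (\<lambda>x. \<psi>' x + ?d x) = G \<xi> \<psi>' \<psi>'"
    unfolding G_add_self[OF assms(1,3) d] using 0[OF assms(3)] 0[OF d] by simp
  thus ?thesis by simp
qed

lemma G_const_on_weight:
  assumes "\<xi> \<in> B" "\<zeta> \<in> B" "AE x in M. (\<zeta> x - a) * \<xi> x = 0"
  shows "G \<xi> \<zeta> \<zeta> = 0"
proof -
  have "E \<zeta> (\<lambda>x. \<xi> x * \<zeta> x) = 0"
    by (rule orthogonal[where a = a]) (use assms B_D mult_B in \<open>auto elim!: eventually_mono\<close>)
  moreover have "E (\<lambda>x. \<zeta> x * \<zeta> x) \<xi> = 0"
  proof (rule orthogonal)
    show "AE x in M. (\<zeta> x * \<zeta> x - a * a) * \<xi> x = 0" using assms(3)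
      by eventually_elim (auto simp: algebra_simps)
  qed (use assms B_D mult_B in auto)
  ultimately show ?thesis
    using form_sym[OF B_D[OF assms(1)] B_D[OF mult_B[OF assms(2,2)]]] by (simp add: G_def)
qed

end

lemma truncated_form_loc_eq:
  fixes M :: "'a::metric_space measure"
  assumes form: "local_dirichlet_form M D E" and sc: "sigma_compact_space (euclidean :: 'a topology)"
    and \<xi>: "\<xi> \<in> B_form M D" and \<psi>: "\<psi> \<in> B_form M D"
    and eq: "AE x in M. x \<in> ess_supp M \<xi> \<longrightarrow> \<psi> x = \<eta> x"
  shows "truncated_form_loc M D E \<xi> \<eta> = truncated_form E \<xi> \<psi>"
proof -
  interpret local_dirichlet_form M D E by (rule form)
  define \<psi>' where "\<psi>' = (SOME \<psi>'. \<psi>' \<in> B \<and> (AE x in M. x \<in> ess_supp M \<xi> \<longrightarrow> \<psi>' x = \<eta> x))"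
  have \<psi>': "\<psi>' \<in> B \<and> (AE x in M. x \<in> ess_supp M \<xi> \<longrightarrow> \<psi>' x = \<eta> x)"
    unfolding \<psi>'_def by (rule someI[of _ \<psi>]) (use \<psi> eq in simp)
  hence "AE x in M. x \<in> ess_supp M \<xi> \<longrightarrow> \<psi>' x = \<eta> x" by simp
  hence "AE x in M. \<xi> x * (\<psi>' x - \<psi> x) = 0"
    using eq ess_supp_zero[OF sc, of M \<xi>] by eventually_elim auto
  hence "G \<xi> \<psi>' \<psi>' = G \<xi> \<psi> \<psi>" using \<xi> \<psi> \<psi>' by (intro G_cong_on_weight) auto
  thus ?thesis unfolding truncated_form_loc_def truncated_form_G \<psi>'_def .
qed

section \<open>The Rellich inequality\<close>

locale rellich_setting = local_form_with_operator M D E DH H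
  for M :: "'a::metric_space measure" and D E DH H +
  fixes \<eta> :: "'a \<Rightarrow> real" and \<gamma> :: real
  assumes sigma_compact: "sigma_compact_space (euclidean :: 'a topology)"
    and \<eta>_loc: "\<eta> \<in> Bloc_form M D" and \<eta>_nonneg: "AE x in M. 0 \<le> \<eta> x"
    and hardy: "hardy_inequality M D E \<eta>"
    and \<gamma>_pos: "0 < \<gamma>" and \<gamma>_less: "\<gamma> < 1"
    and eikonal: "\<And>\<phi>. \<phi> \<in> Bc_form M D \<Longrightarrow> truncated_form_loc M D E (\<lambda>x. (\<phi> x)\<^sup>2) \<eta>
           \<le> \<gamma> * l2_inner M (\<lambda>x. (\<eta> x)\<^sup>2 * \<phi> x) (\<lambda>x. (\<eta> x)\<^sup>2 * \<phi> x)"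
begin

lemma \<eta>_measurable: "\<eta> \<in> borel_measurable M"
  using \<eta>_loc by (simp add: Bloc_form_def)

lemma Bc_dominated:
  assumes "f \<in> Bc_form M D" "g \<in> B" "AE x in M. f x = 0 \<longrightarrow> g x = 0"
  shows "g \<in> Bc_form M D"
proof -
  have "ess_supp M g = ess_supp M f \<inter> ess_supp M g" using ess_supp_mono[OF assms(3)] by blast
  hence "compact (ess_supp M g)"
    using assms(1) compact_Int_closed[OF _ closed_ess_supp] by (metis (no_types, lifting) Bc_form_def mem_Collect_eq)
  thus ?thesis using assms(2) by (simp add: Bc_form_def)
qed

text \<open>The eikonal hypothesis survives truncation of \<open>\<eta>\<close> at height \<open>a\<close> up to a factor close to \<open>1\<close>: it is
  applied to the weight cut off where \<open>\<eta> \<ge> (1 + \<epsilon>) a\<close>, which by locality does not affect the energy of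
  \<open>min \<eta> a\<close>.\<close>

lemma eikonal_truncated:
  assumes w: "\<omega> \<in> Bc_form M D" and e: "e \<in> B" "AE x in M. 0 \<le> e x"
    and eq: "AE x in M. x \<in> ess_supp M \<omega> \<longrightarrow> e x = \<eta> x" and a: "a > 0" and \<epsilon>: "\<epsilon> > 0"
  defines "\<zeta> \<equiv> (\<lambda>x. min (max (e x) 0) a)"
  shows "G (\<lambda>x. (\<omega> x)\<^sup>2) \<zeta> \<zeta>
    \<le> \<gamma> * (1 + \<epsilon>) ^ 4 * l2_inner M (\<lambda>x. (\<zeta> x)\<^sup>2 * \<omega> x) (\<lambda>x. (\<zeta> x)\<^sup>2 * \<omega> x)"
proof -
  have wB: "\<omega> \<in> B" using w by (simp add: Bc_form_def)
  have \<zeta>: "\<zeta> \<in> B" unfolding \<zeta>_def by (rule B_cut[OF e(1)]) (use a in simp)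
  define k where "k = (\<lambda>x. e x - \<zeta> x)"
  have k: "k \<in> B" unfolding k_def by (rule B_diff[OF e(1) \<zeta>])
  define v where "v = (\<lambda>x. min (max (k x) 0) (\<epsilon> * a))"
  have v: "v \<in> B" unfolding v_def by (rule B_cut[OF k]) (use a \<epsilon> in simp)
  \<comment> \<open>The factor 1 - v / (\<epsilon> a) is a ramp: it is 1 where \<open>e\<close> is
    at most \<open>a\<close> and 0 where \<open>e\<close> is at least (1 + \<epsilon>) a. So
    \<theta> differs from \<omega> only where \<zeta> is constant, and it vanishes where \<eta> is
    much larger than \<zeta>.\<close>
  define \<theta> where "\<theta> = (\<lambda>x. \<omega> x - (1 / (\<epsilon> * a)) * (v x * \<omega> x))"
  have \<theta>: "\<theta> \<in> B" unfolding \<theta>_def by (intro B_diff B_scale mult_B wB v)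
  have \<theta>_zero: "AE x in M. \<omega> x = 0 \<longrightarrow> \<theta> x = 0" by (simp add: \<theta>_def)
  have \<theta>c: "\<theta> \<in> Bc_form M D" by (rule Bc_dominated[OF w \<theta> \<theta>_zero])
  have w2: "(\<lambda>x. (\<omega> x)\<^sup>2) \<in> B" and \<theta>2: "(\<lambda>x. (\<theta> x)\<^sup>2) \<in> B" using power2_B wB \<theta> by auto
  have "G (\<lambda>x. (\<omega> x)\<^sup>2 - (\<theta> x)\<^sup>2) \<zeta> \<zeta> = 0"
  proof (rule G_const_on_weight[OF B_diff[OF w2 \<theta>2] \<zeta>])
    show "AE x in M. (\<zeta> x - a) * ((\<omega> x)\<^sup>2 - (\<theta> x)\<^sup>2) = 0" using e(2)
    proof eventually_elim
      case (elim x)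
      show ?case
      proof (cases "e x < a")
        case True
        hence "v x = 0" using elim a \<epsilon> by (simp add: v_def k_def \<zeta>_def)
        thus ?thesis by (simp add: \<theta>_def)
      next
        case False
        thus ?thesis using a by (simp add: \<zeta>_def)
      qed
    qed
  qed
  hence "G (\<lambda>x. (\<omega> x)\<^sup>2) \<zeta> \<zeta> = G (\<lambda>x. (\<theta> x)\<^sup>2) \<zeta> \<zeta>"
    using G_weight_diff[OF w2 \<theta>2 \<zeta> \<zeta>] by simp
  also have "\<dots> \<le> G (\<lambda>x. (\<theta> x)\<^sup>2) e e"
  proof -
    \<comment> \<open>The excess \<open>k\<close> lives where \<zeta> equals \<open>a\<close>, so
      the energy of \<open>e\<close> splits without a cross term and dominates that of
      \<zeta>.\<close>
    have "G (\<lambda>x. (\<theta> x)\<^sup>2) \<zeta> k = 0"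
    proof (rule G_orthogonal[OF \<theta>2 \<zeta> k])
      show "AE x in M. (\<zeta> x - a) * k x = 0" using e(2)
        by eventually_elim (auto simp: \<zeta>_def k_def min_def max_def)
    qed
    moreover have "e = (\<lambda>x. \<zeta> x + k x)" by (simp add: k_def)
    ultimately have "G (\<lambda>x. (\<theta> x)\<^sup>2) e e = G (\<lambda>x. (\<theta> x)\<^sup>2) \<zeta> \<zeta> + G (\<lambda>x. (\<theta> x)\<^sup>2) k k"
      using G_add_self[OF \<theta>2 \<zeta> k] by simp
    thus ?thesis using G_nonneg[OF \<theta> k] by simp
  qed
  also have "\<dots> = truncated_form_loc M D E (\<lambda>x. (\<theta> x)\<^sup>2) \<eta>"
  proof -
    have "ess_supp M (\<lambda>x. (\<theta> x)\<^sup>2) \<subseteq> ess_supp M \<omega>"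
      by (rule ess_supp_mono) (use \<theta>_zero in \<open>auto elim: eventually_mono\<close>)
    hence "AE x in M. x \<in> ess_supp M (\<lambda>x. (\<theta> x)\<^sup>2) \<longrightarrow> e x = \<eta> x" using eq by auto
    from truncated_form_loc_eq[OF local_dirichlet_form_axioms sigma_compact \<theta>2 e(1) this]
    show ?thesis by (simp add: truncated_form_G)
  qed
  also have "\<dots> \<le> \<gamma> * l2_inner M (\<lambda>x. (\<eta> x)\<^sup>2 * \<theta> x) (\<lambda>x. (\<eta> x)\<^sup>2 * \<theta> x)"
    by (rule eikonal[OF \<theta>c])
  \<comment> \<open>Where \<theta> does not vanish, \<eta> \<le> (1 + \<epsilon>) \<zeta>; the inner
    product contains \<eta> to the fourth power, whence the exponent 4.\<close>
  also have "\<dots> \<le> \<gamma> * (((1 + \<epsilon>)\<^sup>2)\<^sup>2 * l2_inner M (\<lambda>x. (\<zeta> x)\<^sup>2 * \<omega> x) (\<lambda>x. (\<zeta> x)\<^sup>2 * \<omega> x))"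
  proof (intro mult_left_mono l2_inner_mono)
    show "(\<lambda>x. (\<eta> x)\<^sup>2 * \<theta> x) \<in> borel_measurable M" using \<eta>_measurable B_measurable[OF \<theta>] by simp
    show "(\<lambda>x. (\<zeta> x)\<^sup>2 * \<omega> x) \<in> L2 M" by (intro D_L2 B_D mult_B power2_B \<zeta> wB)
    show "AE x in M. \<bar>(\<eta> x)\<^sup>2 * \<theta> x\<bar> \<le> (1 + \<epsilon>)\<^sup>2 * \<bar>(\<zeta> x)\<^sup>2 * \<omega> x\<bar>"
      using e(2) eq ess_supp_zero[OF sigma_compact, of M \<omega>]
    proof eventually_elim
      case (elim x)
      show ?case
      proof (cases "\<omega> x = 0 \<or> k x \<ge> \<epsilon> * a")
        case True
        hence "\<theta> x = 0" using a \<epsilon> by (auto simp: \<theta>_def v_def)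
        thus ?thesis by simp
      next
        case False
        hence ex: "e x = \<eta> x" "k x < \<epsilon> * a" using elim by auto
        have "\<eta> x \<le> (1 + \<epsilon>) * \<zeta> x"
        proof (cases "e x \<le> a")
          case True
          hence "\<zeta> x = \<eta> x" using elim ex(1) by (simp add: \<zeta>_def)
          thus ?thesis using elim ex(1) \<epsilon> by (simp add: distrib_right)
        next
          case False
          hence "\<zeta> x = a" using elim a by (simp add: \<zeta>_def)
          thus ?thesis using ex by (simp add: k_def distrib_right)
        qed
        hence "(\<eta> x)\<^sup>2 \<le> (1 + \<epsilon>)\<^sup>2 * (\<zeta> x)\<^sup>2"
          using power_mono[of "\<eta> x" "(1 + \<epsilon>) * \<zeta> x" 2] elim ex(1) by (simp add: power_mult_distrib)
        moreover have "\<bar>\<theta> x\<bar> \<le> \<bar>\<omega> x\<bar>"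
        proof -
          have "0 \<le> v x" "v x \<le> \<epsilon> * a" using a \<epsilon> by (auto simp: v_def)
          hence "\<bar>1 - v x / (\<epsilon> * a)\<bar> \<le> 1" using a \<epsilon> by (simp add: abs_le_iff divide_le_eq)
          hence "\<bar>1 - v x / (\<epsilon> * a)\<bar> * \<bar>\<omega> x\<bar> \<le> 1 * \<bar>\<omega> x\<bar>" by (intro mult_right_mono) auto
          moreover have "\<theta> x = (1 - v x / (\<epsilon> * a)) * \<omega> x" by (simp add: \<theta>_def left_diff_distrib)
          ultimately show ?thesis by (simp add: abs_mult)
        qed
        ultimately have "(\<eta> x)\<^sup>2 * \<bar>\<theta> x\<bar> \<le> ((1 + \<epsilon>)\<^sup>2 * (\<zeta> x)\<^sup>2) * \<bar>\<omega> x\<bar>"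
          by (intro mult_mono) auto
        thus ?thesis by (simp add: abs_mult mult.assoc)
      qed
    qed
  qed (use \<gamma>_pos in simp)
  finally show ?thesis by (simp add: mult.assoc flip: power_mult)
qed

text \<open>Boundedness of \<phi> places \<phi> \<beta> and \<phi> \<beta>^2 in \<open>D\<close>, so
  that the Hardy inequality and \<open>form_operator\<close> apply to them. The right side is built
  from quantities whose limits along the net are accessible.\<close>

lemma localized_estimate:
  assumes \<phi>: "\<phi> \<in> DH" "\<phi> \<in> B" and \<rho>: "\<rho> \<in> Bc_form M D" "AE x in M. 0 \<le> \<rho> x \<and> \<rho> x \<le> 1"
    and a: "a > 0" and \<epsilon>: "0 < \<epsilon>" "\<epsilon> < 1"
  defines "q \<equiv> (\<lambda>x. (min (\<eta> x) a)\<^sup>2 * (\<rho> x * \<phi> x))"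
  shows "l2_inner M q q \<le> l2_norm M (H \<phi>) * l2_norm M q
    + (\<gamma> * (1 + \<epsilon>) ^ 4 * l2_inner M q q + a\<^sup>2 * truncated_form E (\<lambda>x. (\<phi> x)\<^sup>2) \<rho> / \<epsilon>) / (1 - \<epsilon>)"
proof -
  have \<rho>B: "\<rho> \<in> B" and K: "compact (ess_supp M \<rho>)" using \<rho> by (auto simp: Bc_form_def)
  obtain \<eta>' where \<eta>': "\<eta>' \<in> B" "AE x in M. x \<in> ess_supp M \<rho> \<longrightarrow> \<eta> x = \<eta>' x"
    using \<eta>_loc K by (auto simp: Bloc_form_def)
  \<comment> \<open>The absolute value makes the local representative nonnegative everywhere; on the
    support of \<rho> it still agrees with \<eta>, because \<eta> is nonnegative.\<close>
  define e where "e = (\<lambda>x. \<bar>\<eta>' x\<bar>)"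
  have e: "e \<in> B" "\<And>x. 0 \<le> e x" unfolding e_def using B_abs \<eta>' by auto
  have e\<eta>: "AE x in M. x \<in> ess_supp M \<rho> \<longrightarrow> e x = \<eta> x"
    using \<eta>'(2) \<eta>_nonneg by eventually_elim (auto simp: e_def)
  define \<zeta> where "\<zeta> = (\<lambda>x. min (max (e x) 0) a)"
  have \<zeta>: "\<zeta> \<in> B" unfolding \<zeta>_def by (rule B_cut[OF e(1)]) (use a in simp)
  have \<zeta>a: "AE x in M. \<bar>\<zeta> x\<bar> \<le> a" using a by (simp add: \<zeta>_def)
  have \<zeta>\<eta>: "AE x in M. \<rho> x = 0 \<or> \<eta> x = e x \<and> \<zeta> x = min (\<eta> x) a \<and> 0 \<le> \<zeta> x \<and> \<zeta> x \<le> \<eta> x"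
    using e\<eta> ess_supp_zero[OF sigma_compact, of M \<rho>] by eventually_elim (use e(2) a in \<open>auto simp: \<zeta>_def\<close>)
  define \<beta> where "\<beta> = (\<lambda>x. \<rho> x * \<zeta> x)"
  have \<beta>: "\<beta> \<in> B" unfolding \<beta>_def by (rule mult_B[OF \<rho>B \<zeta>])
  have \<phi>\<beta>: "(\<lambda>x. \<phi> x * \<beta> x) \<in> B" and \<phi>\<beta>\<beta>: "(\<lambda>x. \<phi> x * (\<beta> x * \<beta> x)) \<in> B" and \<phi>\<rho>: "(\<lambda>x. \<phi> x * \<rho> x) \<in> B"
    using \<phi> \<beta> \<rho>B mult_B by auto
  have q'B: "(\<lambda>x. (\<zeta> x)\<^sup>2 * (\<phi> x * \<rho> x)) \<in> B" by (rule mult_B[OF power2_B[OF \<zeta>] \<phi>\<rho>])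
  have qm: "q \<in> borel_measurable M"
    unfolding q_def using \<eta>_measurable B_measurable \<rho>B \<phi> by simp
  have q_eq: "AE x in M. (\<zeta> x)\<^sup>2 * (\<phi> x * \<rho> x) = q x"
    using \<zeta>\<eta> by eventually_elim (auto simp: q_def)
  have q: "q \<in> L2 M" by (rule L2_ae[OF D_L2[OF B_D[OF q'B]] qm q_eq])
  define P where "P = l2_inner M q q"
  define W where "W = G (\<lambda>x. (\<phi> x)\<^sup>2) \<beta> \<beta>"
  have hardy_L2: "(\<lambda>x. \<eta> x * (\<phi> x * \<beta> x)) \<in> L2 M"
    and hardy_le: "l2_inner M (\<lambda>x. \<eta> x * (\<phi> x * \<beta> x)) (\<lambda>x. \<eta> x * (\<phi> x * \<beta> x))
      \<le> E (\<lambda>x. \<phi> x * \<beta> x) (\<lambda>x. \<phi> x * \<beta> x)"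
    using hardy B_D[OF \<phi>\<beta>] unfolding hardy_inequality_def by auto
  \<comment> \<open>The Hardy term contains \<eta> \<zeta> where \<open>q\<close> contains
    \<zeta>^2, and 0 \<le> \<zeta> \<le> \<eta> wherever \<rho> does not vanish.\<close>
  have "P \<le> 1\<^sup>2 * l2_inner M (\<lambda>x. \<eta> x * (\<phi> x * \<beta> x)) (\<lambda>x. \<eta> x * (\<phi> x * \<beta> x))"
    unfolding P_def
  proof (rule l2_inner_mono[OF qm hardy_L2])
    show "AE x in M. \<bar>q x\<bar> \<le> 1 * \<bar>\<eta> x * (\<phi> x * \<beta> x)\<bar>" using \<zeta>\<eta>
    proof eventually_elim
      case (elim x)
      show ?case
      proof (cases "\<rho> x = 0")
        case False
        hence z: "\<zeta> x = min (\<eta> x) a" "0 \<le> \<zeta> x" "\<zeta> x \<le> \<eta> x" using elim by auto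
        have "\<zeta> x * (\<zeta> x * \<bar>\<rho> x * \<phi> x\<bar>) \<le> \<eta> x * (\<zeta> x * \<bar>\<rho> x * \<phi> x\<bar>)"
          using z by (intro mult_right_mono) auto
        thus ?thesis using z unfolding q_def \<beta>_def z(1)[symmetric]
          by (simp add: abs_mult power2_eq_square mult_ac)
      qed (simp add: q_def)
    qed
  qed
  hence 1: "P \<le> E (\<lambda>x. \<phi> x * \<beta> x) (\<lambda>x. \<phi> x * \<beta> x)" using hardy_le by simp
  have 2: "E (\<lambda>x. \<phi> x * \<beta> x) (\<lambda>x. \<phi> x * \<beta> x) = E \<phi> (\<lambda>x. \<phi> x * (\<beta> x * \<beta> x)) + W"
    using G_square_weight[OF \<phi>(2) \<beta>] by (simp add: W_def)
  have 3: "E \<phi> (\<lambda>x. \<phi> x * (\<beta> x * \<beta> x)) \<le> l2_norm M (H \<phi>) * l2_norm M q"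
  proof -
    have "E \<phi> (\<lambda>x. \<phi> x * (\<beta> x * \<beta> x)) = l2_inner M (H \<phi>) (\<lambda>x. \<phi> x * (\<beta> x * \<beta> x))"
      by (rule form_operator[OF \<phi>(1) B_D[OF \<phi>\<beta>\<beta>]])
    also have "\<dots> \<le> l2_norm M (H \<phi>) * l2_norm M (\<lambda>x. \<phi> x * (\<beta> x * \<beta> x))"
      using l2.cauchy_schwarz[OF op.op_L2[OF \<phi>(1)] D_L2[OF B_D[OF \<phi>\<beta>\<beta>]]] by (simp add: l2_norm_def)
    also have "\<dots> \<le> l2_norm M (H \<phi>) * l2_norm M q"
    proof (rule mult_left_mono)
      \<comment> \<open>The test function equals \<rho> q almost everywhere, and \<rho> \<le>
        1.\<close>
      have "l2_inner M (\<lambda>x. \<phi> x * (\<beta> x * \<beta> x)) (\<lambda>x. \<phi> x * (\<beta> x * \<beta> x)) \<le> 1\<^sup>2 * l2_inner M q q"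
      proof (rule l2_inner_mono[OF B_measurable[OF \<phi>\<beta>\<beta>] q])
        show "AE x in M. \<bar>\<phi> x * (\<beta> x * \<beta> x)\<bar> \<le> 1 * \<bar>q x\<bar>" using q_eq \<rho>(2)
        proof eventually_elim
          case (elim x)
          have "\<bar>\<phi> x * (\<beta> x * \<beta> x)\<bar> = \<rho> x * \<bar>q x\<bar>"
            using elim(2) unfolding elim(1)[symmetric] \<beta>_def by (simp add: abs_mult power2_eq_square mult_ac)
          also have "\<dots> \<le> 1 * \<bar>q x\<bar>" using elim(2) by (intro mult_right_mono) auto
          finally show ?case .
        qed
      qed
      thus "l2_norm M (\<lambda>x. \<phi> x * (\<beta> x * \<beta> x)) \<le> l2_norm M q" by (simp add: l2_norm_def)
    qed (use l2.nonneg[OF op.op_L2[OF \<phi>(1)]] in \<open>simp add: l2_norm_def\<close>)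
    finally show ?thesis .
  qed
  have 4: "G (\<lambda>x. (\<phi> x * \<rho> x)\<^sup>2) \<zeta> \<zeta> \<le> \<gamma> * (1 + \<epsilon>) ^ 4 * P"
  proof -
    have c: "(\<lambda>x. \<phi> x * \<rho> x) \<in> Bc_form M D" by (rule Bc_dominated[OF \<rho>(1) \<phi>\<rho>]) simp
    have "ess_supp M (\<lambda>x. \<phi> x * \<rho> x) \<subseteq> ess_supp M \<rho>" by (rule ess_supp_mono) simp
    hence "AE x in M. x \<in> ess_supp M (\<lambda>x. \<phi> x * \<rho> x) \<longrightarrow> e x = \<eta> x" using e\<eta> by auto
    from eikonal_truncated[OF c e(1) _ this a \<epsilon>(1)] e(2)
    have "G (\<lambda>x. (\<phi> x * \<rho> x)\<^sup>2) \<zeta> \<zeta>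
      \<le> \<gamma> * (1 + \<epsilon>) ^ 4 * l2_inner M (\<lambda>x. (\<zeta> x)\<^sup>2 * (\<phi> x * \<rho> x)) (\<lambda>x. (\<zeta> x)\<^sup>2 * (\<phi> x * \<rho> x))"
      by (simp add: \<zeta>_def)
    also have "l2_inner M (\<lambda>x. (\<zeta> x)\<^sup>2 * (\<phi> x * \<rho> x)) (\<lambda>x. (\<zeta> x)\<^sup>2 * (\<phi> x * \<rho> x)) = P"
      unfolding P_def by (rule l2_inner_cong) (use q_eq qm B_measurable[OF q'B] in auto)
    finally show ?thesis .
  qed
  have "(1 - \<epsilon>) * W \<le> G (\<lambda>x. (\<phi> x * \<rho> x)\<^sup>2) \<zeta> \<zeta> + a\<^sup>2 * truncated_form E (\<lambda>x. (\<phi> x)\<^sup>2) \<rho> / \<epsilon>"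
    unfolding W_def \<beta>_def truncated_form_G by (rule G_product_estimate[OF \<phi>(2) \<rho>B \<zeta> \<zeta>a a \<epsilon>(1)])
  hence "(1 - \<epsilon>) * W \<le> \<gamma> * (1 + \<epsilon>) ^ 4 * P + a\<^sup>2 * truncated_form E (\<lambda>x. (\<phi> x)\<^sup>2) \<rho> / \<epsilon>"
    using 4 by linarith
  hence "W \<le> (\<gamma> * (1 + \<epsilon>) ^ 4 * P + a\<^sup>2 * truncated_form E (\<lambda>x. (\<phi> x)\<^sup>2) \<rho> / \<epsilon>) / (1 - \<epsilon>)"
    using \<epsilon>(2) by (simp add: pos_le_divide_eq mult.commute)
  thus ?thesis using 1 2 3 unfolding P_def by linarith
qed

section \<open>Removal of the cut-offs\<close>

lemma truncated_mult_L2: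
  assumes "\<psi> \<in> L2 M" "a > 0"
  shows "(\<lambda>x. (min (\<eta> x) a)\<^sup>2 * \<psi> x) \<in> L2 M"
    and "l2_norm M (\<lambda>x. (min (\<eta> x) a)\<^sup>2 * \<psi> x) \<le> a\<^sup>2 * l2_norm M \<psi>"
proof -
  have m: "(\<lambda>x. (min (\<eta> x) a)\<^sup>2 * \<psi> x) \<in> borel_measurable M"
    using \<eta>_measurable L2_measurable[OF assms(1)] by simp
  have ae: "AE x in M. \<bar>(min (\<eta> x) a)\<^sup>2 * \<psi> x\<bar> \<le> a\<^sup>2 * \<bar>\<psi> x\<bar>" using \<eta>_nonneg
    by eventually_elim (use assms(2) in \<open>auto simp: abs_mult intro!: mult_right_mono power_mono\<close>)
  show "(\<lambda>x. (min (\<eta> x) a)\<^sup>2 * \<psi> x) \<in> L2 M" by (rule L2_bound[OF assms(1) m ae])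
  show "l2_norm M (\<lambda>x. (min (\<eta> x) a)\<^sup>2 * \<psi> x) \<le> a\<^sup>2 * l2_norm M \<psi>"
    using real_sqrt_le_mono[OF l2_inner_mono[OF m assms(1) ae]]
    unfolding l2_norm_def real_sqrt_mult real_sqrt_abs by simp
qed

lemma net_limit:
  fixes F :: "'i filter" and \<rho> :: "'i \<Rightarrow> 'a \<Rightarrow> real"
  assumes \<phi>: "\<phi> \<in> L2 M" and a: "a > 0"
    and \<rho>: "\<And>\<alpha>. \<rho> \<alpha> \<in> borel_measurable M" "\<And>\<alpha>. AE x in M. 0 \<le> \<rho> \<alpha> x \<and> \<rho> \<alpha> x \<le> 1"
    and lim: "((\<lambda>\<alpha>. l2_inner M \<phi> (\<lambda>x. \<rho> \<alpha> x * \<phi> x)) \<longlongrightarrow> l2_inner M \<phi> \<phi>) F"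
  defines "q \<equiv> (\<lambda>\<alpha> x. (min (\<eta> x) a)\<^sup>2 * (\<rho> \<alpha> x * \<phi> x))" and "p \<equiv> (\<lambda>x. (min (\<eta> x) a)\<^sup>2 * \<phi> x)"
  shows "((\<lambda>\<alpha>. l2_inner M (q \<alpha>) (q \<alpha>)) \<longlongrightarrow> l2_inner M p p) F"
proof -
  have \<rho>\<phi>: "(\<lambda>x. \<rho> \<alpha> x * \<phi> x) \<in> L2 M" for \<alpha>
  proof (rule L2_bound[OF \<phi>, where c = 1])
    show "AE x in M. \<bar>\<rho> \<alpha> x * \<phi> x\<bar> \<le> 1 * \<bar>\<phi> x\<bar>" using \<rho>(2)[of \<alpha>]
      by eventually_elim (auto simp: abs_mult intro!: mult_left_le_one_le)
  qed (use \<rho>(1) L2_measurable[OF \<phi>] in simp)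
  have p: "p \<in> L2 M" and q: "q \<alpha> \<in> L2 M" for \<alpha>
    using truncated_mult_L2(1)[OF \<phi> a] truncated_mult_L2(1)[OF \<rho>\<phi> a] by (auto simp: p_def q_def)
  have "\<bar>l2_inner M (q \<alpha>) (q \<alpha>) - l2_inner M p p\<bar>
      \<le> 2 * a ^ 4 * (l2_inner M \<phi> \<phi> - l2_inner M \<phi> (\<lambda>x. \<rho> \<alpha> x * \<phi> x))" for \<alpha>
  proof -
    let ?d = "\<lambda>x. q \<alpha> x * q \<alpha> x - p x * p x" and ?c = "\<lambda>x. \<phi> x * \<phi> x - \<phi> x * (\<rho> \<alpha> x * \<phi> x)"
    have int: "integrable M (\<lambda>x. q \<alpha> x * q \<alpha> x)" "integrable M (\<lambda>x. p x * p x)"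
      "integrable M (\<lambda>x. \<phi> x * \<phi> x)" "integrable M (\<lambda>x. \<phi> x * (\<rho> \<alpha> x * \<phi> x))"
      by (intro L2_mult_integrable p q \<phi> \<rho>\<phi>)+
    have "\<bar>\<integral>x. ?d x \<partial>M\<bar> \<le> (\<integral>x. \<bar>?d x\<bar> \<partial>M)" by (rule integral_abs_bound)
    also have "\<dots> \<le> (\<integral>x. 2 * a ^ 4 * ?c x \<partial>M)"
    proof (rule integral_mono_AE)
      show "AE x in M. \<bar>?d x\<bar> \<le> 2 * a ^ 4 * ?c x" using \<rho>(2)[of \<alpha>] \<eta>_nonneg
      proof eventually_elim
        case (elim x)
        define s where "s = min (\<eta> x) a"
        have "0 \<le> s" "s \<le> a" using elim a by (auto simp: s_def)
        hence s: "0 \<le> s ^ 4" "s ^ 4 \<le> a ^ 4" by (auto intro: power_mono)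
        have r: "0 \<le> (1 - (\<rho> \<alpha> x)\<^sup>2)" "1 - (\<rho> \<alpha> x)\<^sup>2 \<le> 2 * (1 - \<rho> \<alpha> x)"
          using elim power_le_one[of "\<rho> \<alpha> x" 2] zero_le_power2[of "1 - \<rho> \<alpha> x"]
          by (auto simp: power2_diff)
        have "?d x = - (s ^ 4 * (1 - (\<rho> \<alpha> x)\<^sup>2) * (\<phi> x)\<^sup>2)"
          by (simp add: q_def p_def s_def[symmetric] power2_eq_square power4_eq_xxxx algebra_simps)
        hence "\<bar>?d x\<bar> = s ^ 4 * (1 - (\<rho> \<alpha> x)\<^sup>2) * (\<phi> x)\<^sup>2" using s r by simp
        also have "\<dots> \<le> a ^ 4 * (2 * (1 - \<rho> \<alpha> x)) * (\<phi> x)\<^sup>2"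
          using s r by (intro mult_right_mono mult_mono) auto
        also have "\<dots> = 2 * a ^ 4 * ?c x" by (simp add: power2_eq_square algebra_simps)
        finally show ?case .
      qed
    qed (use int in auto)
    also have "\<dots> = 2 * a ^ 4 * (l2_inner M \<phi> \<phi> - l2_inner M \<phi> (\<lambda>x. \<rho> \<alpha> x * \<phi> x))"
      using int by (simp add: l2_inner_def)
    finally show ?thesis using int by (simp add: l2_inner_def)
  qed
  hence "\<forall>\<^sub>F \<alpha> in F. norm (l2_inner M (q \<alpha>) (q \<alpha>) - l2_inner M p p)
      \<le> 2 * a ^ 4 * (l2_inner M \<phi> \<phi> - l2_inner M \<phi> (\<lambda>x. \<rho> \<alpha> x * \<phi> x))"
    by (intro always_eventually allI) simp
  moreover have "((\<lambda>\<alpha>. 2 * a ^ 4 * (l2_inner M \<phi> \<phi> - l2_inner M \<phi> (\<lambda>x. \<rho> \<alpha> x * \<phi> x)))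
      \<longlongrightarrow> 2 * a ^ 4 * (l2_inner M \<phi> \<phi> - l2_inner M \<phi> \<phi>)) F"
    by (intro tendsto_intros lim)
  hence "((\<lambda>\<alpha>. 2 * a ^ 4 * (l2_inner M \<phi> \<phi> - l2_inner M \<phi> (\<lambda>x. \<rho> \<alpha> x * \<phi> x))) \<longlongrightarrow> 0) F"
    by simp
  ultimately have "((\<lambda>\<alpha>. l2_inner M (q \<alpha>) (q \<alpha>) - l2_inner M p p) \<longlongrightarrow> 0) F"
    by (rule Lim_null_comparison)
  thus ?thesis by (rule LIM_zero_cancel)
qed

text \<open>The net limit is taken at fixed \<epsilon>, since the error has coefficient a^2 /
  \<epsilon>; then \<epsilon> tends to 0.\<close>

lemma truncated_rellich_bounded:
  fixes F :: "'i filter" and \<rho> :: "'i \<Rightarrow> 'a \<Rightarrow> real"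
  assumes F: "F \<noteq> bot" and \<rho>: "\<And>\<alpha>. \<rho> \<alpha> \<in> Bc_form M D" "\<And>\<alpha>. AE x in M. 0 \<le> \<rho> \<alpha> x \<and> \<rho> \<alpha> x \<le> 1"
    and lim: "\<And>\<phi>. \<phi> \<in> B \<Longrightarrow> ((\<lambda>\<alpha>. l2_inner M \<phi> (\<lambda>x. \<rho> \<alpha> x * \<phi> x)) \<longlongrightarrow> l2_inner M \<phi> \<phi>) F"
      "\<And>\<phi>. \<phi> \<in> B \<Longrightarrow> ((\<lambda>\<alpha>. truncated_form E (\<lambda>x. (\<phi> x)\<^sup>2) (\<rho> \<alpha>)) \<longlongrightarrow> 0) F"
    and \<phi>: "\<phi> \<in> DH" "\<phi> \<in> B" and a: "a > 0"
  shows "(1 - \<gamma>) * l2_norm M (\<lambda>x. (min (\<eta> x) a)\<^sup>2 * \<phi> x) \<le> l2_norm M (H \<phi>)"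
proof -
  let ?p = "\<lambda>x. (min (\<eta> x) a)\<^sup>2 * \<phi> x" and ?q = "\<lambda>\<alpha> x. (min (\<eta> x) a)\<^sup>2 * (\<rho> \<alpha> x * \<phi> x)"
  define P where "P = l2_inner M ?p ?p"
  define R where "R = l2_norm M ?p"
  define h where "h = l2_norm M (H \<phi>)"
  have pL: "?p \<in> L2 M" by (rule truncated_mult_L2(1)[OF D_L2[OF B_D[OF \<phi>(2)]] a])
  have R: "R \<ge> 0" "P = R\<^sup>2" using l2.nonneg[OF pL] l2_norm_sq[OF pL] by (auto simp: P_def R_def l2_norm_def)
  have h: "h \<ge> 0" using l2.nonneg[OF op.op_L2[OF \<phi>(1)]] by (simp add: h_def l2_norm_def)
  have \<rho>B: "\<rho> \<alpha> \<in> B" for \<alpha> using \<rho>(1)[of \<alpha>] by (simp add: Bc_form_def)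
  have Plim: "((\<lambda>\<alpha>. l2_inner M (?q \<alpha>) (?q \<alpha>)) \<longlongrightarrow> P) F"
    unfolding P_def by (rule net_limit[OF D_L2[OF B_D[OF \<phi>(2)]] a B_measurable[OF \<rho>B] \<rho>(2) lim(1)[OF \<phi>(2)]])
  have Rlim: "((\<lambda>\<alpha>. l2_norm M (?q \<alpha>)) \<longlongrightarrow> R) F"
    using tendsto_real_sqrt[OF Plim] R by (simp add: l2_norm_def)
  have *: "P \<le> h * R + (\<gamma> * (1 + \<epsilon>) ^ 4 * P) / (1 - \<epsilon>)" if \<epsilon>: "0 < \<epsilon>" "\<epsilon> < 1" for \<epsilon>
  proof (rule tendsto_le[OF F _ Plim])
    have "((\<lambda>\<alpha>. h * l2_norm M (?q \<alpha>) + (\<gamma> * (1 + \<epsilon>) ^ 4 * l2_inner M (?q \<alpha>) (?q \<alpha>)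
        + a\<^sup>2 * truncated_form E (\<lambda>x. (\<phi> x)\<^sup>2) (\<rho> \<alpha>) / \<epsilon>) / (1 - \<epsilon>))
      \<longlongrightarrow> h * R + (\<gamma> * (1 + \<epsilon>) ^ 4 * P + a\<^sup>2 * 0 / \<epsilon>) / (1 - \<epsilon>)) F"
      using \<epsilon> by (intro tendsto_intros Plim Rlim lim(2)[OF \<phi>(2)]) auto
    thus "((\<lambda>\<alpha>. h * l2_norm M (?q \<alpha>) + (\<gamma> * (1 + \<epsilon>) ^ 4 * l2_inner M (?q \<alpha>) (?q \<alpha>)
        + a\<^sup>2 * truncated_form E (\<lambda>x. (\<phi> x)\<^sup>2) (\<rho> \<alpha>) / \<epsilon>) / (1 - \<epsilon>))
      \<longlongrightarrow> h * R + (\<gamma> * (1 + \<epsilon>) ^ 4 * P) / (1 - \<epsilon>)) F" by simp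
    show "\<forall>\<^sub>F \<alpha> in F. l2_inner M (?q \<alpha>) (?q \<alpha>) \<le> h * l2_norm M (?q \<alpha>) +
        (\<gamma> * (1 + \<epsilon>) ^ 4 * l2_inner M (?q \<alpha>) (?q \<alpha>)
        + a\<^sup>2 * truncated_form E (\<lambda>x. (\<phi> x)\<^sup>2) (\<rho> \<alpha>) / \<epsilon>) / (1 - \<epsilon>)"
      unfolding h_def by (intro always_eventually allI localized_estimate \<phi> \<rho> a \<epsilon>)
  qed
  have "P \<le> h * R + (\<gamma> * (1 + 0) ^ 4 * P) / (1 - 0)"
  proof (rule tendsto_lowerbound)
    show "((\<lambda>\<epsilon>. h * R + (\<gamma> * (1 + \<epsilon>) ^ 4 * P) / (1 - \<epsilon>))
        \<longlongrightarrow> h * R + (\<gamma> * (1 + 0) ^ 4 * P) / (1 - 0)) (at_right 0)"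
      by (intro tendsto_intros) auto
    show "\<forall>\<^sub>F \<epsilon> in at_right 0. P \<le> h * R + (\<gamma> * (1 + \<epsilon>) ^ 4 * P) / (1 - \<epsilon>)"
      unfolding eventually_at_right_field using * by (intro exI[of _ 1]) auto
  qed simp
  hence "((1 - \<gamma>) * R) * R \<le> h * R" unfolding R(2) by (simp add: algebra_simps power2_eq_square)
  hence "(1 - \<gamma>) * R \<le> h" using R(1) h by (cases "R = 0") auto
  thus ?thesis by (simp add: R_def h_def)
qed

text \<open>Multiplication by the truncated \<eta>^2 is bounded on L2, so the estimate passes from
  the bounded core to all of \<open>DH\<close>.\<close>

lemma truncated_rellich:
  assumes bounded: "\<And>\<psi>. \<psi> \<in> DH \<Longrightarrow> \<psi> \<in> B \<Longrightarrow>
      (1 - \<gamma>) * l2_norm M (\<lambda>x. (min (\<eta> x) a)\<^sup>2 * \<psi> x) \<le> l2_norm M (H \<psi>)"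
    and \<phi>: "\<phi> \<in> DH" and a: "a > 0"
  shows "(1 - \<gamma>) * l2_norm M (\<lambda>x. (min (\<eta> x) a)\<^sup>2 * \<phi> x) \<le> l2_norm M (H \<phi>)"
proof (rule field_le_epsilon)
  fix e :: real assume e: "e > 0"
  \<comment> \<open>The approximation costs \<open>d\<close> through \<open>H\<close> and at most
    \<open>a^2 * d\<close> through the multiplication, together \<open>e\<close>.\<close>
  define d where "d = e / (a\<^sup>2 + 1)"
  have d: "d > 0" using e by (simp add: d_def add_nonneg_pos)
  obtain \<psi> where \<psi>: "\<psi> \<in> DH" "\<psi> \<in> B" "l2_norm M (\<lambda>x. \<phi> x - \<psi> x) < d"
    "l2_norm M (\<lambda>x. H \<phi> x - H \<psi> x) < d" using bounded_core[OF \<phi> d] by blast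
  let ?T = "\<lambda>f x. (min (\<eta> x) a)\<^sup>2 * f x"
  note \<phi>L = D_L2[OF DH_D[OF \<phi>]] and \<psi>L = D_L2[OF DH_D[OF \<psi>(1)]]
  note dL = l2.diff_in[OF \<phi>L \<psi>L]
  have "l2_norm M (\<lambda>x. ?T \<psi> x + ?T (\<lambda>x. \<phi> x - \<psi> x) x)
      \<le> l2_norm M (?T \<psi>) + l2_norm M (?T (\<lambda>x. \<phi> x - \<psi> x))"
    unfolding l2_norm_def by (intro l2.triangle truncated_mult_L2(1) \<psi>L dL a)
  moreover have "(\<lambda>x. ?T \<psi> x + ?T (\<lambda>x. \<phi> x - \<psi> x) x) = ?T \<phi>" by (simp add: algebra_simps)
  moreover have "l2_norm M (?T (\<lambda>x. \<phi> x - \<psi> x)) \<le> a\<^sup>2 * d"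
    using truncated_mult_L2(2)[OF dL a] mult_left_mono[OF less_imp_le[OF \<psi>(3)], of "a\<^sup>2"] by simp
  ultimately have "(1 - \<gamma>) * l2_norm M (?T \<phi>) \<le> (1 - \<gamma>) * (l2_norm M (?T \<psi>) + a\<^sup>2 * d)"
    using \<gamma>_less by (intro mult_left_mono) auto
  also have "\<dots> \<le> l2_norm M (H \<psi>) + 1 * (a\<^sup>2 * d)"
    unfolding distrib_left using \<gamma>_pos d by (intro add_mono bounded \<psi> mult_right_mono) auto
  also have "l2_norm M (H \<psi>) \<le> l2_norm M (H \<phi>) + d"
  proof -
    have "l2_norm M (\<lambda>x. H \<phi> x - (H \<phi> x - H \<psi> x)) \<le> l2_norm M (H \<phi>) + l2_norm M (\<lambda>x. H \<phi> x - H \<psi> x)"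
      unfolding l2_norm_def by (intro l2.triangle_diff l2.diff_in op.op_L2 \<phi> \<psi>)
    thus ?thesis using \<psi>(4) by simp
  qed
  also have "l2_norm M (H \<phi>) + d + 1 * (a\<^sup>2 * d) = l2_norm M (H \<phi>) + d * (a\<^sup>2 + 1)"
    by (simp add: algebra_simps)
  also have "d * (a\<^sup>2 + 1) = e" unfolding d_def by (simp add: add_nonneg_eq_0_iff)
  finally show "(1 - \<gamma>) * l2_norm M (?T \<phi>) \<le> l2_norm M (H \<phi>) + e" by simp
qed

text \<open>The bound does not depend on \<open>a\<close>, so Fatou's lemma gives both the
  integrability, i.e. the inclusion of domains, and the inequality.\<close>

lemma rellich_from_truncated:
  assumes trunc: "\<And>a. a > 0 \<Longrightarrow> (1 - \<gamma>) * l2_norm M (\<lambda>x. (min (\<eta> x) a)\<^sup>2 * \<phi> x) \<le> l2_norm M (H \<phi>)"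
    and \<phi>: "\<phi> \<in> DH"
  shows "(\<lambda>x. (\<eta> x)\<^sup>2 * \<phi> x) \<in> L2 M"
    and "(1 - \<gamma>)\<^sup>2 * l2_inner M (\<lambda>x. (\<eta> x)\<^sup>2 * \<phi> x) (\<lambda>x. (\<eta> x)\<^sup>2 * \<phi> x) \<le> l2_inner M (H \<phi>) (H \<phi>)"
proof -
  let ?t = "\<lambda>n x. (min (\<eta> x) (real (Suc n)))\<^sup>2 * \<phi> x" and ?f = "\<lambda>x. (\<eta> x)\<^sup>2 * \<phi> x"
  note [measurable] = \<eta>_measurable D_measurable[OF DH_D[OF \<phi>]]
  have tL: "?t n \<in> L2 M" for n by (rule truncated_mult_L2(1)[OF D_L2[OF DH_D[OF \<phi>]]]) simp
  define C where "C = l2_inner M (H \<phi>) (H \<phi>) / (1 - \<gamma>)\<^sup>2"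
  have C0: "C \<ge> 0" using l2.nonneg[OF op.op_L2[OF \<phi>]] by (simp add: C_def)
  have C: "l2_inner M (?t n) (?t n) \<le> C" for n
  proof -
    have "((1 - \<gamma>) * l2_norm M (?t n))\<^sup>2 \<le> (l2_norm M (H \<phi>))\<^sup>2"
      using trunc[of "real (Suc n)"] \<gamma>_less l2.nonneg[OF tL[of n]]
      by (intro power_mono mult_nonneg_nonneg) (auto simp: l2_norm_def)
    hence "(1 - \<gamma>)\<^sup>2 * l2_inner M (?t n) (?t n) \<le> l2_inner M (H \<phi>) (H \<phi>)"
      unfolding power_mult_distrib l2_norm_sq[OF tL] l2_norm_sq[OF op.op_L2[OF \<phi>]] .
    thus ?thesis using \<gamma>_less by (simp add: C_def pos_le_divide_eq mult.commute)
  qed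
  have nn_t: "(\<integral>\<^sup>+x. ennreal ((?t n x)\<^sup>2) \<partial>M) \<le> ennreal C" for n
  proof -
    have "(\<integral>\<^sup>+x. ennreal ((?t n x)\<^sup>2) \<partial>M) = ennreal (\<integral>x. (?t n x)\<^sup>2 \<partial>M)"
      by (rule nn_integral_eq_integral) (use tL[of n] in \<open>auto simp: L2_def\<close>)
    also have "\<dots> \<le> ennreal C"
      using C[of n] by (intro ennreal_leI) (simp add: l2_inner_def power2_eq_square)
    finally show ?thesis .
  qed
  have "(\<integral>\<^sup>+x. ennreal ((?f x)\<^sup>2) \<partial>M) = (\<integral>\<^sup>+x. liminf (\<lambda>n. ennreal ((?t n x)\<^sup>2)) \<partial>M)"
  proof (rule nn_integral_cong)
    fix x
    obtain K :: nat where K: "\<eta> x < real K" using reals_Archimedean2 by blast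
    have "\<forall>\<^sub>F n in sequentially. ennreal ((?t n x)\<^sup>2) = ennreal ((?f x)\<^sup>2)"
      using eventually_ge_at_top[of K] by eventually_elim (use K in \<open>simp add: min_absorb1\<close>)
    hence "(\<lambda>n. ennreal ((?t n x)\<^sup>2)) \<longlonglongrightarrow> ennreal ((?f x)\<^sup>2)" by (rule tendsto_eventually)
    thus "ennreal ((?f x)\<^sup>2) = liminf (\<lambda>n. ennreal ((?t n x)\<^sup>2))"
      by (intro lim_imp_Liminf[symmetric]) auto
  qed
  also have "\<dots> \<le> liminf (\<lambda>n. \<integral>\<^sup>+x. ennreal ((?t n x)\<^sup>2) \<partial>M)"
    by (rule nn_integral_liminf) simp
  also have "\<dots> \<le> ennreal C"
    by (rule Liminf_le) (use nn_t in auto)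
  finally have le: "(\<integral>\<^sup>+x. ennreal ((?f x)\<^sup>2) \<partial>M) \<le> ennreal C" .
  have int: "integrable M (\<lambda>x. (?f x)\<^sup>2)"
    by (rule integrableI_nonneg) (use le ennreal_less_top[of C] in \<open>auto intro: le_less_trans\<close>)
  thus fL: "?f \<in> L2 M" by (simp add: L2_def)
  have "ennreal (\<integral>x. (?f x)\<^sup>2 \<partial>M) \<le> ennreal C"
    using le nn_integral_eq_integral[OF int] by simp
  hence "l2_inner M ?f ?f \<le> C" using C0 by (simp add: l2_inner_def power2_eq_square ennreal_le_iff)
  thus "(1 - \<gamma>)\<^sup>2 * l2_inner M ?f ?f \<le> l2_inner M (H \<phi>) (H \<phi>)"
    using \<gamma>_less by (simp add: C_def pos_le_divide_eq mult.commute)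
qed

end


theorem theorem1p1:
  fixes M :: "'a::metric_space measure"
    and D :: "('a \<Rightarrow> real) set" and E :: "('a \<Rightarrow> real) \<Rightarrow> ('a \<Rightarrow> real) \<Rightarrow> real"
    and DH :: "('a \<Rightarrow> real) set" and H :: "('a \<Rightarrow> real) \<Rightarrow> ('a \<Rightarrow> real)"
    and \<eta> :: "'a \<Rightarrow> real" and \<gamma> :: real
    and F :: "'i filter" and \<rho> :: "'i \<Rightarrow> 'a \<Rightarrow> real"
  assumes "locally_compact_space (euclidean :: 'a topology)"
    and "sigma_compact_space (euclidean :: 'a topology)"
    and "radon_measure M" and "full_support M"
    and "dirichlet_form M D E" and "local_form M D E"
    and "Cc_dense_in_C0 M D" and "Cc_dense_in_Bc M D E"
    and "associated_operator M D E DH H"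
    and "\<eta> \<in> Bloc_form M D" and "AE x in M. 0 \<le> \<eta> x"
    and hardy: "hardy_inequality M D E \<eta>"
    and "0 < \<gamma>" and "\<gamma> < 1"
    and eikonal: "\<forall>\<phi>\<in>Bc_form M D. truncated_form_loc M D E (\<lambda>x. (\<phi> x)\<^sup>2) \<eta>
           \<le> \<gamma> * l2_inner M (\<lambda>x. (\<eta> x)\<^sup>2 * \<phi> x) (\<lambda>x. (\<eta> x)\<^sup>2 * \<phi> x)"
    and "F \<noteq> bot"
    and "\<forall>\<alpha>. \<rho> \<alpha> \<in> Bc_form M D" and "\<forall>\<alpha>. AE x in M. 0 \<le> \<rho> \<alpha> x \<and> \<rho> \<alpha> x \<le> 1"
    and "\<forall>\<phi>\<in>B_form M D.
           ((\<lambda>\<alpha>. l2_inner M \<phi> (\<lambda>x. \<rho> \<alpha> x * \<phi> x)) \<longlongrightarrow> l2_inner M \<phi> \<phi>) F \<and>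
           ((\<lambda>\<alpha>. truncated_form E (\<lambda>x. (\<phi> x)\<^sup>2) (\<rho> \<alpha>)) \<longlongrightarrow> 0) F"
  shows "rellich_inequality M DH H \<eta> ((1 - \<gamma>)\<^sup>2)"
proof -
  note net = assms(19) and \<rho> = assms(17,18)
  have form: "local_dirichlet_form M D E"
    using assms(5,6) by (simp add: local_dirichlet_form_def local_dirichlet_form_axioms_def)
  interpret rellich_setting M D E DH H \<eta> \<gamma>
  proof (intro rellich_setting.intro local_form_with_operator.intro form rellich_setting_axioms.intro
        local_form_with_operator_axioms.intro)
    show "truncated_form_loc M D E (\<lambda>x. (\<phi> x)\<^sup>2) \<eta>
        \<le> \<gamma> * l2_inner M (\<lambda>x. (\<eta> x)\<^sup>2 * \<phi> x) (\<lambda>x. (\<eta> x)\<^sup>2 * \<phi> x)" if "\<phi> \<in> Bc_form M D" for \<phi>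
      using eikonal that by blast
  qed (fact assms)+
  have bounded: "(1 - \<gamma>) * l2_norm M (\<lambda>x. (min (\<eta> x) a)\<^sup>2 * \<psi> x) \<le> l2_norm M (H \<psi>)"
    if "\<psi> \<in> DH" "\<psi> \<in> B" "a > 0" for \<psi> a
  proof (rule truncated_rellich_bounded[of F \<rho>])
    show "((\<lambda>\<alpha>. l2_inner M \<phi> (\<lambda>x. \<rho> \<alpha> x * \<phi> x)) \<longlongrightarrow> l2_inner M \<phi> \<phi>) F"
      "((\<lambda>\<alpha>. truncated_form E (\<lambda>x. (\<phi> x)\<^sup>2) (\<rho> \<alpha>)) \<longlongrightarrow> 0) F" if "\<phi> \<in> B" for \<phi>
      using net that by blast+
    show "\<rho> \<alpha> \<in> Bc_form M D" "AE x in M. 0 \<le> \<rho> \<alpha> x \<and> \<rho> \<alpha> x \<le> 1" for \<alpha>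
      using \<rho> by blast+
  qed (fact that \<open>F \<noteq> bot\<close>)+
  have "(1 - \<gamma>) * l2_norm M (\<lambda>x. (min (\<eta> x) a)\<^sup>2 * \<phi> x) \<le> l2_norm M (H \<phi>)"
    if "\<phi> \<in> DH" "a > 0" for \<phi> a
    by (rule truncated_rellich[OF bounded that]) (use that in auto)
  thus ?thesis unfolding rellich_inequality_def using rellich_from_truncated by blast
qed

end
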